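(* Let $d\ge 2$, let $\vec G=(G_i)_{i\ge 1}$ be independent standard Gaussian random variables, and let $$F_n=\sum_{i_1<\cdots<i_d} a_n(i_1,\dots,i_d)\,G_{i_1}\cdots G_{i_d},\qquad n\in\mathbb N,$$ where for each $n$ only finitely many of the real coefficients $a_n(i_1,\dots,i_d)$ are nonzero. Let $s\in\{1,\dots,d-1\}$ and suppose that $\tilde\rho_s(F_n)\to 0$ as $n\to\infty$. Further assume that $(F_n)$ converges in distribution to a probability measure $\mu$. Then there exists a multivariate polynomial $Q$ (possibly in countably many variables) such that the law of $Q(\vec G)$ is $\mu$ and $$\deg(Q)\le \Big\lfloor \frac{d}{s+1}\Big\rfloor .$$
   Context: For $k\in\mathbb N$ and a homogeneous polynomial $F=\sum_{i_1<\cdots<i_d}a_{i_1,\dots,i_d}G_{i_1}\cdots G_{i_d}$ (finitely many nonzero coefficients), the semi-norm $\tilde\rho_k$ is $$\tilde\rho_k(F)=\sup\Big\{\Big\|\sum_{i\ge1}\partial_{G_i}F\,\partial_{G_i}X\Big\|_{L^2}: X=\sum_{i_1<\cdots<i_k}b_{i_1,\dots,i_k}G_{i_1}\cdots G_{i_k},\ \|X\|_{L^2}\le 1\Big\},$$ where $X$ ranges over such sums with finitely many nonzero real coefficients and $\partial_{G_i}$ is the partial derivative with respect to $G_i$. "$Q(\vec G)$ with $\deg Q\le m$" means an element of the $L^2(\mathbf P)$-closure of the linear space of ordinary polynomials of total degree at most $m$ in finitely many of the $G_i$. *)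

theory Defs
  imports "HOL-Probability.Probability" "HOL-Library.Poly_Mapping"
begin

text \<open>Strictly increasing tuples \<open>i\<^sub>1 < \<dots> < i\<^sub>d\<close> are encoded as the \<open>d\<close>-element sets
  \<open>{i\<^sub>1, \<dots>, i\<^sub>d}\<close> of natural numbers; variables are indexed from 0.\<close>

definition increasing_tuples :: "nat \<Rightarrow> nat set set" where
  "increasing_tuples d = {I. finite I \<and> card I = d}"

definition finite_coeffs :: "nat \<Rightarrow> (nat set \<Rightarrow> real) \<Rightarrow> bool" where
  "finite_coeffs d a \<longleftrightarrow> finite {I \<in> increasing_tuples d. a I \<noteq> 0}"

definition hom_poly :: "nat \<Rightarrow> (nat set \<Rightarrow> real) \<Rightarrow> (nat \<Rightarrow> real) \<Rightarrow> real" where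
  "hom_poly d a x = (\<Sum>I \<in> {I \<in> increasing_tuples d. a I \<noteq> 0}. a I * (\<Prod>i\<in>I. x i))"

definition partial_deriv :: "nat \<Rightarrow> ((nat \<Rightarrow> real) \<Rightarrow> real) \<Rightarrow> (nat \<Rightarrow> real) \<Rightarrow> real" where
  "partial_deriv i f x = deriv (\<lambda>t. f (x(i := t))) (x i)"

text \<open>Meaningful only for square-integrable \<open>f\<close>: the Bochner integral is 0 otherwise. Polynomials
  in Gaussian variables are square-integrable.\<close>

definition L2_norm :: "'a measure \<Rightarrow> ('a \<Rightarrow> real) \<Rightarrow> real" where
  "L2_norm M f = sqrt (\<integral>\<omega>. (f \<omega>)\<^sup>2 \<partial>M)"

text \<open>The supremum is taken in the extended reals, so that no boundedness side condition is hidden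
  in it. For \<open>F\<close> and \<open>X\<close> with finitely many nonzero coefficients, only finitely many terms of the
  series over \<open>i\<close> are nonzero.\<close>

definition rho_tilde ::
  "'a measure \<Rightarrow> (nat \<Rightarrow> 'a \<Rightarrow> real) \<Rightarrow> nat \<Rightarrow> ((nat \<Rightarrow> real) \<Rightarrow> real) \<Rightarrow> ereal" where
  "rho_tilde M G k F =
     (SUP b \<in> {b. finite_coeffs k b \<and> L2_norm M (\<lambda>\<omega>. hom_poly k b (\<lambda>i. G i \<omega>)) \<le> 1}.
        ereal (L2_norm M (\<lambda>\<omega>. suminf (\<lambda>i. partial_deriv i F (\<lambda>j. G j \<omega>)
                                         * partial_deriv i (hom_poly k b) (\<lambda>j. G j \<omega>)))))"

text \<open>Polynomials in the variables \<open>x\<^sub>0, x\<^sub>1, \<dots>\<close>: finitely supported maps from exponent vectors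
  to coefficients.\<close>

type_synonym real_mpoly = "(nat \<Rightarrow>\<^sub>0 nat) \<Rightarrow>\<^sub>0 real"

definition mpoly_eval :: "real_mpoly \<Rightarrow> (nat \<Rightarrow> real) \<Rightarrow> real" where
  "mpoly_eval p x =
     (\<Sum>e \<in> Poly_Mapping.keys p. Poly_Mapping.lookup p e *
        (\<Prod>i \<in> Poly_Mapping.keys e. x i ^ Poly_Mapping.lookup e i))"

definition total_degree :: "real_mpoly \<Rightarrow> nat" where
  "total_degree p =
     Max (insert 0 ((\<lambda>e. \<Sum>i \<in> Poly_Mapping.keys e. Poly_Mapping.lookup e i) ` Poly_Mapping.keys p))"

definition L2_poly_closure :: "'a measure \<Rightarrow> (nat \<Rightarrow> 'a \<Rightarrow> real) \<Rightarrow> nat \<Rightarrow> ('a \<Rightarrow> real) set" where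
  "L2_poly_closure M G m =
     {Q \<in> borel_measurable M. integrable M (\<lambda>\<omega>. (Q \<omega>)\<^sup>2) \<and>
        (\<forall>\<epsilon>>0. \<exists>p. total_degree p \<le> m \<and>
           L2_norm M (\<lambda>\<omega>. Q \<omega> - mpoly_eval p (\<lambda>i. G i \<omega>)) < \<epsilon>)}"

end

theory Submission imports Defs "HOL-Real_Asymp.Real_Asymp" begin

text \<open>
  Fix a nonprincipal ultrafilter \<open>U\<close> and regard \<open>L\<^sup>2\<close>-bounded sequences of polynomials of bounded
  degree as vectors, with inner product \<open>lim\<^sub>U E[X\<^sub>n Z\<^sub>n]\<close>. Call a bounded sequence \<open>Y\<close> in the \<open>k\<close>-th
  Wiener chaos prime if it is orthogonal to all products of bounded sequences of chaos orders \<open>i\<close> and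
  \<open>k - i\<close>, \<open>1 \<le> i < k\<close>. Iterating \<open>(j + l - k) E[Y X Z] = 2 \<Sum>\<^sub>i E[Y \<partial>\<^sub>i X \<partial>\<^sub>i Z]\<close>, for \<open>X\<close> and \<open>Z\<close> of chaos
  orders \<open>j\<close> and \<open>l\<close>, shows that the carre du champ operator \<open>\<Gamma>(Y, Y')\<close> of two primes is asymptotically
  constant, so by Stein's identity primes are asymptotically jointly Gaussian.

  A Hilbert projection argument and induction on the degree show that every bounded sequence is a
  limit of polynomials in primes in which a prime of order \<open>k\<close> has weight \<open>k\<close>. The hypothesis on the
  semi-norm forces \<open>\<Gamma>(F, Y) \<rightarrow> 0\<close> for all primes \<open>Y\<close> of order at most \<open>s\<close>; hence \<open>F\<close> is a limit of
  polynomials in primes of order at least \<open>s + 1\<close> of total weight at most \<open>d\<close>, and such a polynomial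
  has degree at most \<open>d div (s + 1)\<close>.
\<close>

section \<open>Smooth functions of finitely many variables\<close>

text \<open>The \<open>F n\<close> may involve ever more variables, so there is no common
  finite-dimensional space in which to take limits. The ultrafilter makes all inner products
  converge at once and turns the question into geometry in a single semi-definite space; the
  \<open>L^2\<close> bound on the \<open>F n\<close> comes from convergence in law. In the limit a
  prime is a Gaussian variable of degree one, whatever its order, and d div (s + 1) counts how many
  weights of size at least s + 1 fit into d. Smallness of the pairings of \<open>Y\<close> with
  products of orders i and k - i must be turned into control for all orders j, l. The integration by
  parts identity lowers j and l together, so it keeps j - l and ends either at j + l = k, the one
  case that needs an assumption, or at j + l < k, where the degree forces zero. Two gaps separate
  the semi-norm from such smallness: it tests only polynomials of order exactly s, and only
  multilinear ones. No constant may depend on the number of variables. Sums over the variables are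
  therefore reassembled into the carre du champ before they are estimated.\<close>

abbreviation D :: "nat \<Rightarrow> ((nat \<Rightarrow> real) \<Rightarrow> real) \<Rightarrow> (nat \<Rightarrow> real) \<Rightarrow> real" where
  "D \<equiv> partial_deriv"

text \<open>The test functions: polynomials and trigonometric functions of polynomials, a class that is
  closed under partial derivatives and composition.\<close>

inductive smooth :: "nat set \<Rightarrow> ((nat \<Rightarrow> real) \<Rightarrow> real) \<Rightarrow> bool" for V where
  smooth_const: "smooth V (\<lambda>x. c)"
| smooth_var: "i \<in> V \<Longrightarrow> smooth V (\<lambda>x. x i)"
| smooth_add: "smooth V f \<Longrightarrow> smooth V g \<Longrightarrow> smooth V (\<lambda>x. f x + g x)"
| smooth_mult: "smooth V f \<Longrightarrow> smooth V g \<Longrightarrow> smooth V (\<lambda>x. f x * g x)"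
| smooth_cos: "smooth V f \<Longrightarrow> smooth V (\<lambda>x. cos (f x))"
| smooth_sin: "smooth V f \<Longrightarrow> smooth V (\<lambda>x. sin (f x))"

definition sm :: "((nat \<Rightarrow> real) \<Rightarrow> real) \<Rightarrow> bool" where
  "sm f \<longleftrightarrow> (\<exists>V. finite V \<and> smooth V f)"

lemma smooth_mono: "smooth V f \<Longrightarrow> V \<subseteq> W \<Longrightarrow> smooth W f"
  by (induction rule: smooth.induct) (auto intro: smooth.intros)

lemma smooth_sum: "(\<And>i. i \<in> A \<Longrightarrow> smooth V (f i)) \<Longrightarrow> smooth V (\<lambda>x. \<Sum>i\<in>A. f i x)"
  by (induction A rule: infinite_finite_induct) (auto intro: smooth.intros)

lemma smooth_imp_sm: "smooth V f \<Longrightarrow> finite V \<Longrightarrow> sm f"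
  by (auto simp: sm_def)

lemma smooth_cong_on: "smooth V f \<Longrightarrow> (\<And>i. i \<in> V \<Longrightarrow> x i = y i) \<Longrightarrow> f x = f y"
  by (induction rule: smooth.induct) auto

lemma sm_common:
  assumes "sm f" "sm g"
  obtains V where "finite V" "smooth V f" "smooth V g"
  using assms unfolding sm_def by (meson finite_UnI smooth_mono sup_ge1 sup_ge2)

lemma sm_const [simp, intro]: "sm (\<lambda>x. c)"
  unfolding sm_def by (blast intro: smooth.intros)

lemma sm_var [simp, intro]: "sm (\<lambda>x. x i)"
  unfolding sm_def by (rule exI[of _ "{i}"]) (auto intro: smooth.intros)

lemma sm_add [simp, intro]: "sm f \<Longrightarrow> sm g \<Longrightarrow> sm (\<lambda>x. f x + g x)"
  by (erule (1) sm_common) (auto simp: sm_def intro: smooth.intros)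

lemma sm_mult [simp, intro]: "sm f \<Longrightarrow> sm g \<Longrightarrow> sm (\<lambda>x. f x * g x)"
  by (erule (1) sm_common) (auto simp: sm_def intro: smooth.intros)

lemma sm_cos [simp, intro]: "sm f \<Longrightarrow> sm (\<lambda>x. cos (f x))"
  by (auto simp: sm_def intro: smooth.intros)

lemma sm_sin [simp, intro]: "sm f \<Longrightarrow> sm (\<lambda>x. sin (f x))"
  by (auto simp: sm_def intro: smooth.intros)

lemma sm_minus [simp, intro]: "sm f \<Longrightarrow> sm (\<lambda>x. - f x)"
  using sm_mult[of "\<lambda>_. -1" f] by simp

lemma sm_diff [simp, intro]: "sm f \<Longrightarrow> sm g \<Longrightarrow> sm (\<lambda>x. f x - g x)"
  using sm_add[of f "\<lambda>x. - g x"] by simp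

lemma sm_divide [simp, intro]: "sm f \<Longrightarrow> sm (\<lambda>x. f x / c)"
  using sm_mult[of f "\<lambda>_. 1 / c"] by simp

lemma sm_power [simp, intro]: "sm f \<Longrightarrow> sm (\<lambda>x. f x ^ n)"
  by (induction n) auto

lemma sm_sum [simp, intro]: "(\<And>i. i \<in> A \<Longrightarrow> sm (f i)) \<Longrightarrow> sm (\<lambda>x. \<Sum>i\<in>A. f i x)"
  by (induction A rule: infinite_finite_induct) auto

lemma smooth_differentiable: "smooth V f \<Longrightarrow> (\<lambda>t. f (x(i := t))) differentiable (at t)"
proof (induction rule: smooth.induct)
  case (smooth_var j)
  then show ?case by (cases "i = j") auto
next
  case (smooth_cos f)
  then obtain d where "((\<lambda>t. f (x(i := t))) has_real_derivative d) (at t)"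
    unfolding real_differentiable_def by blast
  from DERIV_fun_cos[OF this] show ?case
    unfolding real_differentiable_def by blast
next
  case (smooth_sin f)
  then obtain d where "((\<lambda>t. f (x(i := t))) has_real_derivative d) (at t)"
    unfolding real_differentiable_def by blast
  from DERIV_fun_sin[OF this] show ?case
    unfolding real_differentiable_def by blast
qed auto

lemma sm_DERIV:
  assumes "sm f"
  shows "((\<lambda>t. f (x(i := t))) has_real_derivative D i f (x(i := t))) (at t)"
proof -
  obtain d where d: "((\<lambda>t. f (x(i := t))) has_real_derivative d) (at t)"
    using assms smooth_differentiable unfolding sm_def real_differentiable_def by blast
  then show ?thesis
    using DERIV_imp_deriv[OF d] by (simp add: partial_deriv_def)
qed

lemma D_eqI: "((\<lambda>t. f (x(i := t))) has_real_derivative d) (at (x i)) \<Longrightarrow> D i f x = d"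
  by (simp add: partial_deriv_def DERIV_imp_deriv)

lemma sm_DERIV': "sm f \<Longrightarrow> ((\<lambda>t. f (x(i := t))) has_real_derivative D i f x) (at (x i))"
  using sm_DERIV[of f x i "x i"] by simp

lemma D_const [simp]: "D i (\<lambda>x. c) = (\<lambda>x. 0)"
  by (rule ext, rule D_eqI) auto

lemma D_var [simp]: "D i (\<lambda>x. x j) = (\<lambda>x. if i = j then 1 else 0)"
  by (rule ext, rule D_eqI) (auto)

lemma D_add [simp]: "sm f \<Longrightarrow> sm g \<Longrightarrow> D i (\<lambda>x. f x + g x) = (\<lambda>x. D i f x + D i g x)"
  by (rule ext, rule D_eqI, rule DERIV_add) (auto intro: sm_DERIV')

lemma D_mult [simp]: 
  assumes "sm f" "sm g" 
  shows "D i (\<lambda>x. f x * g x) = (\<lambda>x. D i f x * g x + f x * D i g x)"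
proof (rule ext, rule D_eqI)
  fix x
  show "((\<lambda>t. f (x(i := t)) * g (x(i := t))) has_real_derivative D i f x * g x + f x * D i g x) (at (x i))"
    using DERIV_mult[OF sm_DERIV'[OF assms(1), of x i] sm_DERIV'[OF assms(2), of x i]]
    by (simp add: algebra_simps)
qed

lemma D_cos [simp]: assumes "sm f" shows "D i (\<lambda>x. cos (f x)) = (\<lambda>x. - sin (f x) * D i f x)"
proof (rule ext, rule D_eqI)
  fix x
  show "((\<lambda>t. cos (f (x(i := t)))) has_real_derivative - sin (f x) * D i f x) (at (x i))"
    using DERIV_fun_cos[OF sm_DERIV'[OF assms], of x i] by simp
qed

lemma D_sin [simp]: assumes "sm f" shows "D i (\<lambda>x. sin (f x)) = (\<lambda>x. cos (f x) * D i f x)"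
proof (rule ext, rule D_eqI)
  fix x
  show "((\<lambda>t. sin (f (x(i := t)))) has_real_derivative cos (f x) * D i f x) (at (x i))"
    using DERIV_fun_sin[OF sm_DERIV'[OF assms], of x i] by simp
qed

lemma D_cmult [simp]: "sm f \<Longrightarrow> D i (\<lambda>x. c * f x) = (\<lambda>x. c * D i f x)"
  using D_mult[of "\<lambda>_. c" f i] by simp

lemma D_minus [simp]: "sm f \<Longrightarrow> D i (\<lambda>x. - f x) = (\<lambda>x. - D i f x)"
  using D_cmult[of f i "-1"] by simp

lemma D_diff [simp]: "sm f \<Longrightarrow> sm g \<Longrightarrow> D i (\<lambda>x. f x - g x) = (\<lambda>x. D i f x - D i g x)"
  using D_add[of f "\<lambda>x. - g x" i] by simp

lemma D_sum [simp]:
  "(\<And>j. j \<in> A \<Longrightarrow> sm (f j)) \<Longrightarrow> D i (\<lambda>x. \<Sum>j\<in>A. f j x) = (\<lambda>x. \<Sum>j\<in>A. D i (f j) x)"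
  by (induction A rule: infinite_finite_induct) auto

lemma smooth_D:
  assumes "smooth V f" "finite V" shows "smooth V (D i f)"
  using assms(1)
proof (induction rule: smooth.induct)
  case (smooth_cos f)
  have "smooth V (\<lambda>x. (- 1) * sin (f x) * D i f x)"
    by (intro smooth.intros smooth_cos)
  then show ?case using smooth_imp_sm[OF smooth_cos(1) assms(2)] by simp
qed (auto simp: smooth_imp_sm[OF _ assms(2)] intro!: smooth.intros)

lemma sm_D [simp, intro]: "sm f \<Longrightarrow> sm (D i f)"
  unfolding sm_def by (blast intro: smooth_D)

lemma D_outside: "smooth V f \<Longrightarrow> i \<notin> V \<Longrightarrow> D i f = (\<lambda>x. 0)"
proof (rule ext, rule D_eqI)
  fix x assume "smooth V f" "i \<notin> V"
  then have "(\<lambda>t. f (x(i := t))) = (\<lambda>t. f x)"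
    by (intro ext smooth_cong_on[of V f]) auto
  then show "((\<lambda>t. f (x(i := t))) has_real_derivative 0) (at (x i))" by simp
qed

lemma sm_compose:
  assumes "smooth W g" "\<And>i. i \<in> W \<Longrightarrow> sm (\<phi> i)"
  shows "sm (\<lambda>x. g (\<lambda>i. \<phi> i x))"
  using assms(1) by (induction rule: smooth.induct) (auto simp: assms(2))

lemma smooth_compose:
  assumes "smooth W g" "\<And>i. i \<in> W \<Longrightarrow> smooth V (\<phi> i)"
  shows "smooth V (\<lambda>x. g (\<lambda>i. \<phi> i x))"
  using assms(1) by (induction rule: smooth.induct) (auto simp: assms(2) intro!: smooth.intros)

lemma D_compose:
  assumes "smooth W g" "finite W" "\<And>i. i \<in> W \<Longrightarrow> sm (\<phi> i)"
  shows "D j (\<lambda>x. g (\<lambda>i. \<phi> i x)) = (\<lambda>x. \<Sum>i\<in>W. D i g (\<lambda>i. \<phi> i x) * D j (\<phi> i) x)"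
  using assms(1)
proof (induction rule: smooth.induct)
  case (smooth_var k)
  have "(\<Sum>i\<in>W. (if i = k then 1 else 0) * D j (\<phi> i) x) = D j (\<phi> k) x" for x
    using smooth_var assms(2) by (simp add: if_distrib[of "\<lambda>c. c * _"] cong: if_cong)
  then show ?case using assms by simp
next
  case (smooth_add f g)
  note s = smooth_imp_sm[OF _ assms(2)]
  show ?case using smooth_add s[OF smooth_add(1)] s[OF smooth_add(2)]
    sm_compose[OF smooth_add(1) assms(3)] sm_compose[OF smooth_add(2) assms(3)]
    by (simp add: sum.distrib algebra_simps)
next
  case (smooth_mult f g)
  note s = smooth_imp_sm[OF _ assms(2)]
  show ?case using smooth_mult s[OF smooth_mult(1)] s[OF smooth_mult(2)]
    sm_compose[OF smooth_mult(1) assms(3)] sm_compose[OF smooth_mult(2) assms(3)]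
    by (simp add: sum.distrib algebra_simps sum_distrib_left)
next
  case (smooth_cos f)
  show ?case using smooth_cos smooth_imp_sm[OF smooth_cos(1) assms(2)]
    sm_compose[OF smooth_cos(1) assms(3)]
    by (simp add: algebra_simps sum_distrib_left sum_negf)
next
  case (smooth_sin f)
  show ?case using smooth_sin smooth_imp_sm[OF smooth_sin(1) assms(2)]
    sm_compose[OF smooth_sin(1) assms(3)]
    by (simp add: algebra_simps sum_distrib_left)
qed simp

text \<open>The majorant is a product of functions of one coordinate each, so independence makes it
  integrable. All factors are at least 1, hence exponents may be raised freely and such bounds are
  closed under sums and products.\<close>

lemma smooth_bound:
  assumes "smooth V f" "finite V"
  shows "\<exists>C m. 0 \<le> C \<and> (\<forall>x. \<bar>f x\<bar> \<le> C * (\<Prod>i\<in>V. 1 + (x i)\<^sup>2) ^ m)"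
proof -
  define P where "P x = (\<Prod>i\<in>V. 1 + (x i :: real)\<^sup>2)" for x
  have P1: "1 \<le> P x" for x unfolding P_def by (rule prod_ge_1) simp
  have P1m: "1 \<le> P x ^ m" for x m using P1 by simp
  have bdd: "\<exists>C m. 0 \<le> C \<and> (\<forall>x. \<bar>f x\<bar> \<le> C * P x ^ m)" if "\<And>x. \<bar>f x\<bar> \<le> c" for f c
  proof (intro exI conjI allI)
    show "0 \<le> \<bar>c\<bar>" by simp
    show "\<bar>f x\<bar> \<le> \<bar>c\<bar> * P x ^ 0" for x using that[of x] by simp
  qed
  have "\<exists>C m. 0 \<le> C \<and> (\<forall>x. \<bar>f x\<bar> \<le> C * P x ^ m)"
    using assms(1)
  proof (induction rule: smooth.induct)
    case (smooth_const c)
    then show ?case by (rule bdd[of _ "\<bar>c\<bar>"]) simp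
  next
    case (smooth_var i)
    have "\<bar>x i\<bar> \<le> P x" for x
    proof -
      have "P x = (1 + (x i)\<^sup>2) * (\<Prod>j\<in>V - {i}. 1 + (x j)\<^sup>2)"
        unfolding P_def using smooth_var assms(2) by (simp add: prod.remove)
      moreover have "1 \<le> (\<Prod>j\<in>V - {i}. 1 + (x j)\<^sup>2)" by (rule prod_ge_1) simp
      ultimately have "1 + (x i)\<^sup>2 \<le> P x"
        by (smt (verit) mult_left_le mult_le_cancel_left1 zero_le_power2)
      moreover have "\<bar>x i\<bar> \<le> 1 + (x i)\<^sup>2"
        using zero_le_power2[of "\<bar>x i\<bar> - 1"] by (simp add: power2_eq_square algebra_simps)
      ultimately show ?thesis by simp
    qed
    then show ?case by (intro exI[of _ 1] exI[of _ "1::nat"]) auto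
  next
    case (smooth_add f g)
    then obtain C m C' m' where *: "0 \<le> C" "\<And>x. \<bar>f x\<bar> \<le> C * P x ^ m" "0 \<le> C'" "\<And>x. \<bar>g x\<bar> \<le> C' * P x ^ m'"
      by auto
    have "\<bar>f x + g x\<bar> \<le> (C + C') * P x ^ (m + m')" for x
    proof -
      have "C * P x ^ m \<le> C * P x ^ (m + m')" "C' * P x ^ m' \<le> C' * P x ^ (m + m')"
        using * P1[of x] by (auto intro!: mult_left_mono power_increasing)
      then show ?thesis using *(2)[of x] *(4)[of x] by (simp add: algebra_simps)
    qed
    with * show ?case by (intro exI[of _ "C + C'"] exI[of _ "m + m'"]) auto
  next
    case (smooth_mult f g)
    then obtain C m C' m' where *: "0 \<le> C" "\<And>x. \<bar>f x\<bar> \<le> C * P x ^ m" "0 \<le> C'" "\<And>x. \<bar>g x\<bar> \<le> C' * P x ^ m'"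
      by auto
    have "\<bar>f x * g x\<bar> \<le> (C * C') * P x ^ (m + m')" for x
    proof -
      have "\<bar>f x\<bar> * \<bar>g x\<bar> \<le> (C * P x ^ m) * (C' * P x ^ m')"
        using * P1m[of x m] by (intro mult_mono) auto
      then show ?thesis by (simp add: abs_mult power_add algebra_simps)
    qed
    with * show ?case by (intro exI[of _ "C * C'"] exI[of _ "m + m'"]) auto
  next
    case (smooth_cos f)
    then show ?case by (intro bdd[of _ 1]) auto
  next
    case (smooth_sin f)
    then show ?case by (intro bdd[of _ 1]) auto
  qed
  then show ?thesis unfolding P_def .
qed

lemma smooth_measurable:
  assumes "smooth V f" "\<And>i. i \<in> V \<Longrightarrow> (\<lambda>\<omega>. X i \<omega>) \<in> borel_measurable M"
  shows "(\<lambda>\<omega>. f (\<lambda>i. X i \<omega>)) \<in> borel_measurable M"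
  using assms(1) by (induction rule: smooth.induct) (auto simp: assms(2))

section \<open>Gaussian integration by parts\<close>

text \<open>Any filter along which \<open>t\<^sup>2\<close> tends to infinity is allowed, so both
  ends of the line are covered at once. In terms of u = (1 + t^2) / 2 the function is a constant
  multiple of u^m / exp u.\<close>

lemma std_normal_times_power_tendsto_0:
  assumes "filterlim (\<lambda>t::real. t\<^sup>2) at_top F"
  shows "((\<lambda>t. std_normal_density t * (1 + t\<^sup>2) ^ m) \<longlongrightarrow> 0) F"
proof -
  have *: "filterlim (\<lambda>t::real. (1 + t\<^sup>2) / 2) at_top F"
    using filterlim_tendsto_pos_mult_at_top[OF tendsto_const[of "1/2"], of "\<lambda>t. 1 + t\<^sup>2" F]
      filterlim_tendsto_add_at_top[OF tendsto_const[of 1] assms] by simp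
  have "((\<lambda>t::real. ((1 + t\<^sup>2) / 2) ^ m / exp ((1 + t\<^sup>2) / 2)) \<longlongrightarrow> 0) F"
    by (rule filterlim_compose[OF tendsto_power_div_exp_0 *])
  then have "((\<lambda>t::real. (1 / sqrt (2 * pi) * exp (1/2) * 2 ^ m) * (((1 + t\<^sup>2) / 2) ^ m / exp ((1 + t\<^sup>2) / 2))) \<longlongrightarrow> 0) F"
    by (rule tendsto_mult_right_zero)
  moreover have "(1 / sqrt (2 * pi) * exp (1/2) * 2 ^ m) * (((1 + t\<^sup>2) / 2) ^ m / exp ((1 + t\<^sup>2) / 2))
      = std_normal_density t * (1 + t\<^sup>2) ^ m" for t :: real
  proof -
    have e: "exp ((1 + t\<^sup>2) / 2) = exp (1/2) * exp (t\<^sup>2 / 2)"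
      by (simp add: add_divide_distrib exp_add)
    show ?thesis unfolding e
      by (simp add: normal_density_def exp_minus power_divide inverse_eq_divide)
  qed
  ultimately show ?thesis by simp
qed

lemma integrable_std_normal_power:
  "integrable std_normal_distribution (\<lambda>t. (1 + t\<^sup>2) ^ m)"
proof -
  have "integrable lborel (\<lambda>t::real. std_normal_density t * (2 ^ m * (1 + t ^ (2 * m))))"
    using Bochner_Integration.integrable_add[OF integrable_mult_right[OF integrable_std_normal_moment[of 0], of "2 ^ m"]
        integrable_mult_right[OF integrable_std_normal_moment[of "2 * m"], of "2 ^ m"]]
    by (simp add: distrib_left mult_ac)
  then have "integrable lborel (\<lambda>t::real. std_normal_density t * (1 + t\<^sup>2) ^ m)"
  proof (rule Bochner_Integration.integrable_bound)
    have "(1 + t\<^sup>2) ^ m \<le> 2 ^ m * (1 + t ^ (2 * m))" for t :: real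
    proof (cases "t\<^sup>2 \<le> 1")
      case True
      then have "(1 + t\<^sup>2) ^ m \<le> 2 ^ m" by (intro power_mono) auto
      also have "\<dots> \<le> 2 ^ m * (1 + t ^ (2 * m))"
        by (simp add: power_mult)
      finally show ?thesis .
    next
      case False
      then have "(1 + t\<^sup>2) ^ m \<le> (2 * t\<^sup>2) ^ m" by (intro power_mono) auto
      also have "\<dots> \<le> 2 ^ m * (1 + t ^ (2 * m))"
        by (simp add: power_mult power_mult_distrib)
      finally show ?thesis .
    qed
    then show "AE t in lborel. norm (std_normal_density t * (1 + t\<^sup>2) ^ m)
        \<le> norm (std_normal_density t * (2 ^ m * (1 + t ^ (2 * m))))"
      by (intro AE_I2) (auto simp: abs_mult power_mult intro!: mult_left_mono)
  qed simp
  then show ?thesis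
    by (subst integrable_density) auto
qed

text \<open>The derivative of the density \<phi> is - t \<phi>, so \<phi> (h' - t h) is the
  derivative of \<phi> h, whose limits at both infinities vanish by the growth bound.\<close>

lemma std_normal_integration_by_parts:
  fixes h h' :: "real \<Rightarrow> real"
  assumes der: "\<And>t. (h has_real_derivative h' t) (at t)" and cont: "\<And>t. isCont h' t"
    and bd: "\<And>t. \<bar>h t\<bar> \<le> C * (1 + t\<^sup>2) ^ m" "\<And>t. \<bar>h' t\<bar> \<le> C * (1 + t\<^sup>2) ^ m"
  shows "(\<integral>t. t * h t \<partial>std_normal_distribution) = (\<integral>t. h' t \<partial>std_normal_distribution)"
proof -
  have hc: "isCont h t" for t using der DERIV_isCont by blast
  have [measurable]: "h \<in> borel_measurable borel" "h' \<in> borel_measurable borel"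
    using hc cont by (auto intro!: borel_measurable_continuous_onI continuous_at_imp_continuous_on)
  have C: "0 \<le> C" using bd(1)[of 0] by auto
  have ih': "integrable std_normal_distribution h'"
  proof (rule Bochner_Integration.integrable_bound[OF integrable_mult_right[OF integrable_std_normal_power[of m], of C]])
    show "AE t in std_normal_distribution. norm (h' t) \<le> norm (C * (1 + t\<^sup>2) ^ m)"
      using bd(2) C by (intro AE_I2) (auto simp: abs_mult)
  qed simp
  have ih: "integrable std_normal_distribution (\<lambda>t. t * h t)"
  proof (rule Bochner_Integration.integrable_bound[OF integrable_mult_right[OF integrable_std_normal_power[of "Suc m"], of C]])
    have "\<bar>t * h t\<bar> \<le> C * (1 + t\<^sup>2) ^ Suc m" for t
    proof -
      have "\<bar>t\<bar> \<le> 1 + t\<^sup>2"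
        using zero_le_power2[of "\<bar>t\<bar> - 1"] by (simp add: power2_eq_square algebra_simps)
      then have "\<bar>t\<bar> * \<bar>h t\<bar> \<le> (1 + t\<^sup>2) * (C * (1 + t\<^sup>2) ^ m)"
        using bd(1)[of t] by (intro mult_mono) auto
      then show ?thesis by (simp add: abs_mult algebra_simps)
    qed
    then show "AE t in std_normal_distribution. norm (t * h t) \<le> norm (C * (1 + t\<^sup>2) ^ Suc m)"
      using C by (intro AE_I2) (auto simp: abs_mult)
  qed simp
  define f where "f t = std_normal_density t * (h' t - t * h t)" for t
  define F where "F t = std_normal_density t * h t" for t
  have int_f: "integrable lborel f"
  proof -
    have "integrable std_normal_distribution (\<lambda>t. h' t - t * h t)" using ih ih' by auto
    then show ?thesis unfolding f_def by (subst (asm) integrable_density) auto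
  qed
  have dF: "(F has_real_derivative f t) (at t)" for t
  proof -
    have sd: "std_normal_density = (\<lambda>t. 1 / sqrt (2 * pi) * exp (- (t\<^sup>2) / 2))"
      by (simp add: fun_eq_iff normal_density_def)
    show ?thesis
      unfolding F_def[abs_def] f_def sd
      by (rule derivative_eq_intros der refl | simp add: algebra_simps diff_divide_distrib)+
  qed
  have F0: "(F \<longlongrightarrow> 0) l" if "filterlim (\<lambda>t::real. t\<^sup>2) at_top l" for l
  proof (rule Lim_null_comparison)
    show "\<forall>\<^sub>F t in l. norm (F t) \<le> C * (std_normal_density t * (1 + t\<^sup>2) ^ m)"
    proof (intro always_eventually allI)
      fix t
      have "std_normal_density t * \<bar>h t\<bar> \<le> std_normal_density t * (C * (1 + t\<^sup>2) ^ m)"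
        using bd(1)[of t] by (intro mult_left_mono) auto
      then show "norm (F t) \<le> C * (std_normal_density t * (1 + t\<^sup>2) ^ m)"
        by (simp add: F_def abs_mult algebra_simps)
    qed
    show "((\<lambda>t. C * (std_normal_density t * (1 + t\<^sup>2) ^ m)) \<longlongrightarrow> 0) l"
      by (rule tendsto_mult_right_zero[OF std_normal_times_power_tendsto_0[OF that]])
  qed
  have "(LBINT t=-\<infinity>..\<infinity>. f t) = 0 - 0"
  proof (rule interval_integral_FTC_integrable[where F = F])
    show "(F has_vector_derivative f t) (at t)" for t
      using dF by (simp add: has_real_derivative_iff_has_vector_derivative)
    show "isCont f t" for t
      unfolding f_def normal_density_def using hc cont
      by (intro continuous_intros) auto
    show "set_integrable lborel (einterval (-\<infinity>) \<infinity>) f"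
      using int_f by (simp add: set_integrable_def)
    show "((F \<circ> real_of_ereal) \<longlongrightarrow> 0) (at_right (-\<infinity>))"
      unfolding ereal_tendsto_simps by (rule F0) real_asymp
    show "((F \<circ> real_of_ereal) \<longlongrightarrow> 0) (at_left \<infinity>)"
      unfolding ereal_tendsto_simps by (rule F0) real_asymp
  qed simp
  then have "(\<integral>t. f t \<partial>lborel) = 0"
    by (simp add: interval_lebesgue_integral_def set_lebesgue_integral_def)
  then have "(\<integral>t. h' t - t * h t \<partial>std_normal_distribution) = 0"
    unfolding f_def by (subst integral_density) auto
  then show ?thesis using ih ih' by simp
qed

section \<open>Expectations of functions of independent standard Gaussians\<close>

locale gaussian_family = prob_space M for M :: "'a measure" +
  fixes G :: "nat \<Rightarrow> 'a \<Rightarrow> real"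
  assumes indep: "indep_vars (\<lambda>_. borel) G UNIV"
    and law: "\<And>i. distr M borel (G i) = std_normal_distribution"
begin

text \<open>Random variables enter as functions of the whole coordinate sequence, so that partial
  derivatives make sense.\<close>

definition E :: "((nat \<Rightarrow> real) \<Rightarrow> real) \<Rightarrow> real" where
  "E f = (\<integral>\<omega>. f (\<lambda>i. G i \<omega>) \<partial>M)"

lemma G_measurable [measurable]: "G i \<in> borel_measurable M"
  using indep by (auto simp: indep_vars_def)

lemma sm_measurable [measurable]: "sm f \<Longrightarrow> (\<lambda>\<omega>. f (\<lambda>i. G i \<omega>)) \<in> borel_measurable M"
  unfolding sm_def using smooth_measurable[where X = G and M = M] by auto

lemma integrable_prod_power:
  assumes "finite V"
  shows "integrable M (\<lambda>\<omega>. (\<Prod>i\<in>V. 1 + (G i \<omega>)\<^sup>2) ^ m)"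
proof -
  have "integrable M (\<lambda>\<omega>. \<Prod>i\<in>V. (1 + (G i \<omega>)\<^sup>2) ^ m)"
  proof (rule indep_vars_integrable)
    show "indep_vars (\<lambda>_. borel) (\<lambda>i \<omega>. (1 + (G i \<omega>)\<^sup>2) ^ m) V"
      by (rule indep_vars_compose2[OF indep_vars_subset[OF indep]]) auto
    show "integrable M (\<lambda>\<omega>. (1 + (G i \<omega>)\<^sup>2) ^ m)" for i
      using integrable_std_normal_power[of m] unfolding law[of i, symmetric]
      by (subst (asm) integrable_distr_eq) auto
  qed fact
  then show ?thesis by (simp add: prod_power_distrib)
qed

lemma sm_integrable [simp]:
  assumes "sm f" shows "integrable M (\<lambda>\<omega>. f (\<lambda>i. G i \<omega>))"
proof -
  obtain V C m where V: "finite V" "0 \<le> C" "\<And>x. \<bar>f x\<bar> \<le> C * (\<Prod>i\<in>V. 1 + (x i)\<^sup>2) ^ m"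
    using assms smooth_bound unfolding sm_def by blast
  show ?thesis
  proof (rule Bochner_Integration.integrable_bound[OF integrable_mult_right[OF integrable_prod_power[OF V(1), of m], of C]])
    show "(\<lambda>\<omega>. f (\<lambda>i. G i \<omega>)) \<in> borel_measurable M" using assms by (rule sm_measurable)
    show "AE \<omega> in M. norm (f (\<lambda>i. G i \<omega>)) \<le> norm (C * (\<Prod>i\<in>V. 1 + (G i \<omega>)\<^sup>2) ^ m)"
      using V(2,3) by (intro AE_I2) (auto intro: order_trans[OF _ abs_ge_self])
  qed
qed

lemma E_const [simp]: "E (\<lambda>x. c) = c"
  by (simp add: E_def prob_space)

lemma E_add [simp]: "sm f \<Longrightarrow> sm g \<Longrightarrow> E (\<lambda>x. f x + g x) = E f + E g"
  by (simp add: E_def)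

lemma E_diff [simp]: "sm f \<Longrightarrow> sm g \<Longrightarrow> E (\<lambda>x. f x - g x) = E f - E g"
  by (simp add: E_def)

lemma E_minus [simp]: "E (\<lambda>x. - f x) = - E f"
  by (simp add: E_def)

lemma E_cmult [simp]: "E (\<lambda>x. c * f x) = c * E f"
  by (simp add: E_def)

lemma E_sum [simp]: "(\<And>i. i \<in> A \<Longrightarrow> sm (f i)) \<Longrightarrow> E (\<lambda>x. \<Sum>i\<in>A. f i x) = (\<Sum>i\<in>A. E (f i))"
  by (simp add: E_def)

lemma E_mono: "sm f \<Longrightarrow> sm g \<Longrightarrow> (\<And>x. f x \<le> g x) \<Longrightarrow> E f \<le> E g"
  unfolding E_def by (intro integral_mono) auto

lemma E_nonneg: "(\<And>x. 0 \<le> f x) \<Longrightarrow> 0 \<le> E f"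
  unfolding E_def by (intro integral_nonneg_AE) auto

lemma PiM_eq_distr:
  assumes "V \<noteq> {}"
  shows "PiM V (\<lambda>_. std_normal_distribution) = distr M (PiM V (\<lambda>_. borel)) (\<lambda>\<omega>. \<lambda>i\<in>V. G i \<omega>)"
proof -
  have "distr M (PiM V (\<lambda>_. borel)) (\<lambda>\<omega>. \<lambda>i\<in>V. G i \<omega>) = PiM V (\<lambda>i. distr M borel (G i))"
    using indep_vars_iff_distr_eq_PiM[of V G "\<lambda>_. borel"] assms indep_vars_subset[OF indep, of V] by simp
  then show ?thesis by (simp add: law)
qed

lemma smooth_measurable_PiM: "smooth V f \<Longrightarrow> f \<in> borel_measurable (PiM V (\<lambda>_. borel))"
  using smooth_measurable[of V f "\<lambda>i x. x i" "PiM V (\<lambda>_. borel)"] by simp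

lemma E_eq_PiM:
  assumes "smooth V f" "V \<noteq> {}"
  shows "E f = (\<integral>x. f x \<partial>PiM V (\<lambda>_. std_normal_distribution))"
proof -
  have "(\<integral>x. f x \<partial>PiM V (\<lambda>_. std_normal_distribution)) = (\<integral>\<omega>. f (\<lambda>i\<in>V. G i \<omega>) \<partial>M)"
    unfolding PiM_eq_distr[OF assms(2)] by (rule integral_distr[OF _ smooth_measurable_PiM[OF assms(1)]]) simp
  also have "\<dots> = E f"
    unfolding E_def by (intro Bochner_Integration.integral_cong refl smooth_cong_on[OF assms(1)]) auto
  finally show ?thesis by simp
qed

lemma integrable_PiM:
  assumes "smooth V f" "finite V" "V \<noteq> {}"
  shows "integrable (PiM V (\<lambda>_. std_normal_distribution)) f"
proof -
  have "integrable M (\<lambda>\<omega>. f (\<lambda>i\<in>V. G i \<omega>)) \<longleftrightarrow> integrable M (\<lambda>\<omega>. f (\<lambda>i. G i \<omega>))"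
    by (intro Bochner_Integration.integrable_cong refl smooth_cong_on[OF assms(1)]) auto
  then show ?thesis
    unfolding PiM_eq_distr[OF assms(3)] using smooth_imp_sm[OF assms(1,2)]
    by (subst integrable_distr_eq[OF _ smooth_measurable_PiM[OF assms(1)]]) auto
qed

text \<open>Fubini isolates coordinate \<open>i\<close>; with the other coordinates frozen this is
  the one-dimensional formula.\<close>

theorem E_ibp: assumes "sm f" shows "E (\<lambda>x. x i * f x) = E (D i f)"
proof -
  obtain W where "finite W" "smooth W f" using assms by (auto simp: sm_def)
  define I where "I = W - {i}"
  define V where "V = insert i I"
  have V: "finite V" "V \<noteq> {}" "smooth V f" "i \<in> V"
    using \<open>finite W\<close> smooth_mono[OF \<open>smooth W f\<close>, of V] by (auto simp: V_def I_def)
  have I: "finite I" "i \<notin> I" using \<open>finite W\<close> by (auto simp: I_def)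
  interpret P: product_sigma_finite "\<lambda>_. std_normal_distribution"
    by (intro product_sigma_finite.intro prob_space_imp_sigma_finite prob_space_normal_density) auto
  note sD = smooth_D[OF V(3,1), of i]
  have sx: "smooth V (\<lambda>x. x i * f x)" by (intro smooth.intros V)
  have "(\<integral>y. (x(i := y)) i * f (x(i := y)) \<partial>std_normal_distribution) = (\<integral>y. D i f (x(i := y)) \<partial>std_normal_distribution)" for x
  proof -
    obtain C m where C: "0 \<le> C" "\<And>x. \<bar>f x\<bar> \<le> C * (\<Prod>i\<in>V. 1 + (x i)\<^sup>2) ^ m"
      using smooth_bound[OF V(3,1)] by auto
    obtain C' m' where C': "0 \<le> C'" "\<And>x. \<bar>D i f x\<bar> \<le> C' * (\<Prod>i\<in>V. 1 + (x i)\<^sup>2) ^ m'"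
      using smooth_bound[OF sD V(1)] by auto
    define P where "P = (\<Prod>i\<in>I. 1 + (x i)\<^sup>2)"
    have P: "(\<Prod>j\<in>V. 1 + ((x(i := y)) j)\<^sup>2) = (1 + y\<^sup>2) * P" for y
    proof -
      have "(\<Prod>j\<in>I. 1 + ((x(i := y)) j)\<^sup>2) = P"
        unfolding P_def by (rule prod.cong) (use I in auto)
      then show ?thesis using I unfolding V_def by simp
    qed
    have P1: "1 \<le> P" unfolding P_def by (rule prod_ge_1) simp
    define K where "K = (C + C') * P ^ (m + m')"
    have up: "A * ((1 + y\<^sup>2) * P) ^ k \<le> K * (1 + y\<^sup>2) ^ (m + m')" if "0 \<le> A" "A \<le> C + C'" "k \<le> m + m'" for A k y
    proof -
      have "1 * 1 \<le> (1 + y\<^sup>2) * P" using P1 by (intro mult_mono) auto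
      then have "A * ((1 + y\<^sup>2) * P) ^ k \<le> (C + C') * ((1 + y\<^sup>2) * P) ^ (m + m')"
        using that by (intro mult_mono power_increasing) auto
      then show ?thesis unfolding K_def power_mult_distrib by (simp only: mult_ac)
    qed
    show ?thesis
      unfolding fun_upd_same
    proof (rule std_normal_integration_by_parts)
      show "((\<lambda>y. f (x(i := y))) has_real_derivative D i f (x(i := t))) (at t)" for t
        by (rule sm_DERIV[OF assms])
      show "isCont (\<lambda>t. D i f (x(i := t))) t" for t
        using sm_DERIV[OF sm_D[OF assms, of i], of x i t] by (rule DERIV_isCont)
      show "\<bar>f (x(i := t))\<bar> \<le> K * (1 + t\<^sup>2) ^ (m + m')" for t
        using C(2)[of "x(i := t)"] up[of C m t] C C' unfolding P by auto
      show "\<bar>D i f (x(i := t))\<bar> \<le> K * (1 + t\<^sup>2) ^ (m + m')" for t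
        using C'(2)[of "x(i := t)"] up[of C' m' t] C C' unfolding P by auto
    qed
  qed
  then show ?thesis
    unfolding E_eq_PiM[OF sx V(2)] E_eq_PiM[OF sD V(2)]
    unfolding V_def
    by (subst (1 2) P.product_integral_insert[OF I])
       (use integrable_PiM[OF sx V(1,2)] integrable_PiM[OF sD V(1,2)] in \<open>simp_all add: V_def\<close>)
qed

section \<open>The norm of square-integrable functions\<close>

definition nrm :: "((nat \<Rightarrow> real) \<Rightarrow> real) \<Rightarrow> real" where
  "nrm f = sqrt (E (\<lambda>x. (f x)\<^sup>2))"

lemma nrm_nonneg [simp]: "0 \<le> nrm f"
  unfolding nrm_def by (simp add: E_nonneg)

lemma nrm_sq: "(nrm f)\<^sup>2 = E (\<lambda>x. (f x)\<^sup>2)"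
  unfolding nrm_def by (simp add: E_nonneg)

lemma E_Cauchy_Schwarz: assumes [simp]: "sm f" "sm g" shows "\<bar>E (\<lambda>x. f x * g x)\<bar> \<le> nrm f * nrm g"
proof -
  define A B C where "A = E (\<lambda>x. (f x)\<^sup>2)" "B = E (\<lambda>x. f x * g x)" "C = E (\<lambda>x. (g x)\<^sup>2)"
  have q: "0 \<le> A * s\<^sup>2 - 2 * B * s * t + C * t\<^sup>2" for s t
  proof -
    have "0 \<le> E (\<lambda>x. (s * f x - t * g x)\<^sup>2)" by (rule E_nonneg) simp
    also have "(\<lambda>x. (s * f x - t * g x)\<^sup>2) = (\<lambda>x. s\<^sup>2 * (f x)\<^sup>2 + (- 2 * s * t) * (f x * g x) + t\<^sup>2 * (g x)\<^sup>2)"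
      by (simp add: fun_eq_iff power2_eq_square algebra_simps)
    also have "E \<dots> = s\<^sup>2 * A + (- 2 * s * t) * B + t\<^sup>2 * C"
      by (subst E_add | simp only: E_cmult A_B_C_def | intro sm_add sm_mult sm_const sm_power assms)+
    finally show ?thesis by (simp add: mult_ac)
  qed
  have "0 \<le> A" "0 \<le> C" by (auto simp: A_B_C_def E_nonneg)
  have "B\<^sup>2 \<le> A * C"
  proof (cases "C = 0")
    case True
    have "B = 0"
    proof (rule ccontr)
      assume "B \<noteq> 0"
      \<comment> \<open>With C = 0 these arguments make the nonnegative quadratic form equal to -
        B^2.\<close>
      have "A * B\<^sup>2 - 2 * B * B * ((A + 1) / 2) \<ge> 0" using q[of B "(A + 1) / 2"] True by simp
      then have "B\<^sup>2 \<le> 0" by (simp add: power2_eq_square algebra_simps)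
      with \<open>B \<noteq> 0\<close> show False by simp
    qed
    then show ?thesis using True by simp
  next
    case False
    have "0 \<le> C * (A * C - B\<^sup>2)" using q[of C B] by (simp add: power2_eq_square algebra_simps)
    then show ?thesis using False \<open>0 \<le> C\<close> by (simp add: zero_le_mult_iff)
  qed
  then have "sqrt (B\<^sup>2) \<le> sqrt (A * C)" by (rule real_sqrt_le_mono)
  then show ?thesis by (simp add: nrm_def A_B_C_def real_sqrt_mult)
qed

lemma nrm_add: assumes [simp]: "sm f" "sm g" shows "nrm (\<lambda>x. f x + g x) \<le> nrm f + nrm g"
proof (rule power2_le_imp_le)
  have "E (\<lambda>x. (f x + g x)\<^sup>2) = E (\<lambda>x. (f x)\<^sup>2 + 2 * (f x * g x) + (g x)\<^sup>2)"
    by (rule arg_cong[of _ _ E]) (simp add: fun_eq_iff power2_eq_square algebra_simps)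
  also have "\<dots> \<le> (nrm f + nrm g)\<^sup>2"
    using E_Cauchy_Schwarz[of f g] by (simp add: nrm_sq power2_sum)
  finally show "(nrm (\<lambda>x. f x + g x))\<^sup>2 \<le> (nrm f + nrm g)\<^sup>2" by (simp add: nrm_sq)
qed simp

lemma nrm_cmult: "nrm (\<lambda>x. c * f x) = \<bar>c\<bar> * nrm f"
  by (simp add: nrm_def power_mult_distrib real_sqrt_mult)

lemma nrm_minus: "nrm (\<lambda>x. - f x) = nrm f"
  by (simp add: nrm_def)

lemma nrm_diff: "sm f \<Longrightarrow> sm g \<Longrightarrow> nrm (\<lambda>x. f x - g x) \<le> nrm f + nrm g"
  using nrm_add[of f "\<lambda>x. - g x"] by (simp add: nrm_minus)

lemma nrm_const [simp]: "nrm (\<lambda>x. c) = \<bar>c\<bar>"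
  by (simp add: nrm_def)

end

section \<open>Polynomials and Wiener chaoses\<close>

text \<open>The index bounds the weighted degree from above. Only multiplication by a single
  variable is built in, which keeps inductions short; closure under products is derived. Weight 1
  gives the total degree; general weights serve for polynomials in primes, where a variable stands
  for a prime and its weight for the order of that prime.\<close>

inductive wpoly :: "(nat \<Rightarrow> nat) \<Rightarrow> nat set \<Rightarrow> nat \<Rightarrow> ((nat \<Rightarrow> real) \<Rightarrow> real) \<Rightarrow> bool"
  for w V where
  wpoly_const: "wpoly w V m (\<lambda>x. c)"
| wpoly_add: "wpoly w V m f \<Longrightarrow> wpoly w V m g \<Longrightarrow> wpoly w V m (\<lambda>x. f x + g x)"
| wpoly_var_mult: "i \<in> V \<Longrightarrow> wpoly w V m f \<Longrightarrow> m + w i \<le> m' \<Longrightarrow> wpoly w V m' (\<lambda>x. x i * f x)"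

abbreviation polyf :: "nat set \<Rightarrow> nat \<Rightarrow> ((nat \<Rightarrow> real) \<Rightarrow> real) \<Rightarrow> bool" where
  "polyf \<equiv> wpoly (\<lambda>_. Suc 0)"

lemma wpoly_mono: "wpoly w V m f \<Longrightarrow> m \<le> n \<Longrightarrow> wpoly w V n f"
  by (induction arbitrary: n rule: wpoly.induct) (auto intro: wpoly.intros le_trans)

lemma wpoly_subset: "wpoly w V m f \<Longrightarrow> V \<subseteq> W \<Longrightarrow> wpoly w W m f"
  by (induction rule: wpoly.induct) (auto intro: wpoly.intros)

lemma wpoly_cong_weight:
  "wpoly w V m f \<Longrightarrow> (\<And>i. i \<in> V \<Longrightarrow> w i = w' i) \<Longrightarrow> wpoly w' V m f"
  by (induction rule: wpoly.induct) (auto intro: wpoly.intros)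

lemma wpoly_smooth: "wpoly w V m f \<Longrightarrow> smooth V f"
  by (induction rule: wpoly.induct) (auto intro!: smooth.intros)

lemma wpoly_sm: "wpoly w V m f \<Longrightarrow> finite V \<Longrightarrow> sm f"
  using wpoly_smooth smooth_imp_sm by blast

lemma wpoly_var: "i \<in> V \<Longrightarrow> w i \<le> m \<Longrightarrow> wpoly w V m (\<lambda>x. x i)"
  using wpoly_var_mult[OF _ wpoly_const[of w V 0 1]] by simp

lemma wpoly_cmult: "wpoly w V m f \<Longrightarrow> wpoly w V m (\<lambda>x. c * f x)"
proof (induction rule: wpoly.induct)
  case (wpoly_var_mult i m f m')
  then show ?case
    using wpoly.wpoly_var_mult[of i V w m "\<lambda>x. c * f x" m'] by (simp add: mult.left_commute)
qed (auto simp: distrib_left intro: wpoly.intros)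

lemma wpoly_minus: "wpoly w V m f \<Longrightarrow> wpoly w V m (\<lambda>x. - f x)"
  using wpoly_cmult[of w V m f "-1"] by simp

lemma wpoly_diff: "wpoly w V m f \<Longrightarrow> wpoly w V m g \<Longrightarrow> wpoly w V m (\<lambda>x. f x - g x)"
  using wpoly_add[OF _ wpoly_minus[of w V m g]] by simp

lemma wpoly_sum: "(\<And>i. i \<in> A \<Longrightarrow> wpoly w V m (f i)) \<Longrightarrow> wpoly w V m (\<lambda>x. \<Sum>i\<in>A. f i x)"
  by (induction A rule: infinite_finite_induct) (auto intro: wpoly.intros)

lemma wpoly_mult: "wpoly w V m f \<Longrightarrow> wpoly w V k g \<Longrightarrow> wpoly w V (m + k) (\<lambda>x. f x * g x)"
proof (induction rule: wpoly.induct)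
  case (wpoly_const m c)
  then show ?case by (metis wpoly_cmult wpoly_mono le_add2)
next
  case (wpoly_var_mult i m f m')
  then show ?case
    using wpoly.wpoly_var_mult[of i V w "m + k" "\<lambda>x. f x * g x" "m' + k"] by (simp add: mult.assoc)
qed (auto simp: distrib_right intro: wpoly.intros)

lemma wpoly_D: assumes "wpoly w V m f" "finite V" shows "wpoly w V m (D i f)"
  using assms(1)
proof (induction rule: wpoly.induct)
  case (wpoly_var_mult j m f m')
  have "wpoly w V m' (\<lambda>x. (if i = j then 1 else 0) * f x + x j * D i f x)"
    using wpoly_var_mult wpoly.wpoly_var_mult[of j V w m "D i f" m']
    by (intro wpoly.intros wpoly_cmult) (auto intro: wpoly_mono)
  then show ?case using wpoly_sm[OF wpoly_var_mult(2) assms(2)] by simp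
qed (auto intro: wpoly.intros simp: wpoly_sm[OF _ assms(2)])

lemma polyf_0: "polyf V 0 f \<Longrightarrow> \<exists>c. f = (\<lambda>x. c)"
proof -
  have "polyf V m f \<Longrightarrow> m = 0 \<Longrightarrow> \<exists>c. f = (\<lambda>x. c)" for m
    by (induction rule: wpoly.induct) auto
  then show "polyf V 0 f \<Longrightarrow> \<exists>c. f = (\<lambda>x. c)" by blast
qed

lemma polyf_D: assumes "polyf V m f" "finite V" shows "polyf V (m - 1) (D i f)"
  using assms(1)
proof (induction rule: wpoly.induct)
  case (wpoly_var_mult j m f m')
  have *: "polyf V (m' - 1) (\<lambda>x. x j * D i f x)"
  proof (cases m)
    case 0
    then obtain c where "f = (\<lambda>x. c)" using polyf_0 wpoly_var_mult(2) by blast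
    then show ?thesis by (simp add: wpoly_const)
  next
    case (Suc k)
    then show ?thesis
      using wpoly_var_mult wpoly.wpoly_var_mult[of j V "\<lambda>_. Suc 0" "m - 1" "D i f" "m' - 1"] by auto
  qed
  have "polyf V (m' - 1) (\<lambda>x. (if i = j then 1 else 0) * f x + x j * D i f x)"
    using wpoly_var_mult by (intro wpoly_add wpoly_cmult *) (auto intro: wpoly_mono)
  then show ?case using wpoly_sm[OF wpoly_var_mult(2) assms(2)] by simp
qed (auto intro: wpoly.intros simp: wpoly_sm[OF _ assms(2)])

lemma D_commute: assumes "wpoly w V m f" "finite V" shows "D i (D j f) = D j (D i f)"
  using assms(1)
proof (induction rule: wpoly.induct)
  case (wpoly_var_mult k m f m')
  have [simp]: "sm f" using wpoly_sm[OF wpoly_var_mult(2) assms(2)] .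
  have "D i (\<lambda>x. (if j = k then 1 else 0) * f x) = (\<lambda>x. (if j = k then 1 else 0) * D i f x)"
    "D j (\<lambda>x. (if i = k then 1 else 0) * f x) = (\<lambda>x. (if i = k then 1 else 0) * D j f x)"
    by simp_all
  with wpoly_var_mult show ?case by (simp add: algebra_simps)
qed (auto simp: wpoly_sm[OF _ assms(2)])

text \<open>The carre du champ and the generator of the Ornstein-Uhlenbeck semigroup in the variables \<open>V\<close>; the
  \<open>k\<close>-th Wiener chaos is the eigenspace of the generator for \<open>- k\<close>.\<close>

definition Gam where "Gam V f g x = (\<Sum>i\<in>V. D i f x * D i g x)"

definition Lap where "Lap V f x = (\<Sum>i\<in>V. D i (D i f) x - x i * D i f x)"

lemma sm_Gam [simp, intro]: "sm f \<Longrightarrow> sm g \<Longrightarrow> sm (Gam V f g)"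
  unfolding Gam_def[abs_def] by auto

lemma sm_Lap [simp, intro]: "sm f \<Longrightarrow> sm (Lap V f)"
  unfolding Lap_def[abs_def] by auto

lemma Gam_commute: "Gam V f g = Gam V g f"
  by (simp add: Gam_def fun_eq_iff mult.commute)

lemma Lap_add: "sm f \<Longrightarrow> sm g \<Longrightarrow> Lap V (\<lambda>x. f x + g x) x = Lap V f x + Lap V g x"
  unfolding Lap_def by (simp add: sum.distrib[symmetric] algebra_simps)

lemma Lap_const [simp]: "Lap V (\<lambda>x. c) x = 0"
  unfolding Lap_def by simp

lemma Lap_cmult: "sm f \<Longrightarrow> Lap V (\<lambda>x. c * f x) x = c * Lap V f x"
  unfolding Lap_def by (simp add: sum_distrib_left algebra_simps)

lemma Lap_diff: "sm f \<Longrightarrow> sm g \<Longrightarrow> Lap V (\<lambda>x. f x - g x) x = Lap V f x - Lap V g x"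
  unfolding Lap_def by (simp add: sum_subtractf[symmetric] algebra_simps)

lemma Lap_sum: "(\<And>i. i \<in> A \<Longrightarrow> sm (f i)) \<Longrightarrow> Lap V (\<lambda>x. \<Sum>i\<in>A. f i x) x = (\<Sum>i\<in>A. Lap V (f i) x)"
  by (induction A rule: infinite_finite_induct) (auto simp: Lap_add)

lemma Lap_mult:
  assumes [simp]: "sm f" "sm g"
  shows "Lap V (\<lambda>x. f x * g x) x = f x * Lap V g x + g x * Lap V f x + 2 * Gam V f g x"
  unfolding Lap_def Gam_def
  by (simp add: sum_distrib_left sum.distrib[symmetric] algebra_simps)

text \<open>By Euler's identity the first-order part of the generator multiplies the terms of degree
  m by - m, while second derivatives lower the degree; so the leading terms cancel.\<close>

lemma Lap_polyf:
  assumes "polyf V m f" "finite V"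
  shows "polyf V (m - 1) (\<lambda>x. Lap V f x + real m * f x)"
  using assms(1)
proof (induction rule: wpoly.induct)
  case (wpoly_const m c)
  then show ?case by (simp add: wpoly.wpoly_const)
next
  case (wpoly_add m f g)
  have [simp]: "sm f" "sm g" using wpoly_sm[OF wpoly_add(1) assms(2)] wpoly_sm[OF wpoly_add(2) assms(2)] by auto
  show ?case using wpoly.wpoly_add[OF wpoly_add(3,4)]
    by (simp add: Lap_add algebra_simps)
next
  case (wpoly_var_mult i m f m')
  have [simp]: "sm f" using wpoly_sm[OF wpoly_var_mult(2) assms(2)] .
  have Lv: "Lap V (\<lambda>x. x i) x = - x i" for x
    using wpoly_var_mult(1) assms(2) unfolding Lap_def
    by (simp add: if_distrib[of "\<lambda>c. _ * c"] sum_negf cong: if_cong)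
  have Gv: "Gam V (\<lambda>x. x i) f x = D i f x" for x
    using wpoly_var_mult(1) assms(2) unfolding Gam_def
    by (simp add: if_distrib[of "\<lambda>c. c * _"] cong: if_cong)
  \<comment> \<open>The surplus factor vanishes when the bound is sharp, m' = m + 1; otherwise there
    is room for one more degree.\<close>
  have eq: "Lap V (\<lambda>x. x i * f x) x + real m' * (x i * f x)
     = x i * (Lap V f x + real m * f x) + 2 * D i f x + (real m' - real m - 1) * (x i * f x)" for x
    by (subst Lap_mult) (simp_all add: Lv Gv algebra_simps)
  have 1: "polyf V (m' - 1) (\<lambda>x. x i * (Lap V f x + real m * f x))"
  proof (cases m)
    case 0
    then obtain c where "f = (\<lambda>x. c)" using polyf_0 wpoly_var_mult(2) by blast
    then show ?thesis using 0 by (simp add: wpoly_const)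
  next
    case (Suc k)
    then show ?thesis
      using wpoly_var_mult
        wpoly.wpoly_var_mult[of i V "\<lambda>_. Suc 0" "m - 1" "\<lambda>x. Lap V f x + real m * f x" "m' - 1"] by auto
  qed
  have 2: "polyf V (m' - 1) (\<lambda>x. 2 * D i f x)"
    using polyf_D[OF wpoly_var_mult(2) assms(2), of i] wpoly_var_mult(3)
    by (intro wpoly_cmult) (auto intro: wpoly_mono)
  have 3: "polyf V (m' - 1) (\<lambda>x. (real m' - real m - 1) * (x i * f x))"
  proof (cases "m' = m + 1")
    case True
    then show ?thesis by (simp add: wpoly_const)
  next
    case False
    then show ?thesis using wpoly_var_mult
      by (intro wpoly_cmult wpoly.wpoly_var_mult[of i V _ m]) auto
  qed
  show ?case unfolding eq by (intro wpoly_add 1 2 3)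
qed

definition chaos where
  "chaos V k f \<longleftrightarrow> polyf V k f \<and> (\<forall>x. Lap V f x = - real k * f x)"

lemma chaos_polyf: "chaos V k f \<Longrightarrow> polyf V k f"
  by (simp add: chaos_def)

lemma chaos_Lap: "chaos V k f \<Longrightarrow> Lap V f x = - real k * f x"
  by (simp add: chaos_def)

lemma chaos_sm: "chaos V k f \<Longrightarrow> finite V \<Longrightarrow> sm f"
  using chaos_polyf wpoly_sm by blast

lemma chaos_const: "chaos V 0 (\<lambda>x. c)"
  by (simp add: chaos_def wpoly_const)

lemma chaos_zero: "chaos V k (\<lambda>x. 0)"
  by (simp add: chaos_def wpoly_const)

lemma chaos_add: "finite V \<Longrightarrow> chaos V k f \<Longrightarrow> chaos V k g \<Longrightarrow> chaos V k (\<lambda>x. f x + g x)"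
  using wpoly_sm by (auto simp: chaos_def Lap_add algebra_simps intro: wpoly_add)

lemma chaos_cmult: "finite V \<Longrightarrow> chaos V k f \<Longrightarrow> chaos V k (\<lambda>x. c * f x)"
  using wpoly_sm by (auto simp: chaos_def Lap_cmult algebra_simps intro: wpoly_cmult)

lemma chaos_diff: "finite V \<Longrightarrow> chaos V k f \<Longrightarrow> chaos V k g \<Longrightarrow> chaos V k (\<lambda>x. f x - g x)"
  using chaos_add[OF _ _ chaos_cmult[of V k g "-1"]] by simp

lemma chaos_sum: 
  "finite V \<Longrightarrow> (\<And>i. i \<in> A \<Longrightarrow> chaos V k (f i)) \<Longrightarrow> chaos V k (\<lambda>x. \<Sum>i\<in>A. f i x)"
  by (induction A rule: infinite_finite_induct) (auto intro: chaos_add chaos_zero)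

lemma chaos_0D: "chaos V 0 f \<Longrightarrow> \<exists>c. f = (\<lambda>x. c)"
  using polyf_0 chaos_polyf by blast

text \<open>The operator \<open>Lap V\<close> + (m + 1) lowers the degree bound from m + 1 to m.
  Dividing the component of order l of the image by m + 1 - l gives a preimage p of that image, so f
  - p is annihilated by the operator: it is the component of top order.\<close>

lemma chaos_decomposition:
  assumes "finite V"
  shows "polyf V m f \<Longrightarrow> \<exists>Z. (\<forall>l. chaos V l (Z l)) \<and> f = (\<lambda>x. \<Sum>l\<le>m. Z l x)"
proof (induction m arbitrary: f)
  case 0
  then obtain c where "f = (\<lambda>x. c)" using polyf_0 by blast
  then show ?case
    by (intro exI[of _ "\<lambda>l. if l = 0 then (\<lambda>x. c) else (\<lambda>x. 0)"]) (auto simp: chaos_const chaos_zero)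
next
  case (Suc m)
  have "polyf V m (\<lambda>x. Lap V f x + real (Suc m) * f x)"
    using Lap_polyf[OF Suc.prems assms] by simp
  then obtain Q where Q: "\<And>l. chaos V l (Q l)"
    "(\<lambda>x. Lap V f x + real (Suc m) * f x) = (\<lambda>x. \<Sum>l\<le>m. Q l x)"
    using Suc.IH by blast
  define c where "c l = 1 / (real (Suc m) - real l)" for l
  define p where "p x = (\<Sum>l\<le>m. c l * Q l x)" for x
  have sQ [simp]: "sm (Q l)" for l using chaos_sm[OF Q(1) assms] .
  have [simp]: "sm f" using wpoly_sm[OF Suc.prems assms] .
  have [simp]: "sm p" unfolding p_def[abs_def] by auto
  have pol: "polyf V (Suc m) (\<lambda>x. f x - p x)"
    unfolding p_def
    by (intro wpoly_diff Suc.prems wpoly_sum wpoly_cmult wpoly_mono[OF chaos_polyf[OF Q(1)]]) auto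
  have Lp: "Lap V p x = (\<Sum>l\<le>m. c l * (- real l * Q l x))" for x
    unfolding p_def[abs_def] by (subst Lap_sum) (auto simp: Lap_cmult chaos_Lap[OF Q(1)])
  have "Lap V (\<lambda>x. f x - p x) x = - real (Suc m) * (f x - p x)" for x
  proof -
    have "Lap V f x = (\<Sum>l\<le>m. Q l x) - real (Suc m) * f x"
      using fun_cong[OF Q(2), of x] by simp
    moreover have "(\<Sum>l\<le>m. Q l x) - Lap V p x = real (Suc m) * p x"
      unfolding Lp p_def sum_distrib_left sum_subtractf[symmetric]
    proof (rule sum.cong)
      fix l assume "l \<in> {..m}"
      then have "real (Suc m) - real l \<noteq> 0" by auto
      then have "c l * (real (Suc m) - real l) = 1" by (simp add: c_def)
      then have "(c l * (real (Suc m) - real l)) * Q l x = Q l x" by simp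
      then show "Q l x - c l * (- real l * Q l x) = real (Suc m) * (c l * Q l x)"
        by (simp add: algebra_simps)
    qed simp
    ultimately show ?thesis by (simp add: Lap_diff algebra_simps)
  qed
  then have top: "chaos V (Suc m) (\<lambda>x. f x - p x)" using pol by (simp add: chaos_def)
  define Z where "Z l = (if l = Suc m then (\<lambda>x. f x - p x) else (\<lambda>x. c l * Q l x))" for l
  have "\<forall>l. chaos V l (Z l)" using top Q(1) assms by (auto simp: Z_def intro: chaos_cmult)
  moreover have "f = (\<lambda>x. \<Sum>l\<le>Suc m. Z l x)"
    by (simp add: Z_def p_def)
  ultimately show ?case by blast
qed

text \<open>The commutator of \<open>D i\<close> with the generator is - \<open>D i\<close>, so
  differentiation turns the eigenvalue - (k + 1) into - k.\<close>

lemma chaos_D: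
  assumes "chaos V (Suc k) f" "finite V" "i \<in> V"
  shows "chaos V k (D i f)"
proof -
  note p = chaos_polyf[OF assms(1)]
  have [simp]: "sm f" using p assms(2) wpoly_sm by blast
  have "Lap V (D i f) x = - real k * D i f x" for x
  proof -
    have "D i (Lap V f) x = - real (Suc k) * D i f x"
    proof -
      have "Lap V f = (\<lambda>x. - real (Suc k) * f x)" using chaos_Lap[OF assms(1)] by auto
      then show ?thesis by simp
    qed
    moreover have "D i (Lap V f) x = Lap V (D i f) x - D i f x"
    proof -
      have "D i (D j (D j f)) = D j (D j (D i f))" "D i (D j f) = D j (D i f)" for j
        using D_commute[OF p assms(2)] D_commute[OF wpoly_D[OF p assms(2)] assms(2)] by metis+
      then have "D i (Lap V f) x = (\<Sum>j\<in>V. D j (D j (D i f)) x - ((if i = j then 1 else 0) * D j f x + x j * D j (D i f) x))"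
        unfolding Lap_def[abs_def] by simp
      also have "\<dots> = Lap V (D i f) x - (\<Sum>j\<in>V. (if i = j then 1 else 0) * D j f x)"
        unfolding Lap_def by (simp only: sum_subtractf[symmetric]) (simp add: algebra_simps)
      also have "(\<Sum>j\<in>V. (if i = j then 1 else 0) * D j f x) = D i f x"
        using assms by (simp add: if_distrib[of "\<lambda>c. c * _"] cong: if_cong)
      finally show ?thesis .
    qed
    ultimately show ?thesis by (simp add: algebra_simps)
  qed
  then show ?thesis using polyf_D[OF p assms(2), of i] by (simp add: chaos_def)
qed

section \<open>Spectral consequences: orthogonality, Parseval's identity, Poincare
  inequalities\<close>

context gaussian_family begin

text \<open>Integration by parts in each coordinate: the generator is minus the adjoint of the
  gradient composed with the gradient, hence symmetric.\<close>

lemma E_Lap: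
  assumes [simp]: "sm f" "sm g"
  shows "E (\<lambda>x. f x * Lap V g x) = - E (Gam V f g)"
proof -
  have "E (\<lambda>x. f x * (D i (D i g) x - x i * D i g x)) = - E (\<lambda>x. D i f x * D i g x)" for i
  proof -
    have "E (\<lambda>x. x i * (f x * D i g x)) = E (\<lambda>x. D i f x * D i g x) + E (\<lambda>x. f x * D i (D i g) x)"
      by (subst E_ibp) auto
    moreover have "(\<lambda>x. f x * (D i (D i g) x - x i * D i g x)) = (\<lambda>x. f x * D i (D i g) x - x i * (f x * D i g x))"
      by (simp add: fun_eq_iff algebra_simps)
    ultimately show ?thesis by simp
  qed
  then show ?thesis
    unfolding Lap_def Gam_def[abs_def] sum_distrib_left by (simp add: sum_negf)
qed

lemma E_Gam_chaos:
  assumes "chaos V k f" "finite V" "sm g"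
  shows "E (Gam V f g) = real k * E (\<lambda>x. f x * g x)"
proof -
  have "E (\<lambda>x. g x * Lap V f x) = - E (Gam V g f)"
    using assms chaos_sm by (intro E_Lap) auto
  moreover have "(\<lambda>x. g x * Lap V f x) = (\<lambda>x. - real k * (f x * g x))"
    by (simp add: fun_eq_iff chaos_Lap[OF assms(1)])
  ultimately show ?thesis by (simp add: Gam_commute[of V f])
qed

lemma chaos_orth:
  assumes "chaos V j f" "chaos V k g" "finite V" "j \<noteq> k"
  shows "E (\<lambda>x. f x * g x) = 0"
proof -
  have "real j * E (\<lambda>x. f x * g x) = real k * E (\<lambda>x. g x * f x)"
    using E_Gam_chaos[OF assms(1,3) chaos_sm[OF assms(2,3)]]
      E_Gam_chaos[OF assms(2,3) chaos_sm[OF assms(1,3)]] by (simp add: Gam_commute[of V f])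
  then show ?thesis using assms(4) by (simp add: mult.commute)
qed

lemma chaos_orth_polyf:
  assumes "chaos V k f" "polyf V m g" "finite V" "m < k"
  shows "E (\<lambda>x. f x * g x) = 0"
proof -
  obtain Z where Z: "\<And>l. chaos V l (Z l)" "g = (\<lambda>x. \<Sum>l\<le>m. Z l x)"
    using chaos_decomposition[OF assms(3,2)] by blast
  have [simp]: "sm f" "\<And>l. sm (Z l)" using assms Z chaos_sm by blast+
  have "E (\<lambda>x. f x * g x) = (\<Sum>l\<le>m. E (\<lambda>x. f x * Z l x))"
    unfolding Z(2) sum_distrib_left by simp
  also have "\<dots> = 0"
    using chaos_orth[OF assms(1) Z(1) assms(3)] assms(4) by (intro sum.neutral) auto
  finally show ?thesis .
qed

lemma chaos_parseval:
  assumes "finite V" "\<And>l. chaos V l (Z l)" "f = (\<lambda>x. \<Sum>l\<le>m. Z l x)"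
  shows "l \<le> m \<Longrightarrow> E (\<lambda>x. f x * Z l x) = E (\<lambda>x. (Z l x)\<^sup>2)"
    and "E (\<lambda>x. (f x)\<^sup>2) = (\<Sum>l\<le>m. E (\<lambda>x. (Z l x)\<^sup>2))"
    and "E f = E (Z 0)"
    and "E (Gam V f f) = (\<Sum>l\<le>m. real l * E (\<lambda>x. (Z l x)\<^sup>2))"
proof -
  have [simp]: "sm (Z l)" for l using assms chaos_sm by blast
  have [simp]: "sm f" unfolding assms(3) by auto
  show 1: "E (\<lambda>x. f x * Z l x) = E (\<lambda>x. (Z l x)\<^sup>2)" if "l \<le> m" for l
  proof -
    have "E (\<lambda>x. f x * Z l x) = (\<Sum>k\<le>m. E (\<lambda>x. Z k x * Z l x))"
      unfolding assms(3) sum_distrib_right by simp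
    also have "\<dots> = (\<Sum>k\<le>m. if k = l then E (\<lambda>x. (Z l x)\<^sup>2) else 0)"
      using chaos_orth[OF assms(2) assms(2) assms(1)] by (intro sum.cong) (auto simp: power2_eq_square)
    also have "\<dots> = E (\<lambda>x. (Z l x)\<^sup>2)" using that by simp
    finally show ?thesis .
  qed
  have "E (\<lambda>x. (f x)\<^sup>2) = E (\<lambda>x. \<Sum>l\<le>m. f x * Z l x)"
    by (rule arg_cong[of _ _ E]) (simp add: fun_eq_iff power2_eq_square sum_distrib_left[symmetric] assms(3))
  then show "E (\<lambda>x. (f x)\<^sup>2) = (\<Sum>l\<le>m. E (\<lambda>x. (Z l x)\<^sup>2))"
    using 1 by simp
  have "E (Z l) = 0" if "l \<noteq> 0" for l
    using chaos_orth[OF assms(2)[of l] chaos_const[of V 1] assms(1)] that by simp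
  then have "(\<Sum>l\<le>m. E (Z l)) = (\<Sum>l\<le>m. if l = 0 then E (Z 0) else 0)"
    by (intro sum.cong) auto
  then show "E f = E (Z 0)" unfolding assms(3) by simp
  have "(\<lambda>x. f x * Lap V f x) = (\<lambda>x. - (\<Sum>l\<le>m. real l * (f x * Z l x)))"
  proof
    fix x
    have "Lap V f x = (\<Sum>l\<le>m. - real l * Z l x)"
      unfolding assms(3) by (subst Lap_sum) (auto simp: chaos_Lap[OF assms(2)])
    then show "f x * Lap V f x = - (\<Sum>l\<le>m. real l * (f x * Z l x))"
      by (simp add: sum_distrib_left sum_negf algebra_simps)
  qed
  then show "E (Gam V f f) = (\<Sum>l\<le>m. real l * E (\<lambda>x. (Z l x)\<^sup>2))"
    using E_Lap[of f f V] 1 by simp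
qed

text \<open>Up to degree m no eigenvalue of - \<open>Lap V\<close> exceeds m: a reverse Poincare
  inequality.\<close>

lemma E_Gam_le:
  assumes "polyf V m f" "finite V"
  shows "E (Gam V f f) \<le> real m * E (\<lambda>x. (f x)\<^sup>2)"
proof -
  obtain Z where Z: "\<And>l. chaos V l (Z l)" "f = (\<lambda>x. \<Sum>l\<le>m. Z l x)"
    using chaos_decomposition[OF assms(2,1)] by blast
  show ?thesis
    unfolding chaos_parseval(2,4)[OF assms(2) Z] sum_distrib_left
    by (intro sum_mono mult_right_mono E_nonneg) auto
qed

text \<open>The component of order 0 is the mean, and every other eigenvalue of -
  \<open>Lap V\<close> is at least 1.\<close>

lemma poincare:
  assumes "polyf V m f" "finite V"
  shows "E (\<lambda>x. (f x)\<^sup>2) \<le> (E f)\<^sup>2 + E (Gam V f f)"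
proof -
  obtain Z where Z: "\<And>l. chaos V l (Z l)" "f = (\<lambda>x. \<Sum>l\<le>m. Z l x)"
    using chaos_decomposition[OF assms(2,1)] by blast
  obtain c where c: "Z 0 = (\<lambda>x. c)" using chaos_0D Z(1) by blast
  have "(\<Sum>l\<le>m. E (\<lambda>x. (Z l x)\<^sup>2)) \<le> (\<Sum>l\<le>m. (if l = 0 then c\<^sup>2 else 0) + real l * E (\<lambda>x. (Z l x)\<^sup>2))"
  proof (rule sum_mono)
    fix l
    have "0 \<le> E (\<lambda>x. (Z l x)\<^sup>2)" by (rule E_nonneg) simp
    then show "E (\<lambda>x. (Z l x)\<^sup>2) \<le> (if l = 0 then c\<^sup>2 else 0) + real l * E (\<lambda>x. (Z l x)\<^sup>2)"
      by (cases "l = 0") (auto simp: c mult_le_cancel_right1)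
  qed
  also have "\<dots> = c\<^sup>2 + (\<Sum>l\<le>m. real l * E (\<lambda>x. (Z l x)\<^sup>2))"
    by (simp add: sum.distrib)
  finally show ?thesis
    unfolding chaos_parseval(2,3,4)[OF assms(2) Z] by (simp add: c)
qed

end

text \<open>The recursion of the product estimate: 1 bounds the squared mean of f g, the factor 2
  comes from (a + b)^2 \<le> 2 a^2 + 2 b^2, and \<open>Suc n\<close> bounds the sum of the two
  degrees, which enter through the reverse Poincare inequality.\<close>

fun prod_const :: "nat \<Rightarrow> real" where
  "prod_const 0 = 1"
| "prod_const (Suc n) = 1 + 2 * real (Suc n) * prod_const n"

lemma prod_const_pos: "0 < prod_const n"
  by (induction n) (auto intro!: add_pos_nonneg)

context gaussian_family begin

text \<open>A substitute for hypercontractivity: apply the Poincare inequality to \<open>f g\<close> and use induction on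
  the degree for the products \<open>\<partial>\<^sub>i f \<cdot> g\<close> and \<open>f \<cdot> \<partial>\<^sub>i g\<close>.\<close>

lemma E_prod_sq_le:
  assumes "finite V"
  shows "polyf V j f \<Longrightarrow> polyf V l g \<Longrightarrow> j + l \<le> n \<Longrightarrow>
    E (\<lambda>x. (f x * g x)\<^sup>2) \<le> prod_const n * (E (\<lambda>x. (f x)\<^sup>2) * E (\<lambda>x. (g x)\<^sup>2))"
proof (induction n arbitrary: j l f g)
  case 0
  then obtain c c' where "f = (\<lambda>x. c)" "g = (\<lambda>x. c')" using polyf_0 by (metis add_is_0 le_zero_eq)
  then show ?case by (simp add: power_mult_distrib)
next
  case (Suc n)
  have [simp]: "sm f" "sm g" using Suc.prems wpoly_sm assms by blast+
  define A B where "A = E (\<lambda>x. (f x)\<^sup>2)" and "B = E (\<lambda>x. (g x)\<^sup>2)"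
  have AB: "0 \<le> A" "0 \<le> B" by (auto simp: A_def B_def E_nonneg)
  note pc = prod_const_pos[of n]
  \<comment> \<open>Summing over \<open>i\<close> reassembles \<open>E (Gam V f f)\<close>, so the
    bound does not depend on the number of variables. Degree 0 is separate because the induction
    needs the degree to drop.\<close>
  have 1: "(\<Sum>i\<in>V. E (\<lambda>x. (D i f x * g x)\<^sup>2)) \<le> prod_const n * (real j * A * B)"
  proof (cases j)
    case 0
    then obtain c where "f = (\<lambda>x. c)" using polyf_0 Suc.prems by blast
    then show ?thesis using 0 by simp
  next
    case (Suc j')
    have "(\<Sum>i\<in>V. E (\<lambda>x. (D i f x * g x)\<^sup>2)) \<le> (\<Sum>i\<in>V. prod_const n * (E (\<lambda>x. (D i f x)\<^sup>2) * B))"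
      unfolding B_def
      using polyf_D[OF Suc.prems(1) assms] Suc.prems Suc
      by (intro sum_mono Suc.IH[of "j - 1" _ l]) auto
    also have "\<dots> = prod_const n * (E (Gam V f f) * B)"
      unfolding Gam_def[abs_def] by (simp add: sum_distrib_left sum_distrib_right power2_eq_square)
    also have "\<dots> \<le> prod_const n * ((real j * A) * B)"
      using E_Gam_le[OF Suc.prems(1) assms] pc AB unfolding A_def[symmetric]
      by (intro mult_left_mono mult_right_mono) auto
    finally show ?thesis .
  qed
  have 2: "(\<Sum>i\<in>V. E (\<lambda>x. (f x * D i g x)\<^sup>2)) \<le> prod_const n * (real l * A * B)"
  proof (cases l)
    case 0
    then obtain c where "g = (\<lambda>x. c)" using polyf_0 Suc.prems by blast
    then show ?thesis using 0 by simp
  next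
    case (Suc l')
    have "(\<Sum>i\<in>V. E (\<lambda>x. (f x * D i g x)\<^sup>2)) \<le> (\<Sum>i\<in>V. prod_const n * (A * E (\<lambda>x. (D i g x)\<^sup>2)))"
      unfolding A_def
      using polyf_D[OF Suc.prems(2) assms] Suc.prems Suc
      by (intro sum_mono Suc.IH[of j _ "l - 1"]) auto
    also have "\<dots> = prod_const n * (A * E (Gam V g g))"
      unfolding Gam_def[abs_def] by (simp add: sum_distrib_left sum_distrib_right power2_eq_square)
    also have "\<dots> \<le> prod_const n * (A * (real l * B))"
      using E_Gam_le[OF Suc.prems(2) assms] pc AB unfolding B_def[symmetric]
      by (intro mult_left_mono mult_right_mono) auto
    finally show ?thesis by (simp add: mult_ac)
  qed
  have "E (Gam V (\<lambda>x. f x * g x) (\<lambda>x. f x * g x))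
      \<le> E (\<lambda>x. \<Sum>i\<in>V. 2 * (D i f x * g x)\<^sup>2 + 2 * (f x * D i g x)\<^sup>2)"
  proof (rule E_mono)
    fix x
    show "Gam V (\<lambda>x. f x * g x) (\<lambda>x. f x * g x) x \<le> (\<Sum>i\<in>V. 2 * (D i f x * g x)\<^sup>2 + 2 * (f x * D i g x)\<^sup>2)"
      unfolding Gam_def
    proof (rule sum_mono)
      fix i
      have "(a + b) * (a + b) \<le> 2 * a\<^sup>2 + 2 * b\<^sup>2" for a b :: real
        using zero_le_power2[of "a - b"] by (simp add: power2_eq_square algebra_simps)
      then show "D i (\<lambda>x. f x * g x) x * D i (\<lambda>x. f x * g x) x \<le> 2 * (D i f x * g x)\<^sup>2 + 2 * (f x * D i g x)\<^sup>2"
        by simp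
    qed
  qed auto
  also have "\<dots> = 2 * (\<Sum>i\<in>V. E (\<lambda>x. (D i f x * g x)\<^sup>2)) + 2 * (\<Sum>i\<in>V. E (\<lambda>x. (f x * D i g x)\<^sup>2))"
    by (simp add: sum.distrib sum_distrib_left)
  also have "\<dots> \<le> 2 * (prod_const n * (real j * A * B)) + 2 * (prod_const n * (real l * A * B))"
    using 1 2 by simp
  also have "\<dots> = 2 * prod_const n * real (j + l) * (A * B)" by (simp add: algebra_simps)
  also have "\<dots> \<le> 2 * prod_const n * real (Suc n) * (A * B)"
    using Suc.prems(3) pc AB by (intro mult_right_mono mult_left_mono) auto
  finally have G: "E (Gam V (\<lambda>x. f x * g x) (\<lambda>x. f x * g x)) \<le> 2 * prod_const n * real (Suc n) * (A * B)" .
  have "(E (\<lambda>x. f x * g x))\<^sup>2 \<le> (nrm f * nrm g)\<^sup>2"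
    using E_Cauchy_Schwarz[of f g] by (intro abs_le_square_iff[THEN iffD1]) auto
  then have C: "(E (\<lambda>x. f x * g x))\<^sup>2 \<le> A * B"
    by (simp add: power_mult_distrib nrm_sq A_def B_def)
  have "E (\<lambda>x. (f x * g x)\<^sup>2) \<le> A * B + 2 * prod_const n * real (Suc n) * (A * B)"
    using poincare[OF wpoly_mult[OF Suc.prems(1,2)] assms] G C by linarith
  then show ?case by (simp add: A_def B_def algebra_simps)
qed

lemma nrm_prod_le:
  assumes "finite V" "polyf V j f" "polyf V l g"
  shows "nrm (\<lambda>x. f x * g x) \<le> sqrt (prod_const (j + l)) * (nrm f * nrm g)"
proof (rule power2_le_imp_le)
  show "(nrm (\<lambda>x. f x * g x))\<^sup>2 \<le> (sqrt (prod_const (j + l)) * (nrm f * nrm g))\<^sup>2"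
    using E_prod_sq_le[OF assms(1,2,3) order_refl] prod_const_pos[of "j + l"]
    by (simp add: nrm_sq power_mult_distrib)
qed (use prod_const_pos[of "j + l"] in auto)

end

section \<open>Contractions\<close>

text \<open>One descent step costs a factor 2 / (j + l - k) \<le> 2 and, by Cauchy-Schwarz over the
  variables, the square root of j l. The summand 1 keeps the constant at least 1, as required where
  the descent stops.\<close>

fun contr_const :: "nat \<Rightarrow> nat \<Rightarrow> real" where
  "contr_const (Suc j) (Suc l) = 1 + 2 * sqrt (real (Suc j) * real (Suc l)) * contr_const j l"
| "contr_const _ _ = 1"

lemma contr_const_ge_1: "1 \<le> contr_const j l"
  by (induction j l rule: contr_const.induct) (auto intro!: mult_nonneg_nonneg)

context gaussian_family begin

text \<open>An operator norm bound for the contractions of \<open>Y\<close> with chaoses of order at most \<open>s\<close>.\<close>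

definition small where
  "small V k s \<epsilon> Y \<longleftrightarrow> (\<forall>i U Z. 1 \<le> i \<longrightarrow> i \<le> s \<longrightarrow> i < k \<longrightarrow> chaos V i U \<longrightarrow> chaos V (k - i) Z \<longrightarrow>
     \<bar>E (\<lambda>x. Y x * (U x * Z x))\<bar> \<le> \<epsilon> * (nrm U * nrm Z))"

text \<open>The pairing of h with the generator applied to f g is computed twice: by the product
  rule, and by moving the generator to h, where it acts as - c.\<close>

lemma E_Gam_chaos3:
  assumes "finite V" "chaos V a f" "chaos V b g" "chaos V c h"
  shows "2 * E (\<lambda>x. h x * Gam V f g x) = (real a + real b - real c) * E (\<lambda>x. h x * (f x * g x))"
proof -
  have [simp]: "sm f" "sm g" "sm h" using assms chaos_sm by blast+
  have "E (\<lambda>x. h x * Lap V (\<lambda>x. f x * g x) x) = - E (Gam V h (\<lambda>x. f x * g x))"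
    by (rule E_Lap) auto
  also have "\<dots> = - real c * E (\<lambda>x. h x * (f x * g x))"
    using E_Gam_chaos[OF assms(4,1), of "\<lambda>x. f x * g x"] by simp
  finally have 1: "E (\<lambda>x. h x * Lap V (\<lambda>x. f x * g x) x) = - real c * E (\<lambda>x. h x * (f x * g x))" .
  have "(\<lambda>x. h x * Lap V (\<lambda>x. f x * g x) x) = (\<lambda>x. - (real a + real b) * (h x * (f x * g x)) + 2 * (h x * Gam V f g x))"
    by (simp add: fun_eq_iff Lap_mult chaos_Lap[OF assms(2)] chaos_Lap[OF assms(3)] algebra_simps)
  then have "E (\<lambda>x. h x * Lap V (\<lambda>x. f x * g x) x) = - (real a + real b) * E (\<lambda>x. h x * (f x * g x)) + 2 * E (\<lambda>x. h x * Gam V f g x)"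
    by (simp only: E_cmult E_add sm_mult sm_const sm_Gam \<open>sm f\<close> \<open>sm g\<close> \<open>sm h\<close>)
  with 1 show ?thesis by (simp add: algebra_simps)
qed

text \<open>Each step replaces \<open>X\<close> and \<open>Z\<close> by their derivatives and lowers
  j and l by one. Their difference is invariant, so the two strict inequalities persist; they give j
  + l < k as soon as one of the orders is 0. The descent ends at j + l = k, where smallness applies,
  or at j + l < k, where \<open>Y\<close> is orthogonal to the product for reasons of
  degree.\<close>

lemma contraction:
  assumes "finite V" "chaos V k Y" "small V k s \<epsilon> Y" "0 \<le> \<epsilon>"
  shows "chaos V j X \<Longrightarrow> chaos V l Z \<Longrightarrow> j \<le> s \<Longrightarrow> j < k + l \<Longrightarrow> l < k + j \<Longrightarrow>
    \<bar>E (\<lambda>x. Y x * (X x * Z x))\<bar> \<le> contr_const j l * \<epsilon> * (nrm X * nrm Z)"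
proof (induction j arbitrary: l X Z)
  case 0
  have "E (\<lambda>x. Y x * (X x * Z x)) = 0"
    by (rule chaos_orth_polyf[OF assms(2) wpoly_mult[OF chaos_polyf[OF 0(1)] chaos_polyf[OF 0(2)]] assms(1)])
      (use 0 in auto)
  then show ?case using assms(4) contr_const_ge_1[of 0 l] by simp
next
  case (Suc j)
  have [simp]: "sm X" "sm Z" "sm Y" using Suc assms chaos_sm by blast+
  have nn: "0 \<le> \<epsilon> * (nrm X * nrm Z)" using assms(4) by simp
  consider "Suc j + l < k" | "Suc j + l = k" "1 \<le> l" | "Suc j + l > k" "1 \<le> l"
    using Suc.prems by linarith
  then show ?case
  proof cases
    case 1
    have "E (\<lambda>x. Y x * (X x * Z x)) = 0"
      by (rule chaos_orth_polyf[OF assms(2) wpoly_mult[OF chaos_polyf[OF Suc.prems(1)] chaos_polyf[OF Suc.prems(2)]] assms(1)])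
        (use 1 in auto)
    then show ?thesis using assms(4) contr_const_ge_1[of "Suc j" l] by simp
  next
    case 2
    have "k - Suc j = l" using 2 by simp
    then have "\<bar>E (\<lambda>x. Y x * (X x * Z x))\<bar> \<le> \<epsilon> * (nrm X * nrm Z)"
      using assms(3)[unfolded small_def, rule_format, of "Suc j" X Z] Suc.prems(1-3) 2 by auto
    also have "\<dots> \<le> contr_const (Suc j) l * (\<epsilon> * (nrm X * nrm Z))"
      using mult_right_mono[OF contr_const_ge_1[of "Suc j" l] nn] by simp
    finally show ?thesis by (simp add: mult.assoc)
  next
    case 3
    then obtain l' where l: "l = Suc l'" by (cases l) auto
    have "(real (Suc j) + real l - real k) * E (\<lambda>x. Y x * (X x * Z x)) = 2 * E (\<lambda>x. Y x * Gam V X Z x)"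
      using E_Gam_chaos3[OF assms(1) Suc.prems(1,2) assms(2)] by simp
    also have "E (\<lambda>x. Y x * Gam V X Z x) = (\<Sum>i\<in>V. E (\<lambda>x. Y x * (D i X x * D i Z x)))"
      unfolding Gam_def sum_distrib_left by simp
    finally have eq: "(real (Suc j) + real l - real k) * E (\<lambda>x. Y x * (X x * Z x)) = 2 * (\<Sum>i\<in>V. E (\<lambda>x. Y x * (D i X x * D i Z x)))" .
    let ?c = "contr_const j l' * \<epsilon>"
    have c0: "0 \<le> ?c" using contr_const_ge_1[of j l'] assms(4) by simp
    have nD: "(\<Sum>i\<in>V. (nrm (D i f))\<^sup>2) = real m * (nrm f)\<^sup>2" if "chaos V m f" for m f
    proof -
      have [simp]: "sm f" using that assms(1) chaos_sm by blast
      have "(\<Sum>i\<in>V. (nrm (D i f))\<^sup>2) = E (Gam V f f)"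
        unfolding Gam_def[abs_def] nrm_sq by (simp add: power2_eq_square)
      also have "\<dots> = real m * E (\<lambda>x. f x * f x)" using that assms(1) by (intro E_Gam_chaos) auto
      finally show ?thesis unfolding nrm_sq[of f] by (simp only: power2_eq_square)
    qed
    have "\<bar>\<Sum>i\<in>V. E (\<lambda>x. Y x * (D i X x * D i Z x))\<bar> \<le> (\<Sum>i\<in>V. ?c * (nrm (D i X) * nrm (D i Z)))"
    proof (rule order_trans[OF sum_abs], rule sum_mono)
      fix i assume "i \<in> V"
      show "\<bar>E (\<lambda>x. Y x * (D i X x * D i Z x))\<bar> \<le> ?c * (nrm (D i X) * nrm (D i Z))"
        using Suc.prems l \<open>i \<in> V\<close> assms(1) by (intro Suc.IH chaos_D) auto
    qed
    also have "\<dots> = ?c * (\<Sum>i\<in>V. nrm (D i X) * nrm (D i Z))" by (simp add: sum_distrib_left)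
    \<comment> \<open>Cauchy-Schwarz over the variables: the squared norms of the derivatives sum to
      the order times the squared norm, however many variables there are.\<close>
    also have "\<dots> \<le> ?c * (L2_set (\<lambda>i. nrm (D i X)) V * L2_set (\<lambda>i. nrm (D i Z)) V)"
      using L2_set_mult_ineq[of "\<lambda>i. nrm (D i X)" "\<lambda>i. nrm (D i Z)" V] c0 by (intro mult_left_mono) auto
    also have "\<dots> = ?c * (sqrt (real (Suc j) * real l) * (nrm X * nrm Z))"
      unfolding L2_set_def nD[OF Suc.prems(1)] nD[OF Suc.prems(2)] by (simp add: real_sqrt_mult)
    finally have 4: "\<bar>\<Sum>i\<in>V. E (\<lambda>x. Y x * (D i X x * D i Z x))\<bar> \<le> ?c * (sqrt (real (Suc j) * real l) * (nrm X * nrm Z))" .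
    \<comment> \<open>The factor is a positive integer, so it may be dropped on the left.\<close>
    have "1 \<le> real (Suc j) + real l - real k" using 3 by linarith
    then have "\<bar>E (\<lambda>x. Y x * (X x * Z x))\<bar> \<le> \<bar>(real (Suc j) + real l - real k) * E (\<lambda>x. Y x * (X x * Z x))\<bar>"
      unfolding abs_mult by (simp add: mult_le_cancel_right1)
    also have "\<dots> \<le> 2 * (?c * (sqrt (real (Suc j) * real l) * (nrm X * nrm Z)))"
      unfolding eq using 4 by (simp add: abs_mult)
    also have "\<dots> = (contr_const (Suc j) l - 1) * (\<epsilon> * (nrm X * nrm Z))" by (simp add: l)
    also have "\<dots> \<le> contr_const (Suc j) l * (\<epsilon> * (nrm X * nrm Z))"
      using nn by (intro mult_right_mono) auto
    finally show ?thesis by (simp add: mult.assoc)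
  qed
qed

text \<open>A crude choice: k + j replaces (k + j - l) / 2, and the sum runs over more orders than
  the carre du champ has.\<close>

definition conc_const :: "nat \<Rightarrow> nat \<Rightarrow> real" where
  "conc_const k j = (\<Sum>l\<le>k + j. real (k + j) * contr_const j l)"

lemma Gam_polyf:
  assumes "finite V" "polyf V k f" "polyf V j g" "1 \<le> k" "1 \<le> j"
  shows "polyf V (k + j - 2) (Gam V f g)"
proof -
  have "polyf V ((k - 1) + (j - 1)) (\<lambda>x. D i f x * D i g x)" for i
    using assms by (intro wpoly_mult polyf_D)
  moreover have "(k - 1) + (j - 1) = k + j - 2" using assms by simp
  ultimately have "polyf V (k + j - 2) (\<lambda>x. \<Sum>i\<in>V. D i f x * D i g x)"
    by (intro wpoly_sum) simp
  then show ?thesis by (simp add: Gam_def[abs_def])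
qed

text \<open>The deviation \<open>R\<close> from the mean is paired with its own chaos components:
  the pairing with the component of order l is (k + j - l) / 2 times the expectation of Y X
  \<open>Z l\<close>, which \<open>contraction\<close> bounds. Summation bounds the square of
  \<open>nrm R\<close> with one factor \<open>nrm R\<close> on the right, which cancels.\<close>

lemma concentration:
  assumes "finite V" "chaos V k Y" "small V k s \<epsilon> Y" "0 \<le> \<epsilon>"
    and "chaos V j X" "1 \<le> j" "j \<le> s" "j \<le> k"
  shows "nrm (\<lambda>x. Gam V Y X x - E (Gam V Y X)) \<le> conc_const k j * \<epsilon> * nrm X"
proof -
  have [simp]: "sm X" "sm Y" using assms chaos_sm by blast+
  define R where "R x = Gam V Y X x - E (Gam V Y X)" for x
  have [simp]: "sm R" unfolding R_def[abs_def] by auto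
  have "polyf V (k + j - 2) R"
    unfolding R_def[abs_def]
    using assms by (intro wpoly_diff Gam_polyf wpoly_const chaos_polyf) auto
  then obtain Z where Z: "\<And>l. chaos V l (Z l)" "R = (\<lambda>x. \<Sum>l\<le>k + j - 2. Z l x)"
    using chaos_decomposition[OF assms(1)] by blast
  have [simp]: "sm (Z l)" for l using Z assms(1) chaos_sm by blast
  have "E R = 0" unfolding R_def by simp
  moreover obtain c where "Z 0 = (\<lambda>x. c)" using chaos_0D Z(1) by blast
  ultimately have Z0: "Z 0 = (\<lambda>x. 0)" using chaos_parseval(3)[OF assms(1) Z] by simp
  have nZ: "nrm (Z l) \<le> nrm R" if "l \<le> k + j - 2" for l
    unfolding nrm_def chaos_parseval(2)[OF assms(1) Z]
    using that by (intro real_sqrt_le_mono member_le_sum) (auto intro: E_nonneg)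
  have bnd: "E (\<lambda>x. R x * Z l x) \<le> real (k + j) * contr_const j l * \<epsilon> * nrm X * nrm R" if l: "l \<le> k + j - 2" for l
  proof (cases "l = 0")
    case True
    then show ?thesis using Z0 contr_const_ge_1[of j 0] assms(4) by simp
  next
    case False
    have "E (Z l) = 0" using chaos_orth[OF Z(1)[of l] chaos_const[of V 1] assms(1)] False by simp
    have "(\<lambda>x. R x * Z l x) = (\<lambda>x. Z l x * Gam V Y X x - E (Gam V Y X) * Z l x)"
      by (simp add: R_def fun_eq_iff algebra_simps)
    then have "2 * E (\<lambda>x. R x * Z l x) = 2 * E (\<lambda>x. Z l x * Gam V Y X x)"
      using \<open>E (Z l) = 0\<close> by simp
    also have "\<dots> = (real k + real j - real l) * E (\<lambda>x. Y x * (X x * Z l x))"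
      using E_Gam_chaos3[OF assms(1,2,5) Z(1)[of l]] by (simp add: mult_ac)
    also have "\<dots> \<le> (real k + real j - real l) * (contr_const j l * \<epsilon> * (nrm X * nrm (Z l)))"
    proof (rule mult_left_mono)
      \<comment> \<open>Centring has removed l = 0, so j \<le> k gives the first inequality; the
        second reflects that the carre du champ has degree at most k + j - 2.\<close>
      have "j < k + l" "l < k + j" using assms(6-8) False l by linarith+
      then show "E (\<lambda>x. Y x * (X x * Z l x)) \<le> contr_const j l * \<epsilon> * (nrm X * nrm (Z l))"
        using contraction[OF assms(1-4) assms(5) Z(1)[of l] assms(7)] by linarith
    qed (use l in linarith)
    also have "\<dots> \<le> (2 * real (k + j)) * (contr_const j l * \<epsilon> * (nrm X * nrm R))"
      using nZ[OF l] contr_const_ge_1[of j l] assms(4)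
      by (intro mult_mono) (auto intro!: mult_nonneg_nonneg mult_left_mono)
    also have "\<dots> = 2 * (real (k + j) * contr_const j l * \<epsilon> * nrm X * nrm R)"
      by (simp only: mult_ac)
    finally show ?thesis by linarith
  qed
  have "(nrm R)\<^sup>2 = (\<Sum>l\<le>k + j - 2. E (\<lambda>x. R x * Z l x))"
    unfolding nrm_sq chaos_parseval(2)[OF assms(1) Z]
    by (intro sum.cong refl chaos_parseval(1)[OF assms(1) Z, symmetric]) auto
  also have "\<dots> \<le> (\<Sum>l\<le>k + j - 2. real (k + j) * contr_const j l * \<epsilon> * nrm X * nrm R)"
    by (intro sum_mono bnd) auto
  also have "\<dots> \<le> (\<Sum>l\<le>k + j. real (k + j) * contr_const j l * \<epsilon> * nrm X * nrm R)"
    using assms(4)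
    by (intro sum_mono2) (auto intro!: mult_nonneg_nonneg order_trans[OF zero_le_one contr_const_ge_1])
  also have "\<dots> = conc_const k j * \<epsilon> * nrm X * nrm R"
    by (simp add: conc_const_def sum_distrib_right)
  finally have "nrm R * nrm R \<le> (conc_const k j * \<epsilon> * nrm X) * nrm R" by (simp add: power2_eq_square)
  moreover have "0 \<le> conc_const k j * \<epsilon> * nrm X"
    unfolding conc_const_def using assms(4)
    by (intro mult_nonneg_nonneg sum_nonneg) (auto intro!: mult_nonneg_nonneg order_trans[OF zero_le_one contr_const_ge_1])
  ultimately have "nrm R \<le> conc_const k j * \<epsilon> * nrm X"
    by (metis mult_le_cancel_right nrm_nonneg order_le_less)
  then show ?thesis unfolding R_def[abs_def] .
qed

end

section \<open>Multilinear polynomials\<close>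

definition xprod :: "nat set \<Rightarrow> (nat \<Rightarrow> real) \<Rightarrow> real" where
  "xprod I x = (\<Prod>i\<in>I. x i)"

lemma xprod_empty: "xprod {} = (\<lambda>x. 1)"
  by (simp add: xprod_def fun_eq_iff)

lemma xprod_insert: "finite I \<Longrightarrow> i \<notin> I \<Longrightarrow> xprod (insert i I) = (\<lambda>x. x i * xprod I x)"
  by (simp add: xprod_def fun_eq_iff)

lemma xprod_remove: "finite I \<Longrightarrow> i \<in> I \<Longrightarrow> xprod I = (\<lambda>x. x i * xprod (I - {i}) x)"
  by (simp add: xprod_def fun_eq_iff prod.remove)

lemma smooth_xprod: "finite I \<Longrightarrow> smooth I (xprod I)"
  by (induction rule: finite_induct)
    (auto simp: xprod_empty xprod_insert intro!: smooth.intros intro: smooth_mono)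

lemma sm_xprod [simp]: "finite I \<Longrightarrow> sm (xprod I)"
  using smooth_xprod smooth_imp_sm by blast

lemma D_xprod_notin: "finite I \<Longrightarrow> i \<notin> I \<Longrightarrow> D i (xprod I) = (\<lambda>x. 0)"
  using D_outside smooth_xprod by blast

lemma chaos_xprod:
  assumes "finite V" "finite I" "I \<subseteq> V" shows "chaos V (card I) (xprod I)"
  using assms(2,3)
proof (induction rule: finite_induct)
  case empty
  then show ?case by (simp add: xprod_empty chaos_const)
next
  case (insert i I)
  then have IH: "chaos V (card I) (xprod I)" "i \<in> V" by auto
  have [simp]: "sm (xprod I)" using insert by simp
  have Lv: "Lap V (\<lambda>x. x i) x = - x i" for x
    using IH(2) assms(1) unfolding Lap_def
    by (simp add: if_distrib[of "\<lambda>c. _ * c"] sum_negf cong: if_cong)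
  have Gv: "Gam V (\<lambda>x. x i) (xprod I) x = 0" for x
    using D_xprod_notin[OF insert(1,2)] unfolding Gam_def
    by (intro sum.neutral) auto
  have "polyf V (card (insert i I)) (xprod (insert i I))"
    using insert IH chaos_polyf[OF IH(1)] by (auto simp: xprod_insert intro!: wpoly_var_mult)
  moreover have "Lap V (xprod (insert i I)) x = - real (card (insert i I)) * xprod (insert i I) x" for x
    using insert by (simp add: xprod_insert Lap_mult Lv Gv chaos_Lap[OF IH(1)] algebra_simps)
  ultimately show ?case by (simp add: chaos_def)
qed

lemma hom_poly_xprod: "hom_poly d a x = (\<Sum>I \<in> {I \<in> increasing_tuples d. a I \<noteq> 0}. a I * xprod I x)"
  by (simp add: hom_poly_def xprod_def)

definition coeffs_in :: "nat set \<Rightarrow> nat \<Rightarrow> (nat set \<Rightarrow> real) \<Rightarrow> bool" where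
  "coeffs_in V d a \<longleftrightarrow> (\<forall>I\<in>increasing_tuples d. a I \<noteq> 0 \<longrightarrow> I \<subseteq> V)"

lemma coeffs_in_finite: "finite V \<Longrightarrow> coeffs_in V d a \<Longrightarrow> finite_coeffs d a"
  unfolding finite_coeffs_def by (rule finite_subset[of _ "Pow V"]) (auto simp: coeffs_in_def)

lemma coeffs_in_exists: "finite_coeffs d a \<Longrightarrow> \<exists>N. \<forall>n\<ge>N. coeffs_in {..<n} d a"
proof -
  assume "finite_coeffs d a"
  then have "finite (\<Union>{I \<in> increasing_tuples d. a I \<noteq> 0})"
    by (auto simp: finite_coeffs_def increasing_tuples_def)
  then obtain N where "\<forall>i\<in>\<Union>{I \<in> increasing_tuples d. a I \<noteq> 0}. i < N"
    using finite_nat_set_iff_bounded by blast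
  then have "\<forall>n\<ge>N. coeffs_in {..<n} d a" unfolding coeffs_in_def by fastforce
  then show ?thesis by blast
qed

lemma chaos_hom_poly:
  assumes "finite V" "coeffs_in V d a" shows "chaos V d (hom_poly d a)"
proof -
  have "chaos V d (xprod I)" if "I \<in> increasing_tuples d" "a I \<noteq> 0" for I
    using that assms chaos_xprod[of V I] by (auto simp: increasing_tuples_def coeffs_in_def)
  then show ?thesis
    unfolding hom_poly_xprod[abs_def] by (intro chaos_sum chaos_cmult assms) auto
qed

context gaussian_family begin

lemma E_xprod_ibp: "finite I \<Longrightarrow> i \<in> I \<Longrightarrow> sm f \<Longrightarrow> E (\<lambda>x. xprod I x * f x) = E (\<lambda>x. xprod (I - {i}) x * D i f x)"
  using E_ibp[of "\<lambda>x. xprod (I - {i}) x * f x" i]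
  by (simp add: xprod_remove[of I i] D_xprod_notin mult.assoc)

text \<open>Independence and unit second moments: one integration by parts removes each variable of
  \<open>S\<close>, since \<open>g\<close> does not contain it.\<close>

lemma E_xprod_sq_mult:
  assumes "finite S" "smooth V g" "finite V"
  shows "S \<inter> V = {} \<Longrightarrow> E (\<lambda>x. (xprod S x)\<^sup>2 * g x) = E g"
  using assms(1)
proof (induction rule: finite_induct)
  case empty
  then show ?case by (simp add: xprod_empty)
next
  case (insert i S)
  have [simp]: "sm g" using assms smooth_imp_sm by blast
  have [simp]: "sm (xprod S)" using insert by simp
  have [simp]: "D i g = (\<lambda>x. 0)" using D_outside[OF assms(2)] insert by blast
  have "(\<lambda>x. (xprod (insert i S) x)\<^sup>2 * g x) = (\<lambda>x. x i * (x i * ((xprod S x * xprod S x) * g x)))"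
    using insert by (simp add: xprod_insert fun_eq_iff power2_eq_square algebra_simps)
  moreover have "E (\<lambda>x. x i * (x i * ((xprod S x * xprod S x) * g x))) = E (\<lambda>x. (xprod S x)\<^sup>2 * g x)"
    using insert by (subst E_ibp) (auto simp: D_xprod_notin power2_eq_square)
  ultimately show ?case using insert by simp
qed

lemma E_xprod_orth:
  assumes "finite I" "finite J"
  shows "E (\<lambda>x. xprod I x * xprod J x) = (if I = J then 1 else 0)"
proof (cases "I = J")
  case True
  then show ?thesis using E_xprod_sq_mult[OF assms(1) smooth_const[of "{}" 1]]
    by (simp add: power2_eq_square)
next
  case False
  then consider i where "i \<in> I" "i \<notin> J" | i where "i \<in> J" "i \<notin> I" by auto
  then show ?thesis
  proof cases
    case 1
    then show ?thesis using False assms by (simp add: E_xprod_ibp[of I i] D_xprod_notin)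
  next
    case 2
    then show ?thesis using False assms E_xprod_ibp[of J i "xprod I"]
      by (simp add: D_xprod_notin mult.commute)
  qed
qed

text \<open>Integration by parts along \<open>J\<close> distributes its p + q variables between
  \<open>A\<close> and \<open>B\<close>. As the degrees are at most p and q, only distributions with
  exactly p variables on \<open>A\<close> survive; there the derivative of \<open>A\<close> is a
  constant, namely the expectation of \<open>A\<close> against the monomial of these variables, and
  that is 0.\<close>

lemma E_xprod_mult_orth:
  assumes "finite V"
  shows "finite J \<Longrightarrow> card J = p + q \<Longrightarrow> polyf V p A \<Longrightarrow> polyf V q B \<Longrightarrow>
    (\<And>I. I \<subseteq> J \<Longrightarrow> card I = p \<Longrightarrow> E (\<lambda>x. xprod I x * A x) = 0) \<Longrightarrow>
    E (\<lambda>x. xprod J x * (A x * B x)) = 0"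
proof (induction "card J" arbitrary: J p q A B)
  case 0
  then obtain c where c: "A = (\<lambda>x. c)" using polyf_0 by auto
  have "E (\<lambda>x. xprod {} x * A x) = 0" using 0 by auto
  then have "c = 0" by (simp add: xprod_empty c)
  then show ?case by (simp add: c)
next
  case (Suc n)
  have [simp]: "sm A" "sm B" using Suc.prems assms wpoly_sm by blast+
  obtain i where i: "i \<in> J" using Suc.hyps(2) by (metis card.empty ex_in_conv nat.distinct(1))
  have cJ: "n = card (J - {i})" "finite (J - {i})" using Suc i by auto
  have "E (\<lambda>x. xprod J x * (A x * B x)) = E (\<lambda>x. xprod (J - {i}) x * (D i A x * B x)) + E (\<lambda>x. xprod (J - {i}) x * (A x * D i B x))"
    using E_xprod_ibp[OF Suc.prems(1) i, of "\<lambda>x. A x * B x"] cJ by (simp add: distrib_left)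
  also have "E (\<lambda>x. xprod (J - {i}) x * (D i A x * B x)) = 0"
  proof (cases p)
    case 0
    then obtain c where c: "A = (\<lambda>x. c)" using polyf_0 Suc.prems by blast
    then show ?thesis by simp
  next
    case p: (Suc p')
    show ?thesis
    proof (rule Suc.hyps(1)[OF cJ(1,2), of p' q])
      show "card (J - {i}) = p' + q" using cJ Suc.hyps(2) Suc.prems p by auto
      show "polyf V p' (D i A)" using polyf_D[OF Suc.prems(3) assms, of i] p by simp
      show "polyf V q B" by fact
      fix I assume I: "I \<subseteq> J - {i}" "card I = p'"
      then have fI: "finite I" "i \<notin> I" using cJ(2) finite_subset by auto
      \<comment> \<open>The hypothesis for \<open>D i A\<close> and \<open>I\<close> is the one for
        \<open>A\<close> and \<open>insert i I\<close>, again by parts.\<close>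
      have "E (\<lambda>x. xprod (insert i I) x * A x) = 0"
        using I fI i p by (intro Suc.prems(5)) auto
      then show "E (\<lambda>x. xprod I x * D i A x) = 0"
        using E_xprod_ibp[of "insert i I" i A] fI by simp
    qed
  qed
  also have "E (\<lambda>x. xprod (J - {i}) x * (A x * D i B x)) = 0"
  proof (cases q)
    case 0
    then obtain c where c: "B = (\<lambda>x. c)" using polyf_0 Suc.prems by blast
    then show ?thesis by simp
  next
    case q: (Suc q')
    show ?thesis
    proof (rule Suc.hyps(1)[OF cJ(1,2), of p q'])
      show "card (J - {i}) = p + q'" using cJ Suc.hyps(2) Suc.prems q by auto
      show "polyf V q' (D i B)" using polyf_D[OF Suc.prems(4) assms, of i] q by simp
    qed (use Suc.prems in auto)
  qed
  finally show ?case by simp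
qed

lemma E_hom_poly_xprod:
  assumes "finite_coeffs k b" "I \<in> increasing_tuples k"
  shows "E (\<lambda>x. hom_poly k b x * xprod I x) = b I"
proof -
  let ?S = "{I \<in> increasing_tuples k. b I \<noteq> 0}"
  have fin: "finite ?S" using assms by (simp add: finite_coeffs_def)
  have [simp]: "finite I" "\<And>J. J \<in> ?S \<Longrightarrow> finite J" using assms by (auto simp: increasing_tuples_def)
  have "E (\<lambda>x. hom_poly k b x * xprod I x) = E (\<lambda>x. \<Sum>J\<in>?S. b J * (xprod J x * xprod I x))"
    by (simp add: hom_poly_xprod sum_distrib_right mult.assoc)
  also have "\<dots> = (\<Sum>J\<in>?S. b J * E (\<lambda>x. xprod J x * xprod I x))"
    by (subst E_sum) auto
  also have "\<dots> = (\<Sum>J\<in>?S. if J = I then b I else 0)"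
    by (intro sum.cong refl) (auto simp: E_xprod_orth)
  also have "\<dots> = b I" using fin assms by auto
  finally show ?thesis .
qed

lemma sm_hom_poly [simp]: "sm (hom_poly k b)"
  unfolding hom_poly_xprod[abs_def] by (intro sm_sum sm_mult) (auto simp: increasing_tuples_def)

lemma E_hom_poly_mult:
  assumes "finite_coeffs k b" "sm f"
  shows "E (\<lambda>x. hom_poly k b x * f x) = (\<Sum>I\<in>{I \<in> increasing_tuples k. b I \<noteq> 0}. b I * E (\<lambda>x. xprod I x * f x))"
  unfolding hom_poly_xprod sum_distrib_right mult.assoc using assms
  by (subst E_sum) (auto simp: increasing_tuples_def)

lemma nrm_hom_poly_sq:
  assumes "finite_coeffs k b"
  shows "(nrm (hom_poly k b))\<^sup>2 = (\<Sum>I\<in>{I \<in> increasing_tuples k. b I \<noteq> 0}. (b I)\<^sup>2)"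
  unfolding nrm_sq using E_hom_poly_mult[OF assms, of "hom_poly k b"] E_hom_poly_xprod[OF assms]
  by (simp add: power2_eq_square mult.commute)

lemma L2_norm_eq_nrm: "L2_norm M (\<lambda>\<omega>. f (\<lambda>i. G i \<omega>)) = nrm f"
  by (simp add: L2_norm_def nrm_def E_def)

text \<open>Multiplying a test function of order \<open>i\<close> by \<open>s - i\<close> fresh variables yields one of order \<open>s\<close> without
  changing the norms involved.\<close>

lemma rho_tilde_nrm_le:
  assumes V: "finite V" "coeffs_in V d a" "coeffs_in V i b" and i: "i \<le> s"
    and r: "rho_tilde M G s (hom_poly d a) \<le> ereal r"
  shows "nrm (Gam V (hom_poly d a) (hom_poly i b)) \<le> r * nrm (hom_poly i b)"
proof -
  let ?F = "hom_poly d a" and ?X = "hom_poly i b"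
  note fb = coeffs_in_finite[OF V(1,3)]
  have sF: "smooth V ?F" "smooth V ?X"
    using chaos_hom_poly[OF V(1)] V chaos_polyf wpoly_smooth by blast+
  show ?thesis
  \<comment> \<open>Test functions in the supremum have norm at most 1, so \<open>?X\<close> is
    normalised; if its norm is 0, all its coefficients vanish.\<close>
  proof (cases "nrm ?X = 0")
    case True
    then have "(\<Sum>I\<in>{I \<in> increasing_tuples i. b I \<noteq> 0}. (b I)\<^sup>2) = 0"
      using nrm_hom_poly_sq[OF fb] by simp
    then have "{I \<in> increasing_tuples i. b I \<noteq> 0} = {}"
      using fb by (subst (asm) sum_nonneg_eq_0_iff) (auto simp: finite_coeffs_def)
    then have "?X = (\<lambda>x. 0)" by (auto simp: hom_poly_def fun_eq_iff)
    then show ?thesis by (simp add: Gam_def[abs_def])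
  next
    case False
    define \<nu> where "\<nu> = nrm ?X"
    have \<nu>: "\<nu> > 0" using False nrm_nonneg[of ?X] unfolding \<nu>_def by linarith
    obtain S where S: "finite S" "card S = s - i" "S \<inter> V = {}"
    proof -
      have "infinite (- V)" using V(1) by (simp add: finite_compl)
      then obtain S where "S \<subseteq> - V" "card S = s - i" "finite S"
        using infinite_arbitrarily_large by metis
      then show ?thesis using that by blast
    qed
    \<comment> \<open>The coefficients of \<open>?X\<close> divided by \<nu> and multiplied by the
      monomial of the fresh set \<open>S\<close>.\<close>
    define b' where "b' J = (if S \<subseteq> J then b (J - S) / \<nu> else 0)" for J
    define T where "T = {I \<in> increasing_tuples i. b I \<noteq> 0}"
    have TV: "I \<subseteq> V" if "I \<in> T" for I using that V(3) by (auto simp: T_def coeffs_in_def)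
    have disj: "I \<inter> S = {}" if "I \<in> T" for I using TV[OF that] S by auto
    have Tset: "{I \<in> increasing_tuples s. b' I \<noteq> 0} = (\<lambda>I. I \<union> S) ` T"
    proof (intro equalityI subsetI)
      fix J assume J: "J \<in> {I \<in> increasing_tuples s. b' I \<noteq> 0}"
      then have SJ: "S \<subseteq> J" "b (J - S) \<noteq> 0" "finite J" "card J = s"
        by (auto simp: b'_def increasing_tuples_def split: if_splits)
      then have "card (J - S) = i" using S i by (simp add: card_Diff_subset)
      then have "J - S \<in> T" using SJ by (auto simp: T_def increasing_tuples_def)
      moreover have "J = (J - S) \<union> S" using SJ by auto
      ultimately show "J \<in> (\<lambda>I. I \<union> S) ` T" by blast
    next
      fix J assume "J \<in> (\<lambda>I. I \<union> S) ` T"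
      then obtain I where I: "I \<in> T" "J = I \<union> S" by auto
      then have "J - S = I" using disj by auto
      moreover have "card J = s" using I disj[OF I(1)] S i
        by (auto simp: T_def increasing_tuples_def card_Un_disjoint)
      ultimately show "J \<in> {I \<in> increasing_tuples s. b' I \<noteq> 0}"
        using I S \<nu> by (auto simp: b'_def T_def increasing_tuples_def)
    qed
    have inj: "inj_on (\<lambda>I. I \<union> S) T"
      by (rule inj_onI) (use disj in blast)
    have hp: "hom_poly s b' = (\<lambda>x. xprod S x * (1 / \<nu> * ?X x))"
    proof
      fix x
      have "hom_poly s b' x = (\<Sum>I\<in>T. b' (I \<union> S) * xprod (I \<union> S) x)"
        unfolding hom_poly_xprod Tset by (subst sum.reindex[OF inj]) simp
      also have "\<dots> = (\<Sum>I\<in>T. xprod S x * (1 / \<nu> * (b I * xprod I x)))"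
      proof (rule sum.cong)
        fix I assume I: "I \<in> T"
        then have "I \<union> S - S = I" "finite I" using disj by (auto simp: T_def increasing_tuples_def)
        then show "b' (I \<union> S) * xprod (I \<union> S) x = xprod S x * (1 / \<nu> * (b I * xprod I x))"
          using disj[OF I] S by (simp add: b'_def xprod_def prod.union_disjoint)
      qed simp
      also have "\<dots> = xprod S x * (1 / \<nu> * ?X x)"
        by (simp add: hom_poly_xprod T_def sum_distrib_left)
      finally show "hom_poly s b' x = xprod S x * (1 / \<nu> * ?X x)" .
    qed
    have nS: "nrm (\<lambda>x. xprod S x * g x) = nrm g" if "smooth V g" for g
      unfolding nrm_def power_mult_distrib
      using E_xprod_sq_mult[OF S(1) _ V(1) S(3), of "\<lambda>x. g x * g x"] that
      by (simp add: smooth_mult power2_eq_square)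
    have Gm: "(suminf (\<lambda>j. D j ?F x * D j (hom_poly s b') x)) = xprod S x * (1 / \<nu> * Gam V ?F ?X x)" for x
    proof -
      \<comment> \<open>\<open>?F\<close> contains no variable outside \<open>V\<close>: the series
        is a finite sum to which the fresh variables contribute nothing.\<close>
      have "(suminf (\<lambda>j. D j ?F x * D j (hom_poly s b') x)) = (\<Sum>j\<in>V. D j ?F x * D j (hom_poly s b') x)"
        using V(1) D_outside[OF sF(1)] by (intro suminf_finite) auto
      also have "\<dots> = (\<Sum>j\<in>V. xprod S x * (1 / \<nu> * (D j ?F x * D j ?X x)))"
      proof (rule sum.cong)
        fix j assume "j \<in> V"
        then have "D j (xprod S) = (\<lambda>x. 0)" using S by (intro D_xprod_notin) auto
        moreover have "D j (\<lambda>x. 1 / \<nu> * ?X x) = (\<lambda>x. 1 / \<nu> * D j ?X x)" by (rule D_cmult) simp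
        ultimately have "D j (hom_poly s b') x = xprod S x * (1 / \<nu> * D j ?X x)"
          unfolding hp by (subst D_mult) (use S in auto)
        then show "D j ?F x * D j (hom_poly s b') x = xprod S x * (1 / \<nu> * (D j ?F x * D j ?X x))"
          by simp
      qed simp
      also have "\<dots> = xprod S x * (1 / \<nu> * Gam V ?F ?X x)"
        unfolding Gam_def by (simp add: sum_distrib_left)
      finally show ?thesis .
    qed
    have "finite_coeffs s b'"
      unfolding finite_coeffs_def Tset using fb by (auto simp: T_def finite_coeffs_def)
    moreover have "nrm (hom_poly s b') \<le> 1"
    proof -
      have "nrm (hom_poly s b') = nrm (\<lambda>x. 1 / \<nu> * ?X x)"
        unfolding hp by (rule nS) (intro smooth.intros sF)
      then show ?thesis using \<nu> unfolding nrm_cmult by (simp add: \<nu>_def)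
    qed
    ultimately have "ereal (L2_norm M (\<lambda>\<omega>. suminf (\<lambda>j. D j ?F (\<lambda>j. G j \<omega>) * D j (hom_poly s b') (\<lambda>j. G j \<omega>)))) \<le> ereal r"
      using r unfolding rho_tilde_def
      by (intro order_trans[OF SUP_upper r[unfolded rho_tilde_def]]) (auto simp: L2_norm_eq_nrm)
    then have "nrm (\<lambda>x. xprod S x * (1 / \<nu> * Gam V ?F ?X x)) \<le> r"
      unfolding Gm by (simp add: L2_norm_eq_nrm[of "\<lambda>x. xprod S x * (1 / \<nu> * Gam V ?F ?X x)", simplified] )
    moreover have "smooth V (Gam V ?F ?X)"
    proof -
      have "smooth V (\<lambda>x. \<Sum>i\<in>A. D i ?F x * D i ?X x)" for A
        by (induction A rule: infinite_finite_induct) (auto intro!: smooth.intros smooth_D sF V)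
      then show ?thesis unfolding Gam_def[abs_def] .
    qed
    then have "nrm (\<lambda>x. xprod S x * (1 / \<nu> * Gam V ?F ?X x)) = nrm (\<lambda>x. 1 / \<nu> * Gam V ?F ?X x)"
      by (intro nS smooth.intros)
    ultimately have "1 / \<nu> * nrm (Gam V ?F ?X) \<le> r"
      using \<nu> unfolding nrm_cmult by simp
    then show ?thesis using \<nu> by (simp add: \<nu>_def[symmetric] field_simps)
  qed
qed

text \<open>Since \<open>F\<close> is multilinear, only the multilinear part of \<open>U\<close> contributes to \<open>E[F U Z]\<close>.\<close>

lemma rho_tilde_small:
  assumes V: "finite V" "coeffs_in V d a" and "s < d"
    and r: "rho_tilde M G s (hom_poly d a) \<le> ereal r" "0 \<le> r"
  shows "small V d s r (hom_poly d a)"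
  unfolding small_def
proof (intro allI impI)
  fix i U Z assume i: "1 \<le> i" "i \<le> s" "i < d" and U: "chaos V i U" and Z: "chaos V (d - i) Z"
  let ?F = "hom_poly d a"
  have [simp]: "sm U" "sm Z" using U Z chaos_sm V by blast+
  note fa = coeffs_in_finite[OF V]
  \<comment> \<open>The coefficients of the orthogonal projection of \<open>U\<close> onto the
    multilinear polynomials of order i in the variables \<open>V\<close>.\<close>
  define b where "b I = (if I \<subseteq> V then E (\<lambda>x. xprod I x * U x) else 0)" for I
  have b: "coeffs_in V i b" unfolding coeffs_in_def b_def by meson
  note fb = coeffs_in_finite[OF V(1) b]
  let ?X = "hom_poly i b"
  have X: "chaos V i ?X" using chaos_hom_poly[OF V(1) b] .
  have "nrm ?X * nrm ?X = E (\<lambda>x. ?X x * U x)"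
    unfolding E_hom_poly_mult[OF fb \<open>sm U\<close>] power2_eq_square[symmetric] nrm_hom_poly_sq[OF fb]
    by (intro sum.cong refl) (auto simp: b_def power2_eq_square split: if_splits)
  also have "\<dots> \<le> nrm ?X * nrm U" using E_Cauchy_Schwarz[of ?X U] by simp
  finally have nX: "nrm ?X \<le> nrm U" by (metis mult_le_cancel_left_pos nrm_nonneg order_le_less)
  have dX: "chaos V i (\<lambda>x. U x - ?X x)" using U X V by (intro chaos_diff)
  have "E (\<lambda>x. ?F x * ((U x - ?X x) * Z x)) = 0"
  proof -
    have "E (\<lambda>x. xprod J x * ((U x - ?X x) * Z x)) = 0" if J: "J \<in> increasing_tuples d" "a J \<noteq> 0" for J
    proof (rule E_xprod_mult_orth[OF V(1), of J i "d - i"])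
      have JV: "J \<subseteq> V" "finite J" "card J = d" using J V(2) by (auto simp: coeffs_in_def increasing_tuples_def)
      then show "finite J" "card J = i + (d - i)" using i by auto
      show "polyf V i (\<lambda>x. U x - ?X x)" "polyf V (d - i) Z" using dX Z chaos_polyf by blast+
      fix I assume I: "I \<subseteq> J" "card I = i"
      then have "I \<in> increasing_tuples i" "I \<subseteq> V" using JV finite_subset by (auto simp: increasing_tuples_def)
      moreover from this have "E (\<lambda>x. ?X x * xprod I x) = b I" using E_hom_poly_xprod[OF fb] by blast
      ultimately show "E (\<lambda>x. xprod I x * (U x - ?X x)) = 0"
        by (simp add: right_diff_distrib b_def increasing_tuples_def mult.commute[of _ "hom_poly _ _ _"])
    qed
    then show ?thesis
      by (subst E_hom_poly_mult[OF fa]) (auto intro!: sum.neutral)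
  qed
  then have "E (\<lambda>x. ?F x * (U x * Z x)) = E (\<lambda>x. ?F x * (?X x * Z x))"
    by (simp add: left_diff_distrib right_diff_distrib)
  \<comment> \<open>The orders d, i and d - i give the factor d + i - (d - i) = 2 i, and i \<ge> 1
    allows dividing by it.\<close>
  moreover have "real i * E (\<lambda>x. ?F x * (?X x * Z x)) = E (\<lambda>x. Z x * Gam V ?F ?X x)"
    using E_Gam_chaos3[OF V(1) chaos_hom_poly[OF V] X Z] i by (simp add: of_nat_diff mult_ac)
  moreover have "\<bar>E (\<lambda>x. Z x * Gam V ?F ?X x)\<bar> \<le> nrm Z * nrm (Gam V ?F ?X)"
    by (rule E_Cauchy_Schwarz) auto
  moreover have "nrm Z * nrm (Gam V ?F ?X) \<le> nrm Z * (r * nrm U)"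
    using rho_tilde_nrm_le[OF V b i(2) r(1)] nX r(2)
    by (intro mult_left_mono) (auto intro: order_trans mult_left_mono)
  moreover have "\<bar>E (\<lambda>x. ?F x * (?X x * Z x))\<bar> \<le> \<bar>real i * E (\<lambda>x. ?F x * (?X x * Z x))\<bar>"
    using i by (simp add: abs_mult mult_le_cancel_right1)
  ultimately show "\<bar>E (\<lambda>x. ?F x * (U x * Z x))\<bar> \<le> r * (nrm U * nrm Z)"
    by (simp add: mult_ac)
qed

end

section \<open>Sequences along an ultrafilter\<close>

definition ultra :: "'a filter \<Rightarrow> bool" where
  "ultra U \<longleftrightarrow> U \<noteq> bot \<and> (\<forall>P. eventually P U \<or> eventually (\<lambda>x. \<not> P x) U)"

text \<open>Zorn's lemma for the proper filters below \<open>F\<close>, ordered by refinement. The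
  infimum of a chain stays proper because whatever holds eventually for it already does so for one
  member. A finest filter decides every \<open>P\<close>: if restricting it to \<open>P\<close>
  leaves a proper filter, this is the filter itself.\<close>

lemma ultra_exists:
  fixes F :: "'a filter"
  assumes "F \<noteq> bot"
  shows "\<exists>U\<le>F. ultra U"
proof -
  define A where "A = {U. U \<le> F \<and> U \<noteq> bot}"
  let ?P = "\<lambda>a b :: 'a filter. b \<le> a"
  have po: "partial_order_on A (relation_of ?P A)"
    by (rule partial_order_on_relation_ofI) auto
  have "\<exists>m\<in>A. \<forall>a\<in>A. ?P m a \<longrightarrow> a = m"
  proof (rule predicate_Zorn[OF po])
    fix C assume C: "C \<in> Chains (relation_of ?P A)"
    show "\<exists>u\<in>A. \<forall>a\<in>C. ?P a u"
    proof (cases "C = {}")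
      case True
      then show ?thesis using assms by (intro bexI[of _ F]) (auto simp: A_def)
    next
      case False
      have CA: "C \<subseteq> A" and tot: "\<And>a b. a \<in> C \<Longrightarrow> b \<in> C \<Longrightarrow> a \<le> b \<or> b \<le> a"
        using C by (auto simp: Chains_def relation_of_def)
      have "eventually P (Inf C) \<longleftrightarrow> (\<exists>b\<in>C. eventually P b)" for P
      proof (rule eventually_Inf_base[OF False])
        fix a b assume "a \<in> C" "b \<in> C"
        then show "\<exists>x\<in>C. x \<le> inf a b" using tot[of a b] by (metis inf.absorb1 inf.absorb2 order_refl)
      qed
      then have "\<not> eventually (\<lambda>_. False) (Inf C)"
        using CA by (auto simp: A_def trivial_limit_def)
      then have "Inf C \<noteq> bot" by (simp add: trivial_limit_def)
      moreover have "Inf C \<le> F" using False CA by (auto simp: A_def intro: Inf_lower2)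
      ultimately show ?thesis by (intro bexI[of _ "Inf C"]) (auto simp: A_def intro: Inf_lower)
    qed
  qed
  then obtain U where U: "U \<le> F" "U \<noteq> bot" and max: "\<And>W. W \<le> F \<Longrightarrow> W \<noteq> bot \<Longrightarrow> W \<le> U \<Longrightarrow> W = U"
    by (auto simp: A_def)
  have "eventually P U \<or> eventually (\<lambda>x. \<not> P x) U" for P
  proof (cases "inf U (principal {x. P x}) = bot")
    case True
    then have "eventually (\<lambda>x. \<not> P x) U"
      by (simp add: trivial_limit_def eventually_inf_principal)
    then show ?thesis ..
  next
    case False
    then have "inf U (principal {x. P x}) = U" using U by (intro max) (auto intro: le_infI1)
    moreover have "eventually P (inf U (principal {x. P x}))" by (simp add: eventually_inf_principal)
    ultimately have "eventually P U" by simp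
    then show ?thesis ..
  qed
  with U show ?thesis by (auto simp: ultra_def)
qed

text \<open>The image filter has a cluster point in the compact interval, and for an ultrafilter a
  cluster point is a limit.\<close>

lemma ultra_bounded_tendsto:
  fixes r :: "'a \<Rightarrow> real"
  assumes "ultra U" "\<And>n. \<bar>r n\<bar> \<le> C"
  shows "\<exists>l. (r \<longlongrightarrow> l) U"
proof -
  let ?F = "filtermap r U"
  have nb: "?F \<noteq> bot" using assms(1) by (simp add: ultra_def filtermap_bot_iff)
  have ev: "eventually (\<lambda>x. x \<in> {- C..C}) ?F"
    unfolding eventually_filtermap using assms(2) by (intro always_eventually) (auto simp: abs_le_iff minus_le_iff)
  obtain l where l: "inf (nhds l) ?F \<noteq> bot"
    using compact_Icc[of "- C" C, unfolded compact_filter, rule_format, OF nb ev] by auto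
  have "(r \<longlongrightarrow> l) U"
  proof (rule topological_tendstoI)
    fix S assume S: "open S" "l \<in> S"
    show "eventually (\<lambda>n. r n \<in> S) U"
    proof (rule ccontr)
      assume "\<not> ?thesis"
      then have "eventually (\<lambda>n. r n \<notin> S) U" using assms(1) by (auto simp: ultra_def)
      then have "eventually (\<lambda>y. y \<notin> S) ?F" by (simp add: eventually_filtermap)
      moreover have "eventually (\<lambda>y. y \<in> S) (nhds l)" using S by (auto simp: eventually_nhds)
      ultimately have "eventually (\<lambda>y. False) (inf (nhds l) ?F)"
        unfolding eventually_inf by blast
      then show False using l by (simp add: trivial_limit_def)
    qed
  qed
  then show ?thesis ..
qed

text \<open>The supremum need not be attained, but an element above half of it is available as soon
  as it is positive. This provides near-extremal test pairs in \<open>prime_small\<close>.\<close>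

lemma near_maximum:
  fixes S :: "real set"
  assumes "S \<noteq> {}" "\<And>s. s \<in> S \<Longrightarrow> 0 \<le> s" "\<And>s. s \<in> S \<Longrightarrow> s \<le> B"
  shows "\<exists>s\<in>S. \<forall>t\<in>S. t \<le> 2 * s"
proof -
  have bdd: "bdd_above S" using assms(3) by (auto simp: bdd_above_def)
  show ?thesis
  proof (cases "Sup S > 0")
    case True
    then obtain s where "s \<in> S" "Sup S / 2 < s"
      using less_cSupE[of "Sup S / 2" S] assms(1) by auto
    then show ?thesis using cSup_upper[OF _ bdd] by (intro bexI[of _ s]) force+
  next
    case False
    then show ?thesis using cSup_upper[OF _ bdd] assms(1,2) by force
  qed
qed

section \<open>Bounded sequences and their inner product in the ultralimit\<close>

locale gaussian_ultra = gaussian_family M G for M :: "'a measure" and G +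
  fixes U :: "nat filter" and V :: "nat \<Rightarrow> nat set"
  assumes ultra: "ultra U" and U_le: "U \<le> sequentially" and fin_V [simp]: "\<And>n. finite (V n)"
begin

lemma U_nb [simp]: "U \<noteq> bot" using ultra by (simp add: ultra_def)

definition bd :: "nat \<Rightarrow> (nat \<Rightarrow> (nat \<Rightarrow> real) \<Rightarrow> real) \<Rightarrow> bool" where
  "bd m X \<longleftrightarrow> (\<forall>n. polyf (V n) m (X n)) \<and> (\<exists>C. \<forall>n. nrm (X n) \<le> C)"

definition bdch :: "nat \<Rightarrow> (nat \<Rightarrow> (nat \<Rightarrow> real) \<Rightarrow> real) \<Rightarrow> bool" where
  "bdch m X \<longleftrightarrow> (\<forall>n. chaos (V n) m (X n)) \<and> (\<exists>C. \<forall>n. nrm (X n) \<le> C)"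

text \<open>A positive semi-definite form on bounded sequences, for which the limit exists. Null
  sequences are not divided out; \<open>ip_null\<close> takes the place of a quotient.\<close>

definition ip :: "(nat \<Rightarrow> (nat \<Rightarrow> real) \<Rightarrow> real) \<Rightarrow> (nat \<Rightarrow> (nat \<Rightarrow> real) \<Rightarrow> real) \<Rightarrow> real" where
  "ip X Z = Lim U (\<lambda>n. E (\<lambda>x. X n x * Z n x))"

abbreviation dist_sq where
  "dist_sq X Z \<equiv> ip (\<lambda>n x. X n x - Z n x) (\<lambda>n x. X n x - Z n x)"

lemma bd_sm: "bd m X \<Longrightarrow> sm (X n)"
  using wpoly_sm[OF _ fin_V, of "\<lambda>_. Suc 0" n m "X n"] by (simp add: bd_def)

lemma bd_bound: assumes "bd m X" obtains C where "0 \<le> C" "\<And>n. nrm (X n) \<le> C"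
proof -
  obtain C where C: "\<forall>n. nrm (X n) \<le> C" using assms by (auto simp: bd_def)
  then have "0 \<le> C" using nrm_nonneg[of "X 0"] by (metis order_trans)
  then show ?thesis using C by (intro that) auto
qed

lemma bdch_bd: assumes "bdch m X" shows "bd m X"
proof -
  have "polyf (V n) m (X n)" for n using assms unfolding bdch_def by (intro chaos_polyf) simp
  then show ?thesis using assms unfolding bdch_def bd_def by simp
qed

lemma bd_mono: assumes "bd m X" "m \<le> k" shows "bd k X"
proof -
  have "polyf (V n) k (X n)" for n
    by (rule wpoly_mono[OF _ assms(2)]) (use assms(1) in \<open>simp add: bd_def\<close>)
  then show ?thesis using assms(1) unfolding bd_def by simp
qed

lemma bd_const: "bd m (\<lambda>n x. c)"
  unfolding bd_def by (simp add: wpoly_const) (rule exI, rule order_refl)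

lemma bd_add: assumes "bd m X" "bd m Z" shows "bd m (\<lambda>n x. X n x + Z n x)"
proof -
  obtain C D where "\<And>n. nrm (X n) \<le> C" "\<And>n. nrm (Z n) \<le> D" using assms bd_bound by metis
  then have "nrm (\<lambda>x. X n x + Z n x) \<le> C + D" for n
    using nrm_add[OF bd_sm[OF assms(1)] bd_sm[OF assms(2)], of n n] by (meson add_mono order_trans)
  then show ?thesis using assms by (auto simp: bd_def intro: wpoly_add)
qed

lemma bd_cmult: assumes "bd m X" shows "bd m (\<lambda>n x. c * X n x)"
proof -
  obtain C where C: "\<And>n. nrm (X n) \<le> C" using assms bd_bound by metis
  have "nrm (\<lambda>x. c * X n x) \<le> \<bar>c\<bar> * C" for n
    unfolding nrm_cmult using C by (intro mult_left_mono) auto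
  then show ?thesis using assms by (auto simp: bd_def intro: wpoly_cmult)
qed

lemma bd_diff: "bd m X \<Longrightarrow> bd m Z \<Longrightarrow> bd m (\<lambda>n x. X n x - Z n x)"
  using bd_add[of m X "\<lambda>n x. (- 1) * Z n x"] bd_cmult[of m Z "-1"] by simp

lemma bd_sum: "(\<And>i. i \<in> A \<Longrightarrow> bd m (X i)) \<Longrightarrow> bd m (\<lambda>n x. \<Sum>i\<in>A. X i n x)"
proof (induction A rule: infinite_finite_induct)
  case (insert a A)
  have "bd m (\<lambda>n x. X a n x + (\<Sum>i\<in>A. X i n x))" using insert by (intro bd_add) auto
  then show ?case using insert by simp
qed (simp_all add: bd_const)

lemma bd_mult: assumes "bd m X" "bd k Z" shows "bd (m + k) (\<lambda>n x. X n x * Z n x)"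
proof -
  obtain C D where C: "0 \<le> C" "\<And>n. nrm (X n) \<le> C" and D: "0 \<le> D" "\<And>n. nrm (Z n) \<le> D"
    using assms bd_bound by metis
  have "nrm (\<lambda>x. X n x * Z n x) \<le> sqrt (prod_const (m + k)) * (C * D)" for n
  proof (rule order_trans[OF nrm_prod_le[of "V n" m "X n" k "Z n"]])
    show "sqrt (prod_const (m + k)) * (nrm (X n) * nrm (Z n)) \<le> sqrt (prod_const (m + k)) * (C * D)"
      using C D prod_const_pos[of "m + k"] by (intro mult_left_mono mult_mono) auto
  qed (use assms in \<open>auto simp: bd_def\<close>)
  then show ?thesis using assms by (auto simp: bd_def intro: wpoly_mult)
qed

lemma ip_tendsto:
  assumes "bd m X" "bd k Z"
  shows "((\<lambda>n. E (\<lambda>x. X n x * Z n x)) \<longlongrightarrow> ip X Z) U"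
proof -
  obtain C D where C: "0 \<le> C" "\<And>n. nrm (X n) \<le> C" and D: "0 \<le> D" "\<And>n. nrm (Z n) \<le> D"
    using assms bd_bound by metis
  have "\<bar>E (\<lambda>x. X n x * Z n x)\<bar> \<le> C * D" for n
    by (rule order_trans[OF E_Cauchy_Schwarz[OF bd_sm[OF assms(1)] bd_sm[OF assms(2)]]]) (use C D in \<open>auto intro: mult_mono\<close>)
  then obtain l where l: "((\<lambda>n. E (\<lambda>x. X n x * Z n x)) \<longlongrightarrow> l) U"
    using ultra_bounded_tendsto[OF ultra, of "\<lambda>n. E (\<lambda>x. X n x * Z n x)"] by blast
  then show ?thesis unfolding ip_def using tendsto_Lim[OF U_nb l] by simp
qed

lemma ip_eqI: "((\<lambda>n. E (\<lambda>x. X n x * Z n x)) \<longlongrightarrow> l) U \<Longrightarrow> ip X Z = l"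
  unfolding ip_def by (rule tendsto_Lim[OF U_nb])

lemma ip_commute: "ip X Z = ip Z X"
  unfolding ip_def by (subst mult.commute) (rule refl)

lemma ip_diff_right:
  assumes "bd m X" "bd k Z" "bd l W"
  shows "ip X (\<lambda>n x. Z n x - W n x) = ip X Z - ip X W"
proof (rule ip_eqI)
  have [simp]: "sm (X n)" "sm (Z n)" "sm (W n)" for n using assms bd_sm by blast+
  show "((\<lambda>n. E (\<lambda>x. X n x * (Z n x - W n x))) \<longlongrightarrow> ip X Z - ip X W) U"
    using tendsto_diff[OF ip_tendsto[OF assms(1,2)] ip_tendsto[OF assms(1,3)]]
    by (simp add: right_diff_distrib)
qed

lemma ip_cmult_right:
  assumes "bd m X" "bd k Z" shows "ip X (\<lambda>n x. c * Z n x) = c * ip X Z"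
proof (rule ip_eqI)
  have "(\<lambda>n. E (\<lambda>x. X n x * (c * Z n x))) = (\<lambda>n. c * E (\<lambda>x. X n x * Z n x))"
    unfolding mult.left_commute[of _ c] by simp
  then show "((\<lambda>n. E (\<lambda>x. X n x * (c * Z n x))) \<longlongrightarrow> c * ip X Z) U"
    using tendsto_mult_left[OF ip_tendsto[OF assms], of c] by simp
qed

lemma ip_sum_right:
  assumes "bd m X" "\<And>i. i \<in> A \<Longrightarrow> bd k (Z i)"
  shows "ip X (\<lambda>n x. \<Sum>i\<in>A. Z i n x) = (\<Sum>i\<in>A. ip X (Z i))"
proof (rule ip_eqI)
  have [simp]: "sm (X n)" "i \<in> A \<Longrightarrow> sm (Z i n)" for n i using assms bd_sm by blast+
  have "((\<lambda>n. \<Sum>i\<in>A. E (\<lambda>x. X n x * Z i n x)) \<longlongrightarrow> (\<Sum>i\<in>A. ip X (Z i))) U"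
    by (intro tendsto_sum ip_tendsto[OF assms(1) assms(2)])
  then show "((\<lambda>n. E (\<lambda>x. X n x * (\<Sum>i\<in>A. Z i n x))) \<longlongrightarrow> (\<Sum>i\<in>A. ip X (Z i))) U"
    by (simp add: sum_distrib_left)
qed

lemma ip_nonneg: assumes "bd m X" shows "0 \<le> ip X X"
  by (rule tendsto_lowerbound[OF ip_tendsto[OF assms assms]]) (auto intro!: always_eventually E_nonneg)

lemma nrm_tendsto: assumes "bd m X" shows "((\<lambda>n. nrm (X n)) \<longlongrightarrow> sqrt (ip X X)) U"
  unfolding nrm_def power2_eq_square by (intro tendsto_real_sqrt ip_tendsto[OF assms assms])

lemma ip_Cauchy_Schwarz: assumes "bd m X" "bd k Z" shows "(ip X Z)\<^sup>2 \<le> ip X X * ip Z Z"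
proof (rule tendsto_le[OF U_nb])
  show "((\<lambda>n. (E (\<lambda>x. X n x * Z n x))\<^sup>2) \<longlongrightarrow> (ip X Z)\<^sup>2) U"
    by (intro tendsto_power ip_tendsto[OF assms])
  show "((\<lambda>n. E (\<lambda>x. X n x * X n x) * E (\<lambda>x. Z n x * Z n x)) \<longlongrightarrow> ip X X * ip Z Z) U"
    by (intro tendsto_mult ip_tendsto[OF assms(1,1)] ip_tendsto[OF assms(2,2)])
  have "(E (\<lambda>x. X n x * Z n x))\<^sup>2 \<le> (nrm (X n) * nrm (Z n))\<^sup>2" for n
    using E_Cauchy_Schwarz[OF bd_sm[OF assms(1)] bd_sm[OF assms(2)]] by (intro abs_le_square_iff[THEN iffD1]) auto
  moreover have "(nrm f)\<^sup>2 = E (\<lambda>x. f x * f x)" for f unfolding nrm_sq by (simp only: power2_eq_square)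
  ultimately show "\<forall>\<^sub>F n in U. (E (\<lambda>x. X n x * Z n x))\<^sup>2 \<le> E (\<lambda>x. X n x * X n x) * E (\<lambda>x. Z n x * Z n x)"
    by (intro always_eventually) (simp add: power_mult_distrib)
qed

lemma ip_null: "bd m X \<Longrightarrow> bd k Z \<Longrightarrow> ip X X = 0 \<Longrightarrow> ip X Z = 0"
  using ip_Cauchy_Schwarz[of m X k Z] by simp

lemma ip_diff_diff:
  assumes "bd m X" "bd k Z"
  shows "dist_sq X Z = ip X X - 2 * ip X Z + ip Z Z"
proof -
  have 1: "bd (m + k) X" "bd (m + k) Z" using assms bd_mono by auto
  note d = bd_diff[OF 1]
  show ?thesis
    by (simp add: ip_diff_right[OF d 1] ip_commute[of "\<lambda>n x. X n x - Z n x"] ip_diff_right[OF 1(1) 1] ip_diff_right[OF 1(2) 1])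
      (simp add: ip_commute)
qed

lemma ip_sq_triangle:
  assumes "bd m X" "bd m Z"
  shows "ip (\<lambda>n x. X n x + Z n x) (\<lambda>n x. X n x + Z n x) \<le> 2 * ip X X + 2 * ip Z Z"
proof -
  have "0 \<le> dist_sq X Z" by (rule ip_nonneg[OF bd_diff[OF assms]])
  moreover have "ip (\<lambda>n x. X n x + Z n x) (\<lambda>n x. X n x + Z n x) = ip X X + 2 * ip X Z + ip Z Z"
    using ip_diff_diff[OF assms(1) bd_cmult[OF assms(2), of "-1"]] ip_cmult_right[OF assms(1,2), of "-1"]
      ip_cmult_right[OF bd_cmult[OF assms(2), of "-1"] assms(2), of "-1"] ip_cmult_right[OF assms(2,2), of "-1"]
      ip_commute[of "\<lambda>n x. - Z n x" Z]
    by simp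
  ultimately show ?thesis using ip_diff_diff[OF assms] by simp
qed

section \<open>Primes and approximation by polynomials in primes\<close>

definition prime :: "nat \<Rightarrow> (nat \<Rightarrow> (nat \<Rightarrow> real) \<Rightarrow> real) \<Rightarrow> bool" where
  "prime k Y \<longleftrightarrow> 1 \<le> k \<and> bdch k Y \<and>
     (\<forall>i X Z. 1 \<le> i \<longrightarrow> i < k \<longrightarrow> bdch i X \<longrightarrow> bdch (k - i) Z \<longrightarrow> ip Y (\<lambda>n x. X n x * Z n x) = 0)"

lemma prime_bd: "prime k Y \<Longrightarrow> bd k Y"
  by (auto simp: prime_def bdch_bd)

text \<open>The counterpart of \<open>wpoly\<close> with primes as variables and their orders as
  weights. The primes may be correlated here; \<open>qp_representation\<close> makes them
  orthogonal.\<close>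

inductive qp :: "nat \<Rightarrow> (nat \<Rightarrow> (nat \<Rightarrow> real) \<Rightarrow> real) \<Rightarrow> bool" where
  qp_const: "qp m (\<lambda>n x. c)"
| qp_add: "qp m X \<Longrightarrow> qp m Z \<Longrightarrow> qp m (\<lambda>n x. X n x + Z n x)"
| qp_prime_mult: "prime k Y \<Longrightarrow> qp m X \<Longrightarrow> m + k \<le> m' \<Longrightarrow> qp m' (\<lambda>n x. Y n x * X n x)"

lemma qp_bd: "qp m X \<Longrightarrow> bd m X"
proof (induction rule: qp.induct)
  case (qp_prime_mult k Y m X m')
  have "bd (k + m) (\<lambda>n x. Y n x * X n x)" using qp_prime_mult by (intro bd_mult) (auto intro: prime_bd)
  then show ?case by (rule bd_mono) (use qp_prime_mult(3) in simp)
next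
  case (qp_add m X Z)
  then show ?case by (intro bd_add)
qed (rule bd_const)

lemma qp_mono: "qp m X \<Longrightarrow> m \<le> k \<Longrightarrow> qp k X"
proof (induction arbitrary: k rule: qp.induct)
  case (qp_prime_mult l Y m X m')
  show ?case by (rule qp.qp_prime_mult[OF qp_prime_mult(1,2)]) (use qp_prime_mult(3,5) in linarith)
next
  case (qp_add m X Z)
  show ?case by (rule qp.qp_add[OF qp_add(3,4)[OF qp_add(5)]])
qed (rule qp_const)

lemma qp_cmult: "qp m X \<Longrightarrow> qp m (\<lambda>n x. c * X n x)"
proof (induction rule: qp.induct)
  case (qp_prime_mult k Y m X m')
  then show ?case
    using qp.qp_prime_mult[of k Y m "\<lambda>n x. c * X n x" m'] by (simp add: mult.left_commute)
next
  case (qp_add m X Z)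
  show ?case unfolding distrib_left by (rule qp.qp_add[OF qp_add(3,4)])
qed (rule qp_const)

lemma qp_mult: "qp m X \<Longrightarrow> qp k Z \<Longrightarrow> qp (m + k) (\<lambda>n x. X n x * Z n x)"
proof (induction rule: qp.induct)
  case (qp_const m c)
  show ?case by (rule qp_mono[OF qp_cmult[OF qp_const]]) simp
next
  case (qp_add m X W)
  show ?case unfolding distrib_right by (rule qp.qp_add[OF qp_add(3,4)[OF qp_add(5)]])
next
  case (qp_prime_mult l Y m X m')
  then show ?case
    using qp.qp_prime_mult[of l Y "m + k" "\<lambda>n x. X n x * Z n x" "m' + k"] by (simp add: mult.assoc)
qed

lemma qp_prime: "prime k Y \<Longrightarrow> qp k Y"
  using qp_prime_mult[of k Y 0 "\<lambda>n x. 1" k] qp_const[of 0 1] unfolding mult_1_right by (simp only: add_0 order_refl)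

text \<open>Completeness of the space of sequences, as in the countable saturation of an
  ultraproduct. At stage n the diagonal sequence uses the largest j \<le> n for which the required
  estimates among the first members, up to index j, hold at that stage. Every fixed j qualifies for
  \<open>U\<close>-almost all n, and j \<le> n holds eventually along \<open>U\<close>.\<close>

lemma saturation:
  assumes bdQ: "\<And>j. bd m (Q j)"
    and cauchy: "\<And>i j. i \<le> j \<Longrightarrow> dist_sq (Q i) (Q j) < 1 / (real i + 1)"
  shows "\<exists>R. bd m R \<and> (\<forall>i. dist_sq R (Q i) \<le> 1 / (real i + 1))"
proof -
  define dd where "dd i j n = E (\<lambda>x. (Q i n x - Q j n x) * (Q i n x - Q j n x))" for i j n
  define good where "good j n \<longleftrightarrow> (\<forall>i i'. i \<le> i' \<longrightarrow> i' \<le> j \<longrightarrow> dd i i' n < 1 / (real i + 1))" for j n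
  define J where "J n = Max {j. j \<le> n \<and> good j n}" for n
  define R where "R n = Q (J n) n" for n
  \<comment> \<open>The index 0 always qualifies, so the maximum exists; it also keeps
    \<open>R n\<close> within distance 1 of \<open>Q 0 n\<close> at every n, hence bounded.\<close>
  have g0: "good 0 n" for n by (auto simp: good_def dd_def)
  have fin: "finite {j. j \<le> n \<and> good j n}" for n by simp
  have ne: "{j. j \<le> n \<and> good j n} \<noteq> {}" for n using g0[of n] by auto
  have gJ: "good (J n) n" for n using Max_in[OF fin ne] by (auto simp: J_def)
  have Jge: "j \<le> J n" if "j \<le> n" "good j n" for j n
    unfolding J_def using that fin by (intro Max_ge) auto
  have close: "dd i (J n) n < 1 / (real i + 1)" if "i \<le> n" "good i n" for i n
    using gJ[of n] Jge[OF that] by (auto simp: good_def)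
  have ev_good: "eventually (good j) U" for j
  proof -
    have "eventually (\<lambda>n. dd i i' n < 1 / (real i + 1)) U" if "i \<le> i'" for i i'
      using order_tendstoD(2)[OF ip_tendsto[OF bd_diff[OF bdQ[of i] bdQ[of i']] bd_diff[OF bdQ[of i] bdQ[of i']]] cauchy[OF that]]
      unfolding dd_def .
    then have "eventually (\<lambda>n. \<forall>i'\<in>{..j}. \<forall>i\<in>{..i'}. dd i i' n < 1 / (real i + 1)) U"
      by (auto intro!: eventually_ball_finite)
    then show ?thesis by (rule eventually_mono) (auto simp: good_def)
  qed
  have ev_ge: "eventually (\<lambda>n. j \<le> n) U" for j
    using U_le eventually_ge_at_top[of j] by (rule filter_leD)
  have [simp]: "sm (Q j n)" for j n using bdQ bd_sm by blast
  obtain C where C: "0 \<le> C" "\<And>n. nrm (Q 0 n) \<le> C" using bdQ bd_bound by metis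
  have "nrm (R n) \<le> C + 1" for n
  proof -
    have "nrm (\<lambda>x. Q 0 n x - Q (J n) n x) \<le> 1"
      unfolding nrm_def power2_eq_square
      using close[OF _ g0, of n] by (simp add: dd_def)
    moreover have "nrm (R n) \<le> nrm (Q 0 n) + nrm (\<lambda>x. Q 0 n x - Q (J n) n x)"
      using nrm_diff[of "Q 0 n" "\<lambda>x. Q 0 n x - Q (J n) n x"] by (simp add: R_def)
    ultimately show ?thesis using C(2)[of n] by simp
  qed
  then have bR: "bd m R" using bdQ by (auto simp: bd_def R_def)
  have "dist_sq R (Q i) \<le> 1 / (real i + 1)" for i
  proof (rule tendsto_upperbound[OF ip_tendsto[OF bd_diff[OF bR bdQ] bd_diff[OF bR bdQ]] _ U_nb])
    show "\<forall>\<^sub>F n in U. E (\<lambda>x. (R n x - Q i n x) * (R n x - Q i n x)) \<le> 1 / (real i + 1)"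
      using ev_good[of i] ev_ge[of i]
    proof eventually_elim
      case (elim n)
      have "(\<lambda>x. (R n x - Q i n x) * (R n x - Q i n x)) = (\<lambda>x. (Q i n x - Q (J n) n x) * (Q i n x - Q (J n) n x))"
        by (simp add: R_def fun_eq_iff algebra_simps)
      then show ?case using close[OF elim(2,1)] by (simp add: dd_def)
    qed
  qed
  with bR show ?thesis by blast
qed

text \<open>The Hilbert projection of a bounded sequence onto the closure of the products of primes; the
  projection error is again represented by a sequence thanks to saturation.\<close>

lemma qp_projection:
  assumes X: "bd m X"
  shows "\<exists>R Q. bd m R \<and> (\<forall>T. qp m T \<longrightarrow> ip R T = 0) \<and>
    (\<forall>j::nat. qp m (Q j) \<and> ip (\<lambda>n x. (X n x - Q j n x) - R n x) (\<lambda>n x. (X n x - Q j n x) - R n x) \<le> 1 / (real j + 1))"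
proof -
  define S where "S = {dist_sq X Q |Q. qp m Q}"
  define \<delta> where "\<delta> = Inf S"
  have S0: "s \<ge> 0" if "s \<in> S" for s using that ip_nonneg[OF bd_diff[OF X qp_bd]] by (auto simp: S_def)
  have bdd: "bdd_below S" using S0 by (auto simp: bdd_below_def)
  have Sne: "S \<noteq> {}" using qp_const by (auto simp: S_def)
  have lower: "\<delta> \<le> dist_sq X Q" if "qp m Q" for Q
    unfolding \<delta>_def by (rule cInf_lower[OF _ bdd]) (use that in \<open>auto simp: S_def\<close>)
  \<comment> \<open>Chosen for the parallelogram estimate below, which needs 4 a i < 1 / (i +
    1).\<close>
  define a where "a j = 1 / (8 * (real j + 1))" for j :: nat
  have "\<exists>Q. qp m Q \<and> dist_sq X Q < \<delta> + a j" for j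
  proof -
    have "Inf S < \<delta> + a j" by (simp add: \<delta>_def a_def)
    then obtain s where "s \<in> S" "s < \<delta> + a j" using cInf_lessD[OF Sne] by blast
    then show ?thesis by (auto simp: S_def)
  qed
  then have "\<forall>j. \<exists>Q. qp m Q \<and> dist_sq X Q < \<delta> + a j" by (rule allI)
  from choice[OF this] obtain Q where Q': "\<forall>j. qp m (Q j) \<and> dist_sq X (Q j) < \<delta> + a j" ..
  have Q: "qp m (Q j)"
    and Qd: "dist_sq X (Q j) < \<delta> + a j" for j
    using Q'[rule_format, of j] by auto
  have bQ: "bd m (Q j)" for j using Q qp_bd by blast
  define W where "W j = (\<lambda>n x. X n x - Q j n x)" for j
  have bW: "bd m (W j)" for j unfolding W_def by (rule bd_diff[OF X bQ])
  have Wd: "ip (W j) (W j) < \<delta> + a j" for j using Qd unfolding W_def .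
  have cauchy: "dist_sq (W i) (W j) < 1 / (real i + 1)" if "i \<le> j" for i j
  proof -
    \<comment> \<open>The midpoint of two near-minimisers is again a competitor, so the
      parallelogram law forces them to be close to each other.\<close>
    have q: "qp m (\<lambda>n x. (1/2) * Q i n x + (1/2) * Q j n x)" by (intro qp_add qp_cmult Q)
    have eq: "(\<lambda>n x. X n x - ((1/2) * Q i n x + (1/2) * Q j n x)) = (\<lambda>n x. (1/2) * W i n x - (-(1/2)) * W j n x)"
      by (simp add: W_def fun_eq_iff field_simps)
    note h = bd_cmult[OF bW[of i], of "1/2"] bd_cmult[OF bW[of j], of "-(1/2)"]
    have "\<delta> \<le> ip (\<lambda>n x. (1/2) * W i n x) (\<lambda>n x. (1/2) * W i n x)
        - 2 * ip (\<lambda>n x. (1/2) * W i n x) (\<lambda>n x. (-(1/2)) * W j n x)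
        + ip (\<lambda>n x. (-(1/2)) * W j n x) (\<lambda>n x. (-(1/2)) * W j n x)"
      using lower[OF q] unfolding eq ip_diff_diff[OF h] .
    then have "4 * \<delta> \<le> ip (W i) (W i) + 2 * ip (W i) (W j) + ip (W j) (W j)"
      unfolding ip_cmult_right[OF h(1) bW] ip_cmult_right[OF h(2) bW]
        ip_commute[of "\<lambda>n x. (1/2) * W i n x"] ip_commute[of "\<lambda>n x. (-(1/2)) * W j n x"]
        ip_cmult_right[OF bW bW]
      by (simp add: field_simps ip_commute[of "W j" "W i"])
    moreover have "a j \<le> a i" using that by (auto simp: a_def intro!: divide_left_mono)
    moreover have "4 * a i < 1 / (real i + 1)" by (simp add: a_def field_simps)
    ultimately show ?thesis unfolding ip_diff_diff[OF bW bW]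
      using Wd[of i] Wd[of j] by linarith
  qed
  obtain R where bR: "bd m R" and R: "\<And>i. dist_sq R (W i) \<le> 1 / (real i + 1)"
  proof -
    have "\<exists>R. bd m R \<and> (\<forall>i. dist_sq R (W i) \<le> 1 / (real i + 1))"
      by (rule saturation) (fact bW, fact cauchy)
    then show ?thesis by (elim exE conjE) (rule that, auto)
  qed
  have "ip R T = 0" if T: "qp m T" for T
  proof -
    have bT: "bd m T" using T qp_bd by blast
    define \<tau> where "\<tau> = ip T T"
    have \<tau>: "0 \<le> \<tau>" unfolding \<tau>_def by (rule ip_nonneg[OF bT])
    have \<beta>: "(ip (W j) T)\<^sup>2 \<le> (\<tau> + 1) / (real j + 1)" for j
    proof -
      define b where "b = ip (W j) T"
      \<comment> \<open>The optimal step would be b / \<tau>; adding 1 keeps the denominator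
        positive.\<close>
      define t where "t = b / (\<tau> + 1)"
      have bt: "b = t * (\<tau> + 1)" using \<tau> by (simp add: t_def)
      have "qp m (\<lambda>n x. Q j n x + t * T n x)" by (intro qp_add qp_cmult Q T)
      from lower[OF this] have "\<delta> \<le> dist_sq (W j) (\<lambda>n x. t * T n x)"
        by (simp add: W_def algebra_simps)
      also have "\<dots> = ip (W j) (W j) - 2 * t * b + t\<^sup>2 * \<tau>"
        unfolding ip_diff_diff[OF bW bd_cmult[OF bT]] ip_cmult_right[OF bW bT] ip_cmult_right[OF bd_cmult[OF bT] bT]
          ip_commute[of "\<lambda>n x. t * T n x"] ip_cmult_right[OF bT bT]
        by (simp add: \<tau>_def b_def power2_eq_square)
      finally have "2 * t * b \<le> a j + t\<^sup>2 * \<tau>" using Wd[of j] by linarith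
      moreover have "t\<^sup>2 * \<tau> \<le> t * b"
      proof -
        have "t * b - t\<^sup>2 * \<tau> = t\<^sup>2" by (simp add: bt power2_eq_square algebra_simps)
        then show ?thesis using zero_le_power2[of t] by linarith
      qed
      ultimately have "t * b \<le> a j" by linarith
      then have "(t * b) * (\<tau> + 1) \<le> a j * (\<tau> + 1)" using \<tau> by (intro mult_right_mono) auto
      then have "b\<^sup>2 \<le> a j * (\<tau> + 1)" by (simp add: bt power2_eq_square mult_ac)
      also have "\<dots> \<le> (1 / (real j + 1)) * (\<tau> + 1)"
        using \<tau> by (intro mult_right_mono) (auto simp: a_def field_simps)
      finally show ?thesis by (simp add: b_def)
    qed
    have "(ip R T)\<^sup>2 \<le> 4 * (\<tau> + 1) / (real j + 1)" for j
    proof -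
      have "ip R T = ip (W j) T + ip (\<lambda>n x. R n x - W j n x) T"
        using ip_diff_right[OF bT bR bW, of j] by (simp add: ip_commute[of _ T])
      moreover have "(ip (\<lambda>n x. R n x - W j n x) T)\<^sup>2 \<le> (1 / (real j + 1)) * \<tau>"
        using ip_Cauchy_Schwarz[OF bd_diff[OF bR bW] bT, of j] mult_right_mono[OF R[of j] \<tau>] by (simp add: \<tau>_def)
      moreover have "(1 / (real j + 1)) * \<tau> \<le> (\<tau> + 1) / (real j + 1)" by (simp add: divide_right_mono)
      moreover have "(p + q)\<^sup>2 \<le> 2 * p\<^sup>2 + 2 * q\<^sup>2" for p q :: real
        using zero_le_power2[of "p - q"] by (simp add: power2_eq_square algebra_simps)
      ultimately show ?thesis using \<beta>[of j]
        by (smt (verit) mult_2 mult.commute add_divide_distrib times_divide_eq_right)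
    qed
    moreover have "(\<lambda>j. 4 * (\<tau> + 1) / (real j + 1)) \<longlonglongrightarrow> 0"
      by real_asymp
    ultimately have "(ip R T)\<^sup>2 \<le> 0"
      by (intro LIMSEQ_le_const) auto
    then show ?thesis by simp
  qed
  moreover have "ip (\<lambda>n x. (X n x - Q j n x) - R n x) (\<lambda>n x. (X n x - Q j n x) - R n x) \<le> 1 / (real j + 1)" for j
  proof -
    have "dist_sq (W j) R \<le> 1 / (real j + 1)"
      using R[of j] unfolding ip_diff_diff[OF bR bW] ip_diff_diff[OF bW bR] by (simp add: ip_commute[of R "W j"])
    then show ?thesis unfolding W_def .
  qed
  ultimately show ?thesis using bR Q by (intro exI[of _ R] exI[of _ Q]) auto
qed

definition approximable :: "nat \<Rightarrow> (nat \<Rightarrow> (nat \<Rightarrow> real) \<Rightarrow> real) \<Rightarrow> bool" where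
  "approximable m X \<longleftrightarrow> (\<forall>\<epsilon>>0. \<exists>Q. qp m Q \<and> dist_sq X Q < \<epsilon>)"

text \<open>Multiplication by the fixed bounded \<open>B\<close> is continuous in the limit norm,
  because the norm of a product of polynomials is controlled by the product of the norms. So
  orthogonality passes from polynomials in primes to their limits.\<close>

lemma perp_mult_closure:
  assumes "bd k R" "bd l B" "bd m A" "approximable m A"
    and perp: "\<And>P. qp m P \<Longrightarrow> ip R (\<lambda>n x. P n x * B n x) = 0"
  shows "ip R (\<lambda>n x. A n x * B n x) = 0"
proof -
  obtain C where C: "0 \<le> C" "\<And>n. nrm (B n) \<le> C" using assms(2) bd_bound by metis
  define K where "K = ip R R * (prod_const (m + l) * C\<^sup>2)"
  have K0: "0 \<le> K" unfolding K_def
    using ip_nonneg[OF assms(1)] prod_const_pos[of "m + l"] by (intro mult_nonneg_nonneg) auto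
  have "(ip R (\<lambda>n x. A n x * B n x))\<^sup>2 \<le> K * \<epsilon>" if \<epsilon>: "\<epsilon> > 0" for \<epsilon>
  proof -
    obtain P where P: "qp m P" "dist_sq A P < \<epsilon>"
      using assms(4) \<epsilon> by (auto simp: approximable_def)
    note bP = qp_bd[OF P(1)]
    note bAP = bd_diff[OF assms(3) bP]
    have eq: "ip R (\<lambda>n x. A n x * B n x) = ip R (\<lambda>n x. (A n x - P n x) * B n x)"
      using ip_diff_right[OF assms(1) bd_mult[OF assms(3,2)] bd_mult[OF bP assms(2)]] perp[OF P(1)]
      by (simp add: left_diff_distrib)
    have "(ip R (\<lambda>n x. A n x * B n x))\<^sup>2 \<le> ip R R * ip (\<lambda>n x. (A n x - P n x) * B n x) (\<lambda>n x. (A n x - P n x) * B n x)"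
      unfolding eq by (rule ip_Cauchy_Schwarz[OF assms(1) bd_mult[OF bAP assms(2)]])
    also have "\<dots> \<le> ip R R * (prod_const (m + l) * C\<^sup>2 * dist_sq A P)"
    proof (rule mult_left_mono[OF _ ip_nonneg[OF assms(1)]])
      show "ip (\<lambda>n x. (A n x - P n x) * B n x) (\<lambda>n x. (A n x - P n x) * B n x) \<le> prod_const (m + l) * C\<^sup>2 * dist_sq A P"
      proof (rule tendsto_le[OF U_nb])
        show "((\<lambda>n. prod_const (m + l) * C\<^sup>2 * E (\<lambda>x. (A n x - P n x) * (A n x - P n x))) \<longlongrightarrow>
            prod_const (m + l) * C\<^sup>2 * dist_sq A P) U"
          by (rule tendsto_mult_left, rule ip_tendsto[OF bAP bAP])
        show "((\<lambda>n. E (\<lambda>x. (A n x - P n x) * B n x * ((A n x - P n x) * B n x))) \<longlongrightarrow>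
            ip (\<lambda>n x. (A n x - P n x) * B n x) (\<lambda>n x. (A n x - P n x) * B n x)) U"
          by (rule ip_tendsto[OF bd_mult[OF bAP assms(2)] bd_mult[OF bAP assms(2)]])
        show "\<forall>\<^sub>F n in U. E (\<lambda>x. (A n x - P n x) * B n x * ((A n x - P n x) * B n x))
           \<le> prod_const (m + l) * C\<^sup>2 * E (\<lambda>x. (A n x - P n x) * (A n x - P n x))"
        proof (intro always_eventually allI)
          fix n
          have "E (\<lambda>x. ((A n x - P n x) * B n x)\<^sup>2) \<le> prod_const (m + l) * (E (\<lambda>x. (A n x - P n x)\<^sup>2) * E (\<lambda>x. (B n x)\<^sup>2))"
            using bAP assms(2) by (intro E_prod_sq_le[OF fin_V]) (auto simp: bd_def)
          also have "\<dots> \<le> prod_const (m + l) * (E (\<lambda>x. (A n x - P n x)\<^sup>2) * C\<^sup>2)"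
            unfolding nrm_sq[of "B n", symmetric]
            using prod_const_pos[of "m + l"] C by (intro mult_left_mono power_mono) (auto intro: E_nonneg)
          finally show "E (\<lambda>x. (A n x - P n x) * B n x * ((A n x - P n x) * B n x))
           \<le> prod_const (m + l) * C\<^sup>2 * E (\<lambda>x. (A n x - P n x) * (A n x - P n x))"
            by (simp add: power2_eq_square mult_ac)
        qed
      qed
    qed
    also have "\<dots> \<le> K * \<epsilon>"
      unfolding K_def mult.assoc
      using P(2) ip_nonneg[OF assms(1)] prod_const_pos[of "m + l"]
      by (intro mult_left_mono) auto
    finally show ?thesis .
  qed
  then have "(ip R (\<lambda>n x. A n x * B n x))\<^sup>2 \<le> 0 + e" if "e > 0" for e
    using that K0 by (cases "K = 0") (auto simp: dest!: spec[of _ "e / K"] meta_spec[of _ "e / K"])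
  then have "(ip R (\<lambda>n x. A n x * B n x))\<^sup>2 \<le> 0" by (rule field_le_epsilon)
  then show ?thesis by simp
qed

lemma perp_closure:
  assumes "bd k R" "bd m A" "approximable m A" "\<And>P. qp m P \<Longrightarrow> ip R P = 0"
  shows "ip R A = 0"
proof -
  have "ip R (\<lambda>n x. A n x * 1) = 0"
  proof (rule perp_mult_closure[OF assms(1) bd_const[of 0 1] assms(2,3)])
    fix P assume "qp m P"
    then show "ip R (\<lambda>n x. P n x * 1) = 0" unfolding mult_1_right by (rule assms(4))
  qed
  then show ?thesis by (simp only: mult_1_right)
qed

text \<open>The residual \<open>R\<close> of the projection is shown to be null. By induction its
  part \<open>L\<close> below the top order is a limit of polynomials in primes, hence orthogonal to
  \<open>R\<close>, hence null. Up to a null sequence \<open>R\<close> is thus its top component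
  \<open>T\<close>, and \<open>T\<close> is prime: products of bounded sequences of lower orders are
  limits of polynomials in primes of weight at most m, all orthogonal to \<open>R\<close>. But a
  prime is itself such a polynomial, so it is orthogonal to itself.\<close>

theorem bd_approximable: "bd m X \<Longrightarrow> approximable m X"
proof (induction m arbitrary: X rule: less_induct)
  case (less m)
  obtain R Q where bR: "bd m R" and perp: "\<And>T. qp m T \<Longrightarrow> ip R T = 0"
    and Q: "\<And>j::nat. qp m (Q j)"
    and RQ: "\<And>j::nat. ip (\<lambda>n x. (X n x - Q j n x) - R n x) (\<lambda>n x. (X n x - Q j n x) - R n x) \<le> 1 / (real j + 1)"
    using qp_projection[OF less.prems] by (elim exE conjE) (rule that, auto)
  have "\<exists>Z. (\<forall>l. chaos (V n) l (Z l)) \<and> R n = (\<lambda>x. \<Sum>l\<le>m. Z l x)" for n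
    using bR by (intro chaos_decomposition) (auto simp: bd_def)
  then have "\<forall>n. \<exists>Z. (\<forall>l. chaos (V n) l (Z l)) \<and> R n = (\<lambda>x. \<Sum>l\<le>m. Z l x)" by (rule allI)
  from choice[OF this] obtain Z where Z': "\<forall>n. (\<forall>l. chaos (V n) l (Z n l)) \<and> R n = (\<lambda>x. \<Sum>l\<le>m. Z n l x)" ..
  have Z: "chaos (V n) l (Z n l)" "R n = (\<lambda>x. \<Sum>l\<le>m. Z n l x)" for n l using Z'[rule_format, of n] by auto
  define T L where "T n = Z n m" and "L n = (\<lambda>x. R n x - T n x)" for n
  have [simp]: "sm (R n)" "sm (T n)" for n using bR bd_sm chaos_sm[OF Z(1) fin_V] unfolding T_def by blast+
  obtain C where C: "\<And>n. nrm (R n) \<le> C" using bR bd_bound by metis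
  have "nrm (T n) \<le> nrm (R n)" for n
    unfolding nrm_def T_def chaos_parseval(2)[OF fin_V Z]
    by (intro real_sqrt_le_mono member_le_sum) (auto intro: E_nonneg)
  then have bT: "bdch m T" using Z C unfolding bdch_def T_def by (meson order_trans)
  note bTb = bdch_bd[OF bT]
  have bLm: "bd m L" unfolding L_def by (rule bd_diff[OF bR bTb])
  have L0: "ip L L = 0"
  proof (cases m)
    case 0
    then have "L = (\<lambda>n x. 0)" using Z(2) by (simp add: L_def T_def fun_eq_iff)
    then show ?thesis by (intro ip_eqI) simp
  next
    case (Suc m')
    have Leq: "L n = (\<lambda>x. \<Sum>l\<le>m'. Z n l x)" for n
      using Z(2)[of n] Suc by (simp add: L_def T_def fun_eq_iff)
    have pL: "polyf (V n) m' (L n)" for n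
      unfolding Leq by (intro wpoly_sum) (auto intro: wpoly_mono[OF chaos_polyf[OF Z(1)]])
    then have bL: "bd m' L" using bLm by (auto simp: bd_def)
    have "ip R L = 0"
      using Suc less.IH[of m' L] bL qp_mono by (intro perp_closure[OF bR bL] perp) auto
    moreover have "E (\<lambda>x. R n x * L n x) = E (\<lambda>x. L n x * L n x)" for n
    proof -
      have [simp]: "sm (L n)" using bL bd_sm by blast
      have "E (\<lambda>x. T n x * L n x) = 0"
        unfolding T_def by (rule chaos_orth_polyf[OF Z(1) pL]) (auto simp: Suc)
      moreover have "(\<lambda>x. R n x * L n x) = (\<lambda>x. L n x * L n x + T n x * L n x)"
        by (simp add: L_def fun_eq_iff algebra_simps)
      ultimately show ?thesis by simp
    qed
    ultimately show ?thesis by (simp add: ip_def)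
  qed
  have RT: "ip R W = ip T W" if "bd k W" for W k
    using ip_diff_right[OF that bR bTb] ip_null[OF bLm that L0] unfolding L_def[abs_def] ip_commute[of _ W] by simp
  \<comment> \<open>Primes have order at least 1, so m = 0 is treated directly: \<open>R\<close> is
    then a sequence of constants orthogonal to 1.\<close>
  have "qp m T \<or> (m = 0 \<and> ip R R = 0)"
  proof (cases m)
    case 0
    have "\<exists>c. R n = (\<lambda>x. c)" for n using bR 0 polyf_0 by (auto simp: bd_def)
    then obtain c where c: "R = (\<lambda>n x. c n)" by metis
    have "ip R (\<lambda>n x. 1) = 0" using perp[OF qp_const] .
    then have "(c \<longlongrightarrow> 0) U" using ip_tendsto[OF bR bd_const[of 0 1]] by (simp add: c)
    then have "((\<lambda>n. c n * c n) \<longlongrightarrow> 0 * 0) U" by (intro tendsto_mult)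
    then have "ip R R = 0" by (intro ip_eqI) (simp add: c)
    then show ?thesis using 0 by simp
  next
    case (Suc m')
    have "prime m T" unfolding prime_def
    proof (intro conjI allI impI)
      show "1 \<le> m" using Suc by simp
      fix i A B assume i: "1 \<le> i" "i < m" and A: "bdch i A" and B: "bdch (m - i) B"
      note bA = bdch_bd[OF A] and bB = bdch_bd[OF B]
      \<comment> \<open>Two separate passages to the limit: \<open>B\<close> is approximated while
        the polynomial \<open>P\<close> is kept fixed, and afterwards \<open>A\<close> is
        approximated by such \<open>P\<close>.\<close>
      have 1: "ip R (\<lambda>n x. P n x * B n x) = 0" if P: "qp i P" for P
      proof -
        have "ip R (\<lambda>n x. B n x * P n x) = 0"
        proof (rule perp_mult_closure[OF bR qp_bd[OF P] bB])
          show "approximable (m - i) B" using i bB by (intro less.IH) auto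
          show "ip R (\<lambda>n x. P' n x * P n x) = 0" if "qp (m - i) P'" for P'
            using perp[OF qp_mono[OF qp_mult[OF that P]]] i by simp
        qed
        then show ?thesis by (simp add: mult.commute)
      qed
      have "ip R (\<lambda>n x. A n x * B n x) = 0"
        using i bA by (intro perp_mult_closure[OF bR bB bA _ 1] less.IH) auto
      then show "ip T (\<lambda>n x. A n x * B n x) = 0" using RT[OF bd_mult[OF bA bB]] by simp
    qed (rule bT)
    then show ?thesis using qp_prime by blast
  qed
  then have RR: "ip R R = 0"
  proof
    assume "qp m T"
    then have "ip R T = 0" by (rule perp)
    then show "ip R R = 0" using RT[OF bR] by (simp add: ip_commute)
  qed simp
  show ?case unfolding approximable_def
  proof (intro allI impI)
    fix \<epsilon> :: real assume "\<epsilon> > 0"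
    then obtain j :: nat where j: "2 / (real j + 1) < \<epsilon>"
    proof -
      have "(\<lambda>j::nat. 2 / (real j + 1)) \<longlonglongrightarrow> 0" by real_asymp
      then have "eventually (\<lambda>j::nat. 2 / (real j + 1) < \<epsilon>) sequentially" using \<open>\<epsilon> > 0\<close> by (rule order_tendstoD)
      then show ?thesis using that by (auto simp: eventually_sequentially)
    qed
    note bXQ = bd_diff[OF less.prems qp_bd[OF Q]]
    have "dist_sq X (Q j) \<le> 2 / (real j + 1)"
      using ip_sq_triangle[OF bd_diff[OF bXQ[of j] bR] bR] RQ[of j] RR by simp
    then show "\<exists>Q. qp m Q \<and> dist_sq X Q < \<epsilon>"
      using j Q[of j] by (intro exI[of _ "Q j"]) auto
  qed
qed

text \<open>Primeness speaks about sequences, smallness about all test pairs at each n. Pairs that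
  are extremal up to a factor 2, one for every n, form bounded sequences; primeness applied to these
  forces the near-maxima to tend to 0.\<close>

lemma prime_small:
  assumes "prime k Y"
  shows "\<exists>\<epsilon>. (\<forall>n. 0 \<le> \<epsilon> n \<and> small (V n) k k (\<epsilon> n) (Y n)) \<and> (\<epsilon> \<longlongrightarrow> 0) U"
proof -
  have Y: "bdch k Y" using assms by (simp add: prime_def)
  have smY [simp]: "sm (Y n)" for n using bd_sm[OF bdch_bd[OF Y]] .
  have ex: "\<exists>A B. chaos (V n) i A \<and> chaos (V n) (k - i) B \<and> nrm A \<le> 1 \<and> nrm B \<le> 1 \<and>
      (\<forall>A' B'. chaos (V n) i A' \<longrightarrow> chaos (V n) (k - i) B' \<longrightarrow> nrm A' \<le> 1 \<longrightarrow> nrm B' \<le> 1 \<longrightarrow>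
         \<bar>E (\<lambda>x. Y n x * (A' x * B' x))\<bar> \<le> 2 * \<bar>E (\<lambda>x. Y n x * (A x * B x))\<bar>)" for n i
  proof -
    define S where "S = {\<bar>E (\<lambda>x. Y n x * (A x * B x))\<bar> |A B. chaos (V n) i A \<and> chaos (V n) (k - i) B \<and> nrm A \<le> 1 \<and> nrm B \<le> 1}"
    have "\<exists>s\<in>S. \<forall>t\<in>S. t \<le> 2 * s"
    proof (rule near_maximum)
      have "\<bar>E (\<lambda>x. Y n x * (0 * 0))\<bar> \<in> S" unfolding S_def
        by (rule CollectI, rule exI[of _ "\<lambda>x. 0"], rule exI[of _ "\<lambda>x. 0"]) (auto simp: chaos_zero)
      then show "S \<noteq> {}" by blast
      show "0 \<le> s" if "s \<in> S" for s using that by (auto simp: S_def)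
      show "s \<le> nrm (Y n) * (sqrt (prod_const (i + (k - i))) * 1)" if sS: "s \<in> S" for s
      proof -
        obtain A B where AB: "chaos (V n) i A" "chaos (V n) (k - i) B" "nrm A \<le> 1" "nrm B \<le> 1"
          and s: "s = \<bar>E (\<lambda>x. Y n x * (A x * B x))\<bar>" using sS unfolding S_def by (elim CollectE exE conjE) (rule that, simp_all)
        have [simp]: "sm A" "sm B" using AB chaos_sm fin_V by blast+
        have "s \<le> nrm (Y n) * nrm (\<lambda>x. A x * B x)" unfolding s by (rule E_Cauchy_Schwarz) auto
        also have "nrm (\<lambda>x. A x * B x) \<le> sqrt (prod_const (i + (k - i))) * (nrm A * nrm B)"
          by (rule nrm_prod_le[OF fin_V chaos_polyf[OF AB(1)] chaos_polyf[OF AB(2)]])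
        also have "\<dots> \<le> sqrt (prod_const (i + (k - i))) * 1"
          using AB prod_const_pos[of "i + (k - i)"] mult_mono[OF AB(3,4)] by (intro mult_left_mono) auto
        finally show ?thesis by (simp add: mult_left_mono)
      qed
    qed
    then obtain s where s: "s \<in> S" "\<forall>t\<in>S. t \<le> 2 * s" by (elim bexE)
    obtain A B where "chaos (V n) i A" "chaos (V n) (k - i) B" "nrm A \<le> 1" "nrm B \<le> 1"
      and le: "\<forall>t\<in>S. t \<le> 2 * \<bar>E (\<lambda>x. Y n x * (A x * B x))\<bar>" 
    proof -
      from s(1) obtain A B where "s = \<bar>E (\<lambda>x. Y n x * (A x * B x))\<bar>"
        "chaos (V n) i A" "chaos (V n) (k - i) B" "nrm A \<le> 1" "nrm B \<le> 1" unfolding S_def by (elim CollectE exE conjE)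
      with s(2) show ?thesis by (intro that[of A B]) simp_all
    qed
    then show ?thesis
      by (intro exI[of _ A] exI[of _ B] conjI allI impI bspec[OF le]) (auto simp: S_def)
  qed
  define AB where "AB i n = (SOME (AB :: ((nat \<Rightarrow> real) \<Rightarrow> real) \<times> ((nat \<Rightarrow> real) \<Rightarrow> real)). chaos (V n) i (fst AB) \<and> chaos (V n) (k - i) (snd AB) \<and> nrm (fst AB) \<le> 1 \<and> nrm (snd AB) \<le> 1 \<and>
      (\<forall>A' B'. chaos (V n) i A' \<longrightarrow> chaos (V n) (k - i) B' \<longrightarrow> nrm A' \<le> 1 \<longrightarrow> nrm B' \<le> 1 \<longrightarrow>
         \<bar>E (\<lambda>x. Y n x * (A' x * B' x))\<bar> \<le> 2 * \<bar>E (\<lambda>x. Y n x * (fst AB x * snd AB x))\<bar>))" for i n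
  define A B where "A i n = fst (AB i n)" and "B i n = snd (AB i n)" for i n
  have AB: "chaos (V n) i (A i n) \<and> chaos (V n) (k - i) (B i n) \<and> nrm (A i n) \<le> 1 \<and> nrm (B i n) \<le> 1 \<and>
      (\<forall>A' B'. chaos (V n) i A' \<longrightarrow> chaos (V n) (k - i) B' \<longrightarrow> nrm A' \<le> 1 \<longrightarrow> nrm B' \<le> 1 \<longrightarrow>
         \<bar>E (\<lambda>x. Y n x * (A' x * B' x))\<bar> \<le> 2 * \<bar>E (\<lambda>x. Y n x * (A i n x * B i n x))\<bar>)" for i n
    unfolding A_def B_def AB_def by (rule someI_ex) (use ex[of n i] in auto)
  define e where "e i n = 2 * \<bar>E (\<lambda>x. Y n x * (A i n x * B i n x))\<bar>" for i n
  \<comment> \<open>The sum dominates the bounds for all splittings of k into i and k - i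
    simultaneously.\<close>
  define \<epsilon> where "\<epsilon> n = (\<Sum>i\<in>{1..<k}. e i n)" for n
  have e0: "0 \<le> e i n" for i n by (simp add: e_def)
  have "small (V n) k k (\<epsilon> n) (Y n)" for n
    unfolding small_def
  proof (intro allI impI)
    fix i P Q assume i: "1 \<le> i" "i \<le> k" "i < k" and P: "chaos (V n) i P" and Q: "chaos (V n) (k - i) Q"
    have [simp]: "sm P" "sm Q" using P Q chaos_sm fin_V by blast+
    have "e i n \<le> \<epsilon> n" unfolding \<epsilon>_def using i e0 by (intro member_le_sum) auto
    show "\<bar>E (\<lambda>x. Y n x * (P x * Q x))\<bar> \<le> \<epsilon> n * (nrm P * nrm Q)"
    \<comment> \<open>Only nonzero factors can be normalised; if a norm is 0, the product has norm 0
      by \<open>nrm_prod_le\<close>.\<close>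
    proof (cases "nrm P = 0 \<or> nrm Q = 0")
      case True
      have "\<bar>E (\<lambda>x. Y n x * (P x * Q x))\<bar> \<le> nrm (Y n) * nrm (\<lambda>x. P x * Q x)" by (rule E_Cauchy_Schwarz) auto
      also have "nrm (\<lambda>x. P x * Q x) \<le> sqrt (prod_const (i + (k - i))) * (nrm P * nrm Q)"
        by (rule nrm_prod_le[OF fin_V chaos_polyf[OF P] chaos_polyf[OF Q]])
      finally show ?thesis using True by (auto simp: mult_left_mono)
    next
      case False
      then have pos: "0 < nrm P" "0 < nrm Q" using nrm_nonneg[of P] nrm_nonneg[of Q] by linarith+
      have "nrm (\<lambda>x. 1 / nrm P * P x) \<le> 1" "nrm (\<lambda>x. 1 / nrm Q * Q x) \<le> 1"
        unfolding nrm_cmult using pos by auto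
      then have "\<bar>E (\<lambda>x. Y n x * ((1 / nrm P * P x) * (1 / nrm Q * Q x)))\<bar> \<le> e i n"
        unfolding e_def using AB[of n i] chaos_cmult[OF fin_V P] chaos_cmult[OF fin_V Q] by blast
      also have "(\<lambda>x. Y n x * ((1 / nrm P * P x) * (1 / nrm Q * Q x))) = (\<lambda>x. (1 / (nrm P * nrm Q)) * (Y n x * (P x * Q x)))"
        by (simp add: fun_eq_iff)
      also have "E \<dots> = (1 / (nrm P * nrm Q)) * E (\<lambda>x. Y n x * (P x * Q x))" by (rule E_cmult)
      finally have "\<bar>E (\<lambda>x. Y n x * (P x * Q x))\<bar> / (nrm P * nrm Q) \<le> \<epsilon> n"
        using \<open>e i n \<le> \<epsilon> n\<close> pos by (simp add: abs_mult)
      then show ?thesis using pos by (simp add: divide_le_eq)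
    qed
  qed
  moreover have "(\<epsilon> \<longlongrightarrow> 0) U"
  proof -
    have "(e i \<longlongrightarrow> 0) U" if i: "i \<in> {1..<k}" for i
    proof -
      have ba: "bdch i (A i)" "bdch (k - i) (B i)" using AB by (auto simp: bdch_def)
      then have "ip Y (\<lambda>n x. A i n x * B i n x) = 0" using assms i by (auto simp: prime_def)
      then have "((\<lambda>n. E (\<lambda>x. Y n x * (A i n x * B i n x))) \<longlongrightarrow> 0) U"
        using ip_tendsto[OF prime_bd[OF assms] bd_mult[OF bdch_bd[OF ba(1)] bdch_bd[OF ba(2)]]] by simp
      then show ?thesis unfolding e_def by (intro tendsto_mult_right_zero tendsto_rabs_zero)
    qed
    then have "((\<lambda>n. \<Sum>i\<in>{1..<k}. e i n) \<longlongrightarrow> (\<Sum>i\<in>{1..<k}. 0)) U" by (intro tendsto_sum)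
    then show ?thesis by (simp add: \<epsilon>_def[abs_def])
  qed
  moreover have "0 \<le> \<epsilon> n" for n unfolding \<epsilon>_def by (intro sum_nonneg e0)
  ultimately show ?thesis by blast
qed

text \<open>\<open>concentration\<close> bounds the distance to the mean, and the mean is k times
  the expectation of Y X because \<open>Y\<close> has order k. The level s is kept apart from k
  since the lemma serves both primes, with s = k, and the given sequence \<open>F\<close>, with s <
  d.\<close>

lemma small_Gam_tendsto:
  assumes Y: "bdch k Y" and X: "bdch j X" "1 \<le> j" "j \<le> s" "j \<le> k"
    and \<epsilon>: "\<forall>\<^sub>F n in U. 0 \<le> \<epsilon> n \<and> small (V n) k s (\<epsilon> n) (Y n)" "(\<epsilon> \<longlongrightarrow> 0) U"
  shows "((\<lambda>n. nrm (\<lambda>x. Gam (V n) (Y n) (X n) x - real k * ip Y X)) \<longlongrightarrow> 0) U"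
proof -
  have smm [simp]: "sm (Y n)" "sm (X n)" for n using bd_sm bdch_bd Y X by blast+
  obtain C where C: "\<And>n. nrm (X n) \<le> C" using X(1) by (auto simp: bdch_def)
  define c where "c n = E (Gam (V n) (Y n) (X n))" for n
  have "c = (\<lambda>n. real k * E (\<lambda>x. Y n x * X n x))"
    unfolding c_def using Y by (intro ext E_Gam_chaos) (auto simp: bdch_def)
  then have c: "(c \<longlongrightarrow> real k * ip Y X) U"
    using tendsto_mult_left[OF ip_tendsto[OF bdch_bd[OF Y] bdch_bd[OF X(1)]], of "real k"] by simp
  have 1: "\<forall>\<^sub>F n in U. nrm (\<lambda>x. Gam (V n) (Y n) (X n) x - c n) \<le> conc_const k j * \<epsilon> n * nrm (X n)"
    using \<epsilon>(1)
  proof eventually_elim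
    case (elim n)
    then show ?case unfolding c_def using Y X
      by (intro concentration[where s = s]) (auto simp: bdch_def)
  qed
  have "\<forall>\<^sub>F n in U. norm (nrm (\<lambda>x. Gam (V n) (Y n) (X n) x - real k * ip Y X))
      \<le> \<bar>conc_const k j\<bar> * \<epsilon> n * C + \<bar>c n - real k * ip Y X\<bar>"
    using 1 \<epsilon>(1)
  proof eventually_elim
    case (elim n)
    have "nrm (\<lambda>x. Gam (V n) (Y n) (X n) x - real k * ip Y X)
        \<le> nrm (\<lambda>x. Gam (V n) (Y n) (X n) x - c n) + nrm (\<lambda>x. c n - real k * ip Y X)"
      using nrm_add[of "\<lambda>x. Gam (V n) (Y n) (X n) x - c n" "\<lambda>x. c n - real k * ip Y X"] by simp
    also have "\<dots> \<le> conc_const k j * \<epsilon> n * nrm (X n) + \<bar>c n - real k * ip Y X\<bar>"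
      using elim by simp
    also have "conc_const k j * \<epsilon> n * nrm (X n) \<le> \<bar>conc_const k j\<bar> * \<epsilon> n * C"
      using elim C[of n] by (intro mult_mono) auto
    finally show ?case by simp
  qed
  moreover have "((\<lambda>n. \<bar>conc_const k j\<bar> * \<epsilon> n * C + \<bar>c n - real k * ip Y X\<bar>) \<longlongrightarrow> \<bar>conc_const k j\<bar> * 0 * C + \<bar>real k * ip Y X - real k * ip Y X\<bar>) U"
    by (intro tendsto_intros \<epsilon> c)
  ultimately show ?thesis by - (rule Lim_null_comparison, assumption, simp)
qed

lemma bdch_orth: "bdch k Y \<Longrightarrow> bdch j X \<Longrightarrow> j \<noteq> k \<Longrightarrow> ip Y X = 0"
proof (rule ip_eqI)
  assume "bdch k Y" "bdch j X" "j \<noteq> k"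
  then have "E (\<lambda>x. Y n x * X n x) = 0" for n
    using chaos_orth[OF _ _ fin_V, of n k "Y n" j "X n"] by (auto simp: bdch_def)
  then show "((\<lambda>n. E (\<lambda>x. Y n x * X n x)) \<longlongrightarrow> 0) U" by simp
qed

text \<open>Concentration requires the order of the second argument to be at most that of the first.
  Otherwise the arguments are swapped; the orders then differ, so both candidate limits are
  0.\<close>

lemma prime_Gam_tendsto:
  assumes "prime k Y" "prime j X"
  shows "((\<lambda>n. nrm (\<lambda>x. Gam (V n) (Y n) (X n) x - real k * ip Y X)) \<longlongrightarrow> 0) U"
proof -
  have *: "((\<lambda>n. nrm (\<lambda>x. Gam (V n) (Y n) (X n) x - real k * ip Y X)) \<longlongrightarrow> 0) U"
    if "prime k Y" "prime j X" "j \<le> k" for k j Y X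
  proof -
    from prime_small[OF that(1)] obtain \<epsilon> where
      "\<forall>n. 0 \<le> \<epsilon> n \<and> small (V n) k k (\<epsilon> n) (Y n)" "(\<epsilon> \<longlongrightarrow> 0) U" by blast
    then show ?thesis using that
      by (intro small_Gam_tendsto[where j = j and s = k and \<epsilon> = \<epsilon>]) (auto simp: prime_def)
  qed
  show ?thesis
  proof (cases "j \<le> k")
    case False
    then have "ip Y X = 0" using assms bdch_orth[of k Y j X] by (auto simp: prime_def)
    then show ?thesis using *[OF assms(2,1)] False by (simp add: Gam_commute ip_commute)
  qed (use * assms in auto)
qed

end

section \<open>Stein's identity and asymptotic normality\<close>

context gaussian_family begin

lemma E_abs_le: "sm f \<Longrightarrow> \<bar>E f\<bar> \<le> nrm f"
  using E_Cauchy_Schwarz[of f "\<lambda>x. 1"] by simp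

lemma nrm_mono: "sm f \<Longrightarrow> sm g \<Longrightarrow> (\<And>x. \<bar>f x\<bar> \<le> \<bar>g x\<bar>) \<Longrightarrow> nrm f \<le> nrm g"
  unfolding nrm_def by (intro real_sqrt_le_mono E_mono) (auto simp: abs_le_square_iff)

text \<open>All moments are bounded uniformly in n. Test functions grow at most polynomially, so
  this class is stable under composition with them.\<close>

definition mb :: "(nat \<Rightarrow> (nat \<Rightarrow> real) \<Rightarrow> real) \<Rightarrow> bool" where
  "mb X \<longleftrightarrow> (\<forall>n. sm (X n)) \<and> (\<forall>k. \<exists>C. \<forall>n. nrm (\<lambda>x. X n x ^ k) \<le> C)"

lemma mb_sm: "mb X \<Longrightarrow> sm (X n)"
  by (simp add: mb_def)

lemma mb_bound: "mb X \<Longrightarrow> \<exists>C. \<forall>n. nrm (\<lambda>x. X n x ^ k) \<le> C"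
  by (simp add: mb_def)

lemma mb_nrm: "mb X \<Longrightarrow> \<exists>C. \<forall>n. nrm (X n) \<le> C"
  using mb_bound[of X 1] by simp

lemma mb_const: "mb (\<lambda>n x. c)"
  unfolding mb_def by auto

text \<open>Powers of a polynomial are again polynomials, so \<open>nrm_prod_le\<close> bounds their
  norms one factor at a time.\<close>

lemma mb_polyf:
  assumes "\<And>n. finite (W n)" "\<And>n. polyf (W n) m (X n)" "\<And>n. nrm (X n) \<le> C"
  shows "mb X"
proof -
  have "\<exists>D. \<forall>n. nrm (\<lambda>x. X n x ^ k) \<le> D \<and> polyf (W n) (m * k) (\<lambda>x. X n x ^ k)" for k
  proof (induction k)
    case 0
    then show ?case by (auto intro: wpoly_const)
  next
    case (Suc k)
    then obtain D where D: "\<And>n. nrm (\<lambda>x. X n x ^ k) \<le> D" "\<And>n. polyf (W n) (m * k) (\<lambda>x. X n x ^ k)" by blast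
    have D0: "0 \<le> D" using D(1)[of 0] nrm_nonneg order_trans by blast
    have "nrm (\<lambda>x. X n x * X n x ^ k) \<le> sqrt (prod_const (m + m * k)) * (C * D)" for n
    proof -
      have "nrm (\<lambda>x. X n x * X n x ^ k) \<le> sqrt (prod_const (m + m * k)) * (nrm (X n) * nrm (\<lambda>x. X n x ^ k))"
        by (rule nrm_prod_le[OF assms(1,2) D(2)])
      also have "\<dots> \<le> sqrt (prod_const (m + m * k)) * (C * D)"
      proof (rule mult_left_mono)
        have "0 \<le> C" using assms(3)[of n] nrm_nonneg[of "X n"] by linarith
        then show "nrm (X n) * nrm (\<lambda>x. X n x ^ k) \<le> C * D"
          using assms(3) D(1) by (intro mult_mono) auto
      qed (use prod_const_pos[of "m + m * k"] in simp)
      finally show ?thesis .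
    qed
    moreover have "polyf (W n) (m + m * k) (\<lambda>x. X n x * X n x ^ k)" for n
      by (rule wpoly_mult[OF assms(2) D(2)])
    ultimately show ?case by (intro exI[of _ "sqrt (prod_const (m + m * k)) * (C * D)"]) simp
  qed
  moreover have "sm (X n)" for n using wpoly_sm[OF assms(2,1)] .
  ultimately show ?thesis unfolding mb_def by blast
qed

lemma mb_mono:
  assumes "mb X" "\<And>n. sm (Z n)" "\<And>n x. \<bar>Z n x\<bar> \<le> \<bar>X n x\<bar>"
  shows "mb Z"
proof -
  have "\<exists>C. \<forall>n. nrm (\<lambda>x. Z n x ^ k) \<le> C" for k
  proof -
    obtain C where C: "\<And>n. nrm (\<lambda>x. X n x ^ k) \<le> C" using mb_bound[OF assms(1)] by blast
    have "nrm (\<lambda>x. Z n x ^ k) \<le> C" for n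
      by (rule order_trans[OF nrm_mono C[of n]])
        (use assms mb_sm[OF assms(1)] in \<open>auto simp: power_abs intro: power_mono\<close>)
    then show ?thesis by blast
  qed
  then show ?thesis using assms(2) by (simp add: mb_def)
qed

lemma mb_mult: assumes "mb X" "mb Z" shows "mb (\<lambda>n x. X n x * Z n x)"
proof -
  note [simp] = mb_sm[OF assms(1)] mb_sm[OF assms(2)]
  have "\<exists>C. \<forall>n. nrm (\<lambda>x. (X n x * Z n x) ^ k) \<le> C" for k
  proof -
    obtain C where C: "\<And>n. nrm (\<lambda>x. X n x ^ (2 * k)) \<le> C" using mb_bound[OF assms(1)] by blast
    obtain D where D: "\<And>n. nrm (\<lambda>x. Z n x ^ (2 * k)) \<le> D" using mb_bound[OF assms(2)] by blast
    have C0: "0 \<le> C" using C[of 0] nrm_nonneg order_trans by blast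
    have "nrm (\<lambda>x. (X n x * Z n x) ^ k) \<le> sqrt (C * D)" for n
    proof -
      have "(\<lambda>x. ((X n x * Z n x) ^ k)\<^sup>2) = (\<lambda>x. X n x ^ (2 * k) * Z n x ^ (2 * k))"
        by (simp add: fun_eq_iff power_mult_distrib power_mult[symmetric] mult.commute)
      moreover have "E (\<lambda>x. X n x ^ (2 * k) * Z n x ^ (2 * k)) \<le> nrm (\<lambda>x. X n x ^ (2 * k)) * nrm (\<lambda>x. Z n x ^ (2 * k))"
        using E_Cauchy_Schwarz[of "\<lambda>x. X n x ^ (2 * k)" "\<lambda>x. Z n x ^ (2 * k)"] by simp
      moreover have "nrm (\<lambda>x. X n x ^ (2 * k)) * nrm (\<lambda>x. Z n x ^ (2 * k)) \<le> C * D"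
        using C D C0 by (intro mult_mono) auto
      ultimately show ?thesis unfolding nrm_def[of "\<lambda>x. (X n x * Z n x) ^ k"] by simp
    qed
    then show ?thesis by blast
  qed
  then show ?thesis by (simp add: mb_def)
qed

lemma mb_add: assumes "mb X" "mb Z" shows "mb (\<lambda>n x. X n x + Z n x)"
proof -
  note [simp] = mb_sm[OF assms(1)] mb_sm[OF assms(2)]
  have "\<exists>C. \<forall>n. nrm (\<lambda>x. (X n x + Z n x) ^ k) \<le> C" for k
  proof -
    obtain C where C: "\<And>n. nrm (\<lambda>x. X n x ^ (2 * k)) \<le> C" using mb_bound[OF assms(1)] by blast
    obtain D where D: "\<And>n. nrm (\<lambda>x. Z n x ^ (2 * k)) \<le> D" using mb_bound[OF assms(2)] by blast
    have "nrm (\<lambda>x. (X n x + Z n x) ^ k) \<le> sqrt (4 ^ k * (C + D))" for n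
    proof -
      have pw: "((a + b) ^ k)\<^sup>2 \<le> 4 ^ k * (a ^ (2 * k) + b ^ (2 * k))" for a b :: real
      proof -
        have "(a + b)\<^sup>2 \<le> 4 * max (a\<^sup>2) (b\<^sup>2)"
        proof -
          have "(a + b)\<^sup>2 \<le> 2 * a\<^sup>2 + 2 * b\<^sup>2"
            using zero_le_power2[of "a - b"] by (simp add: power2_eq_square algebra_simps)
          then show ?thesis by (simp add: max_def)
        qed
        then have "((a + b)\<^sup>2) ^ k \<le> (4 * max (a\<^sup>2) (b\<^sup>2)) ^ k" by (intro power_mono) auto
        also have "\<dots> = 4 ^ k * max (a\<^sup>2) (b\<^sup>2) ^ k" by (simp add: power_mult_distrib)
        also have "max (a\<^sup>2) (b\<^sup>2) ^ k \<le> (a\<^sup>2) ^ k + (b\<^sup>2) ^ k" by (simp add: max_def)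
        finally show ?thesis by (simp add: power_mult[symmetric] mult.commute)
      qed
      have "E (\<lambda>x. ((X n x + Z n x) ^ k)\<^sup>2) \<le> E (\<lambda>x. 4 ^ k * (X n x ^ (2 * k) + Z n x ^ (2 * k)))"
        by (intro E_mono pw) auto
      also have "\<dots> = 4 ^ k * (E (\<lambda>x. X n x ^ (2 * k)) + E (\<lambda>x. Z n x ^ (2 * k)))"
        by (subst E_cmult, subst E_add) auto
      also have "\<dots> \<le> 4 ^ k * (C + D)"
        using E_abs_le[of "\<lambda>x. X n x ^ (2 * k)"] E_abs_le[of "\<lambda>x. Z n x ^ (2 * k)"] C[of n] D[of n]
        by (intro mult_left_mono) auto
      finally show ?thesis unfolding nrm_def[of "\<lambda>x. (X n x + Z n x) ^ k"] by simp
    qed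
    then show ?thesis by blast
  qed
  then show ?thesis by (simp add: mb_def)
qed

lemma mb_power: "mb X \<Longrightarrow> mb (\<lambda>n x. X n x ^ k)"
proof (induction k)
  case (Suc k)
  have "mb (\<lambda>n x. X n x * X n x ^ k)" using Suc by (intro mb_mult)
  then show ?case by simp
qed (simp add: mb_const)

lemma mb_prod: "(\<And>j. j \<in> A \<Longrightarrow> mb (X j)) \<Longrightarrow> mb (\<lambda>n x. \<Prod>j\<in>A. X j n x)"
proof (induction A rule: infinite_finite_induct)
  case (insert a A)
  have "mb (\<lambda>n x. X a n x * (\<Prod>j\<in>A. X j n x))" using insert by (intro mb_mult) auto
  then show ?case using insert by simp
qed (simp_all add: mb_const)

lemma mb_smooth:
  assumes "smooth J \<Psi>" "finite J" "\<And>j. j \<in> J \<Longrightarrow> mb (y j)"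
  shows "mb (\<lambda>n x. \<Psi> (\<lambda>j. y j n x))"
proof -
  obtain C m where C: "0 \<le> C" "\<And>x. \<bar>\<Psi> x\<bar> \<le> C * (\<Prod>i\<in>J. 1 + (x i)\<^sup>2) ^ m"
    using smooth_bound[OF assms(1,2)] by blast
  show ?thesis
  proof (rule mb_mono)
    show "mb (\<lambda>n x. C * (\<Prod>i\<in>J. 1 + (y i n x)\<^sup>2) ^ m)"
      by (intro mb_mult mb_const mb_power mb_prod mb_add assms(3))
    show "sm (\<lambda>x. \<Psi> (\<lambda>j. y j n x))" for n
      by (rule sm_compose[OF assms(1)]) (use assms(3) mb_sm in blast)
    show "\<bar>\<Psi> (\<lambda>j. y j n x)\<bar> \<le> \<bar>C * (\<Prod>i\<in>J. 1 + (y i n x)\<^sup>2) ^ m\<bar>" for n x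
      using C(2)[of "\<lambda>j. y j n x"] by linarith
  qed
qed

lemma mb_var: "mb (\<lambda>n x. x (N n))"
proof (rule mb_polyf[of "\<lambda>n. {N n}" 1 _ 1])
  have "E (\<lambda>x. x i * x i) = 1" for i using E_ibp[of "\<lambda>x. x i" i] by simp
  then show "nrm (\<lambda>x. x (N n)) \<le> 1" for n by (simp add: nrm_def power2_eq_square)
qed (auto intro: wpoly_var)

text \<open>By the chain rule the carre du champ of e and \<Psi>(y) is the sum over j of
  \<open>D j \<Psi>\<close> at y times that of e and y j, and its mean is w times the expectation of
  e \<Psi>(y). Replacing each carre du champ by its limit c j costs a Cauchy-Schwarz bound. The y j
  are arbitrary families with bounded moments, so primes, fresh Gaussians and \<open>F\<close> can
  all be inserted.\<close>

lemma stein: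
  assumes fin: "\<And>n. finite (V n)" and e: "\<And>n. chaos (V n) w (e n)" "1 \<le> w"
    and J: "finite J" "\<And>j. j \<in> J \<Longrightarrow> mb (y j)"
    and Gm: "\<And>j. j \<in> J \<Longrightarrow> ((\<lambda>n. nrm (\<lambda>x. Gam (V n) (e n) (y j n) x - c j)) \<longlongrightarrow> 0) U"
    and \<Psi>: "smooth J \<Psi>"
  shows "((\<lambda>n. E (\<lambda>x. e n x * \<Psi> (\<lambda>j. y j n x)) - (\<Sum>j\<in>J. c j / real w * E (\<lambda>x. D j \<Psi> (\<lambda>j. y j n x)))) \<longlongrightarrow> 0) U"
proof -
  have [simp]: "sm (e n)" for n using e fin chaos_sm by blast
  have smy: "sm (y j n)" if "j \<in> J" for j n using J(2)[OF that] mb_sm by blast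
  note sD = smooth_D[OF \<Psi> J(1)]
  have [simp]: "sm (\<lambda>x. \<Psi> (\<lambda>j. y j n x))" for n by (rule sm_compose[OF \<Psi> smy])
  have [simp]: "sm (\<lambda>x. D j \<Psi> (\<lambda>j. y j n x))" for j n by (rule sm_compose[OF sD smy])
  have key: "E (\<lambda>x. e n x * \<Psi> (\<lambda>j. y j n x)) - (\<Sum>j\<in>J. c j / real w * E (\<lambda>x. D j \<Psi> (\<lambda>j. y j n x)))
      = (1 / real w) * (\<Sum>j\<in>J. E (\<lambda>x. D j \<Psi> (\<lambda>j. y j n x) * (Gam (V n) (e n) (y j n) x - c j)))" for n
  proof -
    have "real w * E (\<lambda>x. e n x * \<Psi> (\<lambda>j. y j n x)) = E (Gam (V n) (e n) (\<lambda>x. \<Psi> (\<lambda>j. y j n x)))"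
      by (rule E_Gam_chaos[OF e(1) fin, symmetric]) simp
    also have "Gam (V n) (e n) (\<lambda>x. \<Psi> (\<lambda>j. y j n x)) = (\<lambda>x. \<Sum>j\<in>J. D j \<Psi> (\<lambda>j. y j n x) * Gam (V n) (e n) (y j n) x)"
    proof
      fix x
      have Dc: "D i (\<lambda>x. \<Psi> (\<lambda>j. y j n x)) x = (\<Sum>j\<in>J. D j \<Psi> (\<lambda>j. y j n x) * D i (y j n) x)" for i
        by (rule fun_cong[OF D_compose[OF \<Psi> J(1) smy]])
      have "Gam (V n) (e n) (\<lambda>x. \<Psi> (\<lambda>j. y j n x)) x = (\<Sum>i\<in>V n. \<Sum>j\<in>J. D i (e n) x * (D j \<Psi> (\<lambda>j. y j n x) * D i (y j n) x))"
        unfolding Gam_def Dc sum_distrib_left ..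
      also have "\<dots> = (\<Sum>j\<in>J. \<Sum>i\<in>V n. D i (e n) x * (D j \<Psi> (\<lambda>j. y j n x) * D i (y j n) x))"
        by (rule sum.swap)
      finally show "Gam (V n) (e n) (\<lambda>x. \<Psi> (\<lambda>j. y j n x)) x = (\<Sum>j\<in>J. D j \<Psi> (\<lambda>j. y j n x) * Gam (V n) (e n) (y j n) x)"
        unfolding Gam_def sum_distrib_left by (simp add: mult_ac)
    qed
    also have "E \<dots> = (\<Sum>j\<in>J. E (\<lambda>x. D j \<Psi> (\<lambda>j. y j n x) * (Gam (V n) (e n) (y j n) x - c j)) + c j * E (\<lambda>x. D j \<Psi> (\<lambda>j. y j n x)))"
      using smy by (simp add: right_diff_distrib mult.commute[of _ "c _"])
    finally have *: "real w * E (\<lambda>x. e n x * \<Psi> (\<lambda>j. y j n x)) = \<dots>" .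
    show ?thesis using e(2) *
      by (simp add: field_simps sum.distrib sum_divide_distrib[symmetric])
  qed
  have "((\<lambda>n. \<Sum>j\<in>J. E (\<lambda>x. D j \<Psi> (\<lambda>j. y j n x) * (Gam (V n) (e n) (y j n) x - c j))) \<longlongrightarrow> (\<Sum>j\<in>J. 0)) U"
  proof (rule tendsto_sum)
    fix j assume j: "j \<in> J"
    obtain C where C: "\<And>n. nrm (\<lambda>x. D j \<Psi> (\<lambda>j. y j n x)) \<le> C"
    proof -
      have "mb (\<lambda>n x. D j \<Psi> (\<lambda>j. y j n x))" by (rule mb_smooth[OF sD J(1) J(2)])
      then show ?thesis using that mb_nrm by blast
    qed
    show "((\<lambda>n. E (\<lambda>x. D j \<Psi> (\<lambda>j. y j n x) * (Gam (V n) (e n) (y j n) x - c j))) \<longlongrightarrow> 0) U"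
    proof (rule Lim_null_comparison)
      show "\<forall>\<^sub>F n in U. norm (E (\<lambda>x. D j \<Psi> (\<lambda>j. y j n x) * (Gam (V n) (e n) (y j n) x - c j)))
          \<le> C * nrm (\<lambda>x. Gam (V n) (e n) (y j n) x - c j)"
      proof (intro always_eventually allI)
        fix n
        have "\<bar>E (\<lambda>x. D j \<Psi> (\<lambda>j. y j n x) * (Gam (V n) (e n) (y j n) x - c j))\<bar>
            \<le> nrm (\<lambda>x. D j \<Psi> (\<lambda>j. y j n x)) * nrm (\<lambda>x. Gam (V n) (e n) (y j n) x - c j)"
          using smy[OF j] by (intro E_Cauchy_Schwarz) auto
        also have "\<dots> \<le> C * nrm (\<lambda>x. Gam (V n) (e n) (y j n) x - c j)"
          using C by (intro mult_right_mono) auto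
        finally show "norm (E (\<lambda>x. D j \<Psi> (\<lambda>j. y j n x) * (Gam (V n) (e n) (y j n) x - c j)))
          \<le> C * nrm (\<lambda>x. Gam (V n) (e n) (y j n) x - c j)" by simp
      qed
      show "((\<lambda>n. C * nrm (\<lambda>x. Gam (V n) (e n) (y j n) x - c j)) \<longlongrightarrow> 0) U"
        by (rule tendsto_mult_right_zero[OF Gm[OF j]])
    qed
  qed
  then have "((\<lambda>n. (1 / real w) * (\<Sum>j\<in>J. E (\<lambda>x. D j \<Psi> (\<lambda>j. y j n x) * (Gam (V n) (e n) (y j n) x - c j)))) \<longlongrightarrow> 0) U"
    by (intro tendsto_mult_right_zero) simp
  then show ?thesis unfolding key .
qed

end

text \<open>The mean value inequality is applied to f' and then to f minus its tangent; this gives B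
  where Taylor's formula would give B / 2.\<close>

lemma second_order_bound:
  fixes f f' f'' :: "real \<Rightarrow> real"
  assumes "\<And>t. (f has_real_derivative f' t) (at t)" "\<And>t. (f' has_real_derivative f'' t) (at t)"
    and "\<And>t. \<bar>t - a\<bar> \<le> 1 \<Longrightarrow> \<bar>f'' t\<bar> \<le> B" and h: "\<bar>h\<bar> \<le> 1"
  shows "\<bar>f (a + h) - f a - h * f' a\<bar> \<le> B * h\<^sup>2"
proof -
  have B: "0 \<le> B" using assms(3)[of a] by auto
  let ?S = "{a - \<bar>h\<bar>..a + \<bar>h\<bar>}"
  have 1: "\<bar>f' t - f' a\<bar> \<le> B * \<bar>h\<bar>" if t: "t \<in> ?S" for t
  proof -
    have "norm (f' t - f' a) \<le> B * norm (t - a)"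
      using h t by (intro field_differentiable_bound[of ?S f' f'' B])
        (auto intro!: assms(3) has_field_derivative_at_within[OF assms(2)])
    also have "\<dots> \<le> B * \<bar>h\<bar>" using t B by (intro mult_left_mono) auto
    finally show ?thesis by simp
  qed
  have "norm ((f (a + h) - (a + h) * f' a) - (f a - a * f' a)) \<le> (B * \<bar>h\<bar>) * norm ((a + h) - a)"
  proof (rule field_differentiable_bound[of ?S "\<lambda>t. f t - t * f' a" "\<lambda>t. f' t - f' a"])
    show "((\<lambda>t. f t - t * f' a) has_field_derivative f' t - f' a) (at t within ?S)" for t
      by (auto intro!: derivative_eq_intros has_field_derivative_at_within[OF assms(1)])
    show "norm (f' t - f' a) \<le> B * \<bar>h\<bar>" if "t \<in> ?S" for t using 1[OF that] by simp
  qed auto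
  then show ?thesis by (simp add: algebra_simps power2_eq_square abs_mult[symmetric])
qed

context gaussian_family begin

text \<open>The expectation of the test function along the rotation from one half of the coordinates to
  the other has vanishing derivative in the limit, because both halves satisfy Stein's identity with
  the same variances.\<close>

lemma rotation:
  fixes y :: "nat \<Rightarrow> nat \<Rightarrow> (nat \<Rightarrow> real) \<Rightarrow> real" and K :: nat
  assumes U: "ultra U" and y: "\<And>j. j < 2 * K \<Longrightarrow> mb (y j)"
    and st: "\<And>i \<Psi>. i < 2 * K \<Longrightarrow> smooth {..<2 * K} \<Psi> \<Longrightarrow>
      ((\<lambda>n. E (\<lambda>x. y i n x * \<Psi> (\<lambda>j. y j n x)) - \<tau> i * E (\<lambda>x. D i \<Psi> (\<lambda>j. y j n x))) \<longlongrightarrow> 0) U"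
    and \<tau>: "\<And>i. i < K \<Longrightarrow> \<tau> (K + i) = \<tau> i"
    and \<Phi>: "smooth {..<K} \<Phi>"
  shows "((\<lambda>n. E (\<lambda>x. \<Phi> (\<lambda>i. y i n x)) - E (\<lambda>x. \<Phi> (\<lambda>i. y (K + i) n x))) \<longlongrightarrow> 0) U"
proof -
  have Unb: "U \<noteq> bot" using U by (simp add: ultra_def)
  define z :: "real \<Rightarrow> nat \<Rightarrow> (nat \<Rightarrow> real) \<Rightarrow> real" where "z \<theta> i x = cos \<theta> * x i + sin \<theta> * x (K + i)" for \<theta> i x
  have smz: "smooth {..<2 * K} (z \<theta> i)" if "i \<in> {..<K}" for i \<theta>
    unfolding z_def[abs_def] using that by (intro smooth.intros) auto
  have smz' [simp]: "sm (z \<theta> i)" for \<theta> i unfolding z_def[abs_def] by auto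
  define g where "g \<theta> x = \<Phi> (\<lambda>i. z \<theta> i x)" for \<theta> x
  have smg: "smooth {..<2 * K} (g \<theta>)" for \<theta>
    unfolding g_def[abs_def] by (rule smooth_compose[OF \<Phi> smz])
  have yin: "mb (y j)" if "j \<in> {..<2 * K}" for j using y that by simp
  have mbg: "mb (\<lambda>n x. g \<theta> (\<lambda>j. y j n x))" for \<theta> by (rule mb_smooth[OF smg _ yin]) simp
  define v where "v \<theta> n = E (\<lambda>x. g \<theta> (\<lambda>j. y j n x))" for \<theta> n
  define u where "u \<theta> = Lim U (v \<theta>)" for \<theta>
  have vu: "(v \<theta> \<longlongrightarrow> u \<theta>) U" for \<theta>
  proof -
    obtain C where C: "\<forall>n. nrm (\<lambda>x. g \<theta> (\<lambda>j. y j n x)) \<le> C" using mb_nrm[OF mbg] by blast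
    have "\<bar>v \<theta> n\<bar> \<le> C" for n unfolding v_def
      using E_abs_le[OF mb_sm[OF mbg[of \<theta>]], of n] C[rule_format, of n] by linarith
    then obtain l where "(v \<theta> \<longlongrightarrow> l) U" using ultra_bounded_tendsto[OF U] by blast
    then show ?thesis unfolding u_def using tendsto_Lim[OF Unb] by blast
  qed
  \<comment> \<open>The angle becomes the extra coordinate \<open>2 * K\<close>, so that
    differentiability and growth in the angle are instances of the results on smooth
    functions.\<close>
  define gh where "gh x = \<Phi> (\<lambda>i. cos (x (2 * K)) * x i + sin (x (2 * K)) * x (K + i))" for x
  let ?W = "{..<Suc (2 * K)}"
  have smgh: "smooth ?W gh"
    unfolding gh_def[abs_def] by (rule smooth_compose[OF \<Phi>]) (intro smooth.intros, auto)
  have fW: "finite ?W" by simp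
  have [simp]: "sm gh" by (rule smooth_imp_sm[OF smgh fW])
  have gh_g: "gh (x(2 * K := \<theta>)) = g \<theta> x" for x \<theta>
  proof -
    have "\<Phi> (\<lambda>i. cos \<theta> * (x(2 * K := \<theta>)) i + sin \<theta> * (x(2 * K := \<theta>)) (K + i)) = \<Phi> (\<lambda>i. z \<theta> i x)"
      by (rule smooth_cong_on[OF \<Phi>]) (auto simp: z_def)
    then show ?thesis by (simp add: gh_def g_def)
  qed
  define g1 where "g1 \<theta> x = D (2 * K) gh (x(2 * K := \<theta>))" for \<theta> x
  have g1_eq: "g1 \<theta> x = (\<Sum>i<K. (- sin \<theta>) * (x i * D i \<Phi> (\<lambda>i. z \<theta> i x)) + cos \<theta> * (x (K + i) * D i \<Phi> (\<lambda>i. z \<theta> i x)))" for \<theta> x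
  proof -
    define \<phi> :: "nat \<Rightarrow> (nat \<Rightarrow> real) \<Rightarrow> real" where "\<phi> i x = cos (x (2 * K)) * x i + sin (x (2 * K)) * x (K + i)" for i x
    have [simp]: "sm (\<phi> i)" for i unfolding \<phi>_def[abs_def] by auto
    have D\<phi>: "D (2 * K) (\<phi> i) x = - sin (x (2 * K)) * x i + cos (x (2 * K)) * x (K + i)" if "i < K" for i x
      unfolding \<phi>_def[abs_def] using that by simp
    have "D (2 * K) gh = (\<lambda>x. \<Sum>i<K. D i \<Phi> (\<lambda>i. \<phi> i x) * D (2 * K) (\<phi> i) x)"
    proof -
      have "gh = (\<lambda>x. \<Phi> (\<lambda>i. \<phi> i x))" by (simp add: gh_def \<phi>_def fun_eq_iff)
      then show ?thesis using D_compose[OF \<Phi>, of \<phi> "2 * K"] by simp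
    qed
    then have "g1 \<theta> x = (\<Sum>i<K. D i \<Phi> (\<lambda>i. \<phi> i (x(2 * K := \<theta>))) * (- sin \<theta> * x i + cos \<theta> * x (K + i)))"
      unfolding g1_def by (simp add: D\<phi>)
    also have "\<dots> = (\<Sum>i<K. D i \<Phi> (\<lambda>i. z \<theta> i x) * (- sin \<theta> * x i + cos \<theta> * x (K + i)))"
    proof (rule sum.cong)
      fix i
      have "D i \<Phi> (\<lambda>i. \<phi> i (x(2 * K := \<theta>))) = D i \<Phi> (\<lambda>i. z \<theta> i x)"
        by (rule smooth_cong_on[OF smooth_D[OF \<Phi>]]) (auto simp: \<phi>_def z_def)
      then show "D i \<Phi> (\<lambda>i. \<phi> i (x(2 * K := \<theta>))) * (- sin \<theta> * x i + cos \<theta> * x (K + i)) = D i \<Phi> (\<lambda>i. z \<theta> i x) * (- sin \<theta> * x i + cos \<theta> * x (K + i))"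
        by simp
    qed simp
    finally show ?thesis by (simp add: algebra_simps)
  qed
  \<comment> \<open>The derivative in the angle pairs - sin \<theta> \<open>y i\<close> + cos
    \<theta> \<open>y (K + i)\<close> with a test function. By Stein's identity the limit has the
    factor (\<tau> (K + i) - \<tau> i) sin \<theta> cos \<theta>, which is 0.\<close>
  have lim1: "((\<lambda>n. E (\<lambda>x. g1 \<theta> (\<lambda>j. y j n x))) \<longlongrightarrow> 0) U" for \<theta>
  proof -
    define \<Psi> where "\<Psi> i x = D i \<Phi> (\<lambda>i. z \<theta> i x)" for i x
    have s\<Psi>: "smooth {..<2 * K} (\<Psi> i)" for i
      unfolding \<Psi>_def[abs_def] by (rule smooth_compose[OF smooth_D[OF \<Phi>] smz]) auto
    have D\<Psi>: "D j (\<Psi> i) x = (\<Sum>l<K. D l (D i \<Phi>) (\<lambda>i. z \<theta> i x) * D j (z \<theta> l) x)" for i j x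
      unfolding \<Psi>_def[abs_def] using D_compose[OF smooth_D[OF \<Phi> finite_lessThan, of i] finite_lessThan, of "z \<theta>" j] by simp
    have Dz: "D j (z \<theta> l) x = cos \<theta> * (if j = l then 1 else 0) + sin \<theta> * (if j = K + l then 1 else 0)" for j l x
      unfolding z_def[abs_def] by simp
    have D1: "D i (\<Psi> i) x = cos \<theta> * D i (D i \<Phi>) (\<lambda>i. z \<theta> i x)" if "i < K" for i x
    proof -
      have "D i (\<Psi> i) x = (\<Sum>l<K. if i = l then cos \<theta> * D i (D i \<Phi>) (\<lambda>i. z \<theta> i x) else 0)"
        unfolding D\<Psi> Dz using that by (intro sum.cong) auto
      then show ?thesis using that by simp
    qed
    have D2: "D (K + i) (\<Psi> i) x = sin \<theta> * D i (D i \<Phi>) (\<lambda>i. z \<theta> i x)" if "i < K" for i x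
    proof -
      have "D (K + i) (\<Psi> i) x = (\<Sum>l<K. if i = l then sin \<theta> * D i (D i \<Phi>) (\<lambda>i. z \<theta> i x) else 0)"
        unfolding D\<Psi> Dz using that by (intro sum.cong) auto
      then show ?thesis using that by simp
    qed
    have smy: "sm (y j n)" if "j < 2 * K" for j n using y[OF that] mb_sm by blast
    have sm\<Psi>y: "sm (\<lambda>x. \<Psi> i (\<lambda>j. y j n x))" for i n
      by (rule sm_compose[OF s\<Psi>]) (use smy in auto)
    have "((\<lambda>n. \<Sum>i<K. (- sin \<theta>) * (E (\<lambda>x. y i n x * \<Psi> i (\<lambda>j. y j n x)) - \<tau> i * E (\<lambda>x. D i (\<Psi> i) (\<lambda>j. y j n x)))
        + cos \<theta> * (E (\<lambda>x. y (K + i) n x * \<Psi> i (\<lambda>j. y j n x)) - \<tau> (K + i) * E (\<lambda>x. D (K + i) (\<Psi> i) (\<lambda>j. y j n x))))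
        \<longlongrightarrow> (\<Sum>i<K. (- sin \<theta>) * 0 + cos \<theta> * 0)) U"
      by (intro tendsto_sum tendsto_add tendsto_mult_left st s\<Psi>) auto
    moreover have "(\<Sum>i<K. (- sin \<theta>) * (E (\<lambda>x. y i n x * \<Psi> i (\<lambda>j. y j n x)) - \<tau> i * E (\<lambda>x. D i (\<Psi> i) (\<lambda>j. y j n x)))
        + cos \<theta> * (E (\<lambda>x. y (K + i) n x * \<Psi> i (\<lambda>j. y j n x)) - \<tau> (K + i) * E (\<lambda>x. D (K + i) (\<Psi> i) (\<lambda>j. y j n x))))
        = E (\<lambda>x. g1 \<theta> (\<lambda>j. y j n x))" for n
    proof -
      have "E (\<lambda>x. g1 \<theta> (\<lambda>j. y j n x)) = (\<Sum>i<K. (- sin \<theta>) * E (\<lambda>x. y i n x * \<Psi> i (\<lambda>j. y j n x)) + cos \<theta> * E (\<lambda>x. y (K + i) n x * \<Psi> i (\<lambda>j. y j n x)))"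
      proof -
        have s: "sm (\<lambda>x. y i n x * \<Psi> i (\<lambda>j. y j n x))" "sm (\<lambda>x. y (K + i) n x * \<Psi> i (\<lambda>j. y j n x))" if "i < K" for i
          using that smy sm\<Psi>y by auto
        have "E (\<lambda>x. (- sin \<theta>) * (y i n x * \<Psi> i (\<lambda>j. y j n x)) + cos \<theta> * (y (K + i) n x * \<Psi> i (\<lambda>j. y j n x)))
            = (- sin \<theta>) * E (\<lambda>x. y i n x * \<Psi> i (\<lambda>j. y j n x)) + cos \<theta> * E (\<lambda>x. y (K + i) n x * \<Psi> i (\<lambda>j. y j n x))" if "i < K" for i
          by (subst E_add) (use s[OF that] in \<open>auto simp only: E_cmult intro!: sm_mult[OF sm_const]\<close>)
        then show ?thesis
          unfolding g1_eq \<Psi>_def[symmetric] using s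
          by (subst E_sum) (auto intro!: sum.cong sm_add sm_mult[OF sm_const] simp del: mult_minus_left)
      qed
      also have "\<dots> = (\<Sum>i<K. (- sin \<theta>) * (E (\<lambda>x. y i n x * \<Psi> i (\<lambda>j. y j n x)) - \<tau> i * E (\<lambda>x. D i (\<Psi> i) (\<lambda>j. y j n x)))
        + cos \<theta> * (E (\<lambda>x. y (K + i) n x * \<Psi> i (\<lambda>j. y j n x)) - \<tau> (K + i) * E (\<lambda>x. D (K + i) (\<Psi> i) (\<lambda>j. y j n x))))"
      proof (intro sum.cong refl)
        fix i assume "i \<in> {..<K}"
        then have i: "i < K" by simp
        show "(- sin \<theta>) * E (\<lambda>x. y i n x * \<Psi> i (\<lambda>j. y j n x)) + cos \<theta> * E (\<lambda>x. y (K + i) n x * \<Psi> i (\<lambda>j. y j n x))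
          = (- sin \<theta>) * (E (\<lambda>x. y i n x * \<Psi> i (\<lambda>j. y j n x)) - \<tau> i * E (\<lambda>x. D i (\<Psi> i) (\<lambda>j. y j n x)))
            + cos \<theta> * (E (\<lambda>x. y (K + i) n x * \<Psi> i (\<lambda>j. y j n x)) - \<tau> (K + i) * E (\<lambda>x. D (K + i) (\<Psi> i) (\<lambda>j. y j n x)))"
          unfolding D1[OF i] D2[OF i] \<tau>[OF i] E_cmult by (simp only: right_diff_distrib mult_minus_left) simp
      qed
      finally show ?thesis by simp
    qed
    ultimately show ?thesis by simp
  qed
  \<comment> \<open>The second-order remainder is at most a multiple of h^2 uniformly in n, so it
    survives the ultralimit while the linear term disappears; no exchange of limit and derivative is
    involved.\<close>
  have "(u has_real_derivative 0) (at \<theta>)" for \<theta>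
  proof -
    obtain B m where B: "0 \<le> B" "\<And>x. \<bar>D (2 * K) (D (2 * K) gh) x\<bar> \<le> B * (\<Prod>i\<in>?W. 1 + (x i)\<^sup>2) ^ m"
      using smooth_bound[OF smooth_D[OF smooth_D[OF smgh fW] fW] fW] by blast
    \<comment> \<open>Growth in the coordinates other than the angle; the angle stays within
      distance 1 of \<theta> and is absorbed into \<open>A\<close>.\<close>
    define R where "R x = (\<Prod>i<2 * K. 1 + (x i)\<^sup>2) ^ m" for x :: "nat \<Rightarrow> real"
    define A where "A = B * (1 + (\<bar>\<theta>\<bar> + 1)\<^sup>2) ^ m"
    have A0: "0 \<le> A" using B by (simp add: A_def)
    have R0: "0 \<le> R x" for x unfolding R_def by (intro zero_le_power prod_nonneg) auto
    have bnd: "\<bar>g (\<theta> + h) x - g \<theta> x - h * g1 \<theta> x\<bar> \<le> A * R x * h\<^sup>2" if h: "\<bar>h\<bar> \<le> 1" for h x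
    proof (rule second_order_bound[where f = "\<lambda>t. g t x" and f' = "\<lambda>t. g1 t x" and f'' = "\<lambda>t. D (2 * K) (D (2 * K) gh) (x(2 * K := t))" and a = \<theta>])
      show "((\<lambda>t. g t x) has_real_derivative g1 t x) (at t)" for t
        unfolding gh_g[symmetric] g1_def by (rule sm_DERIV) simp
      show "((\<lambda>t. g1 t x) has_real_derivative D (2 * K) (D (2 * K) gh) (x(2 * K := t))) (at t)" for t
        unfolding g1_def by (rule sm_DERIV) simp
      show "\<bar>D (2 * K) (D (2 * K) gh) (x(2 * K := t))\<bar> \<le> A * R x" if t: "\<bar>t - \<theta>\<bar> \<le> 1" for t
      proof -
        have "(\<Prod>i\<in>?W. 1 + ((x(2 * K := t)) i)\<^sup>2) = (1 + t\<^sup>2) * (\<Prod>i<2 * K. 1 + (x i)\<^sup>2)"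
        proof -
          have "(\<Prod>i<2 * K. 1 + ((x(2 * K := t)) i)\<^sup>2) = (\<Prod>i<2 * K. 1 + (x i)\<^sup>2)"
            by (rule prod.cong) auto
          then show ?thesis unfolding lessThan_Suc by simp
        qed
        then have "\<bar>D (2 * K) (D (2 * K) gh) (x(2 * K := t))\<bar> \<le> B * (1 + t\<^sup>2) ^ m * R x"
          using B(2)[of "x(2 * K := t)"] by (simp add: R_def power_mult_distrib mult_ac)
        also have "\<dots> \<le> A * R x"
        proof -
          have "t\<^sup>2 \<le> (\<bar>\<theta>\<bar> + 1)\<^sup>2" using t by (intro abs_le_square_iff[THEN iffD1]) auto
          then show ?thesis unfolding A_def using B R0
            by (intro mult_right_mono mult_left_mono power_mono) auto
        qed
        finally show ?thesis .
      qed
    qed (rule h)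
    have sR: "smooth {..<2 * K} R"
    proof -
      have "smooth {..<2 * K} (\<lambda>x. \<Prod>i\<in>S. 1 + x i * x i)" if "S \<subseteq> {..<2 * K}" for S
        using finite_subset[OF that finite_lessThan] that
        by (induction rule: finite_induct) (auto intro!: smooth.intros)
      then have "smooth {..<2 * K} (\<lambda>x. (\<Prod>i<2 * K. 1 + x i * x i) ^ l)" for l
        by (induction l) (auto intro!: smooth.intros)
      then show ?thesis by (simp add: R_def[abs_def] power2_eq_square)
    qed
    have mbR: "mb (\<lambda>n x. R (\<lambda>j. y j n x))" by (rule mb_smooth[OF sR _ yin]) simp
    then obtain C where C: "\<forall>n. nrm (\<lambda>x. R (\<lambda>j. y j n x)) \<le> C" using mb_nrm by blast
    have smg1: "smooth {..<2 * K} (g1 \<theta>)"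
      unfolding g1_eq[abs_def]
      by (intro smooth_sum smooth.intros smooth_compose[OF smooth_D[OF \<Phi> finite_lessThan] smz]) auto
    have smg1y: "sm (\<lambda>x. g1 \<theta> (\<lambda>j. y j n x))" for n by (rule sm_compose[OF smg1]) (use yin mb_sm in blast)
    have vb: "\<bar>v (\<theta> + h) n - v \<theta> n - h * E (\<lambda>x. g1 \<theta> (\<lambda>j. y j n x))\<bar> \<le> A * C * h\<^sup>2" if h: "\<bar>h\<bar> \<le> 1" for h n
    proof -
      note s = mb_sm[OF mbg] mb_sm[OF mbR] smg1y
      have "v (\<theta> + h) n - v \<theta> n - h * E (\<lambda>x. g1 \<theta> (\<lambda>j. y j n x)) = E (\<lambda>x. g (\<theta> + h) (\<lambda>j. y j n x) - g \<theta> (\<lambda>j. y j n x) - h * g1 \<theta> (\<lambda>j. y j n x))" (is "_ = E ?d")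
        unfolding v_def using s by simp
      moreover have d: "?d x \<le> (A * h\<^sup>2) * R (\<lambda>j. y j n x)" "- ?d x \<le> (A * h\<^sup>2) * R (\<lambda>j. y j n x)" for x
        using bnd[OF h, of "\<lambda>j. y j n x"] by (auto simp: abs_le_iff mult_ac)
      moreover have "E ?d \<le> E (\<lambda>x. (A * h\<^sup>2) * R (\<lambda>j. y j n x))"
        by (intro E_mono d) (use s in auto)
      moreover have "E (\<lambda>x. - ?d x) \<le> E (\<lambda>x. (A * h\<^sup>2) * R (\<lambda>j. y j n x))"
        by (intro E_mono d) (use s in auto)
      moreover have "E (\<lambda>x. (A * h\<^sup>2) * R (\<lambda>j. y j n x)) \<le> A * C * h\<^sup>2"
      proof -
        have "E (\<lambda>x. R (\<lambda>j. y j n x)) \<le> C" using E_abs_le[OF s(2), of n] C[rule_format, of n] by linarith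
        then have "(A * h\<^sup>2) * E (\<lambda>x. R (\<lambda>j. y j n x)) \<le> (A * h\<^sup>2) * C" using A0 by (intro mult_left_mono) auto
        then show ?thesis unfolding E_cmult by (simp add: mult_ac)
      qed
      ultimately show ?thesis unfolding E_minus by linarith
    qed
    have ub: "\<bar>u (\<theta> + h) - u \<theta>\<bar> \<le> A * C * h\<^sup>2" if h: "\<bar>h\<bar> \<le> 1" for h
    proof -
      have "((\<lambda>n. \<bar>v (\<theta> + h) n - v \<theta> n - h * E (\<lambda>x. g1 \<theta> (\<lambda>j. y j n x))\<bar>) \<longlongrightarrow> \<bar>u (\<theta> + h) - u \<theta> - h * 0\<bar>) U"
        by (intro tendsto_intros vu lim1)
      from tendsto_upperbound[OF this _ Unb, of "A * C * h\<^sup>2"] vb[OF h] show ?thesis by simp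
    qed
    show ?thesis
      unfolding DERIV_def
    proof (rule Lim_null_comparison)
      have "eventually (\<lambda>h::real. \<bar>h\<bar> < 1) (at 0)"
        unfolding eventually_at by (intro exI[of _ 1]) auto
      then show "\<forall>\<^sub>F h in at 0. norm ((u (\<theta> + h) - u \<theta>) / h) \<le> A * C * \<bar>h\<bar>"
      proof eventually_elim
        case (elim h)
        have "\<bar>u (\<theta> + h) - u \<theta>\<bar> \<le> (A * C * \<bar>h\<bar>) * \<bar>h\<bar>" using ub[of h] elim by (simp add: power2_eq_square mult.assoc)
        then show ?case by (cases "h = 0") (auto simp: abs_divide divide_le_eq)
      qed
      have "((\<lambda>h. A * C * \<bar>h\<bar>) \<longlongrightarrow> A * C * \<bar>0\<bar>) (at 0)" by (intro tendsto_intros)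
      then show "((\<lambda>h. A * C * \<bar>h\<bar>) \<longlongrightarrow> 0) (at (0::real))" by simp
    qed
  qed
  \<comment> \<open>The angle 0 yields the first half of the coordinates, the angle pi / 2 the
    second.\<close>
  then have "u 0 = u (pi / 2)" using DERIV_isconst_all[of u 0 "pi / 2"] by blast
  then have "((\<lambda>n. v 0 n - v (pi / 2) n) \<longlongrightarrow> 0) U"
    using tendsto_diff[OF vu[of 0] vu[of "pi / 2"]] by simp
  then show ?thesis by (simp add: v_def g_def z_def)
qed

end

section \<open>Polynomials in primes\<close>

text \<open>In the model case of independent centred Gaussians with variances \<sigma> i, the terms
  \<open>x i * T i x - \<sigma> i * D i (T i) x\<close> are orthogonal to everything free of
  \<open>x i\<close>, by Stein's identity; so g is the conditional expectation of f given the
  variables outside \<open>A\<close>. It arises by replacing a factor \<open>x i\<close> with i in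
  \<open>A\<close> by \<sigma> i times the derivative \<open>D i\<close> of its cofactor,
  recursively, which does not raise the weight.\<close>

lemma wpoly_removal:
  fixes \<sigma> :: "nat \<Rightarrow> real"
  assumes fin: "finite V" and w: "\<And>i. i \<in> V \<Longrightarrow> 1 \<le> w i" and A: "A \<subseteq> V"
  shows "wpoly w V m f \<Longrightarrow> \<exists>g T. wpoly w (V - A) m g \<and> (\<forall>i\<in>A. smooth V (T i)) \<and>
    f = (\<lambda>x. g x + (\<Sum>i\<in>A. x i * T i x - \<sigma> i * D i (T i) x))"
proof (induction m arbitrary: f rule: less_induct)
  case (less m)
  define good where "good m f \<longleftrightarrow> (\<exists>g T. wpoly w (V - A) m g \<and> (\<forall>i\<in>A. smooth V (T i)) \<and>
    f = (\<lambda>x. g x + (\<Sum>i\<in>A. x i * T i x - \<sigma> i * D i (T i) x)))" for m f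
  have fA: "finite A" using A fin finite_subset by blast
  have IH: "good k f" if "k < m" "wpoly w V k f" for k f unfolding good_def by (rule less.IH[OF that])
  have goodI: "good k f" if "wpoly w (V - A) k g" "\<And>i. i \<in> A \<Longrightarrow> smooth V (T i)"
    "\<And>x. f x = g x + (\<Sum>i\<in>A. x i * T i x - \<sigma> i * D i (T i) x)" for k f g T
    unfolding good_def using that by (intro exI[of _ g] exI[of _ T]) auto
  have goodE: "\<exists>g T. wpoly w (V - A) k g \<and> (\<forall>i\<in>A. smooth V (T i)) \<and> (\<forall>i\<in>A. sm (T i)) \<and>
    (\<forall>x. f x = g x + (\<Sum>i\<in>A. x i * T i x - \<sigma> i * D i (T i) x))" if g: "good k f" for k f
  proof -
    from g obtain g T where "wpoly w (V - A) k g" "\<forall>i\<in>A. smooth V (T i)"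
      "f = (\<lambda>x. g x + (\<Sum>i\<in>A. x i * T i x - \<sigma> i * D i (T i) x))" unfolding good_def by (elim exE conjE)
    then show ?thesis using smooth_imp_sm[OF _ fin] by (intro exI[of _ g] exI[of _ T]) auto
  qed
  have good_mono: "good k f" if g: "good j f" and le: "j \<le> k" for j k f
  proof -
    from goodE[OF g] obtain g T where "wpoly w (V - A) j g" "\<forall>i\<in>A. smooth V (T i)"
      "\<forall>x. f x = g x + (\<Sum>i\<in>A. x i * T i x - \<sigma> i * D i (T i) x)" by (elim exE conjE)
    then show ?thesis by (intro goodI[OF wpoly_mono[OF _ le]]) auto
  qed
  have good_add: "good k (\<lambda>x. f x + f' x)" if g: "good k f" and g': "good k f'" for k f f'
  proof -
    from goodE[OF g] obtain g T where 1: "wpoly w (V - A) k g" "\<forall>i\<in>A. smooth V (T i)" "\<forall>i\<in>A. sm (T i)"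
      "\<forall>x. f x = g x + (\<Sum>i\<in>A. x i * T i x - \<sigma> i * D i (T i) x)" by (elim exE conjE)
    from goodE[OF g'] obtain g' T' where 2: "wpoly w (V - A) k g'" "\<forall>i\<in>A. smooth V (T' i)" "\<forall>i\<in>A. sm (T' i)"
      "\<forall>x. f' x = g' x + (\<Sum>i\<in>A. x i * T' i x - \<sigma> i * D i (T' i) x)" by (elim exE conjE)
    show ?thesis
    proof (rule goodI[of _ "\<lambda>x. g x + g' x" "\<lambda>i x. T i x + T' i x"])
      show "wpoly w (V - A) k (\<lambda>x. g x + g' x)" by (rule wpoly_add[OF 1(1) 2(1)])
      show "smooth V (\<lambda>x. T i x + T' i x)" if "i \<in> A" for i using 1(2) 2(2) that by (intro smooth_add) auto
      have "(\<Sum>i\<in>A. x i * (T i x + T' i x) - \<sigma> i * D i (\<lambda>x. T i x + T' i x) x)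
          = (\<Sum>i\<in>A. (x i * T i x - \<sigma> i * D i (T i) x) + (x i * T' i x - \<sigma> i * D i (T' i) x))" for x
        using 1(3) 2(3) by (intro sum.cong) (auto simp: algebra_simps)
      then show "f x + f' x = g x + g' x + (\<Sum>i\<in>A. x i * (T i x + T' i x) - \<sigma> i * D i (\<lambda>x. T i x + T' i x) x)" for x
        using 1(4) 2(4) by (simp add: sum.distrib)
    qed
  qed
  have good_high: "good k (\<lambda>x. x i * f x)" if g: "good j f" and i: "i \<in> V - A" and le: "j + w i \<le> k" for i j k f
  proof -
    from goodE[OF g] obtain g T where 1: "wpoly w (V - A) j g" "\<forall>i\<in>A. smooth V (T i)" "\<forall>i\<in>A. sm (T i)"
      "\<forall>x. f x = g x + (\<Sum>i\<in>A. x i * T i x - \<sigma> i * D i (T i) x)" by (elim exE conjE)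
    show ?thesis
    proof (rule goodI[of _ "\<lambda>x. x i * g x" "\<lambda>l x. x i * T l x"])
      show "wpoly w (V - A) k (\<lambda>x. x i * g x)" by (rule wpoly_var_mult[OF i 1(1) le])
      show "smooth V (\<lambda>x. x i * T l x)" if "l \<in> A" for l using 1(2) that i by (intro smooth.intros) auto
      have "(\<Sum>l\<in>A. x l * (x i * T l x) - \<sigma> l * D l (\<lambda>x. x i * T l x) x)
          = x i * (\<Sum>l\<in>A. x l * T l x - \<sigma> l * D l (T l) x)" for x
        unfolding sum_distrib_left using 1(3) i by (intro sum.cong) (auto simp: algebra_simps)
      then show "x i * f x = x i * g x + (\<Sum>l\<in>A. x l * (x i * T l x) - \<sigma> l * D l (\<lambda>x. x i * T l x) x)" for x
        using 1(4) by (simp add: algebra_simps)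
    qed
  qed
  \<comment> \<open>The product is \<sigma> i \<open>D i f\<close> plus a Stein term; the latter is
    absorbed by adding \<open>f\<close> to \<open>T i\<close>, and the derivative is decomposed
    further.\<close>
  have good_low: "good k (\<lambda>x. x i * f x)" if f: "wpoly w V j f" and i: "i \<in> A" and g: "good k (D i f)" for i j k f
  proof -
    from goodE[OF g] obtain g T where 1: "wpoly w (V - A) k g" "\<forall>i\<in>A. smooth V (T i)" "\<forall>i\<in>A. sm (T i)"
      "\<forall>x. D i f x = g x + (\<Sum>i\<in>A. x i * T i x - \<sigma> i * D i (T i) x)" by (elim exE conjE)
    have [simp]: "sm f" using wpoly_sm[OF f fin] .
    show ?thesis
    proof (rule goodI[of _ "\<lambda>x. \<sigma> i * g x" "\<lambda>l x. \<sigma> i * T l x + (if l = i then 1 else 0) * f x"])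
      show "wpoly w (V - A) k (\<lambda>x. \<sigma> i * g x)" by (rule wpoly_cmult[OF 1(1)])
      show "smooth V (\<lambda>x. \<sigma> i * T l x + (if l = i then 1 else 0) * f x)" if "l \<in> A" for l
        using 1(2) that wpoly_smooth[OF f] by (intro smooth.intros) auto
      fix x
      have "(\<Sum>l\<in>A. x l * (\<sigma> i * T l x + (if l = i then 1 else 0) * f x) - \<sigma> l * D l (\<lambda>x. \<sigma> i * T l x + (if l = i then 1 else 0) * f x) x)
          = (\<Sum>l\<in>A. \<sigma> i * (x l * T l x - \<sigma> l * D l (T l) x) + (if l = i then x i * f x - \<sigma> i * D i f x else 0))"
        using 1(3) by (intro sum.cong) (auto simp: algebra_simps)
      also have "\<dots> = \<sigma> i * (\<Sum>l\<in>A. x l * T l x - \<sigma> l * D l (T l) x) + (x i * f x - \<sigma> i * D i f x)"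
        using i fA by (simp add: sum.distrib sum_distrib_left)
      finally show "x i * f x = \<sigma> i * g x + (\<Sum>l\<in>A. x l * (\<sigma> i * T l x + (if l = i then 1 else 0) * f x) - \<sigma> l * D l (\<lambda>x. \<sigma> i * T l x + (if l = i then 1 else 0) * f x) x)"
        using 1(4) by (simp add: algebra_simps)
    qed
  qed
  have "wpoly w V k f \<Longrightarrow> k = m \<Longrightarrow> good k f" for k f
  proof (induction rule: wpoly.induct)
    case (wpoly_const k c)
    show ?case by (rule goodI[of _ "\<lambda>x. c" "\<lambda>i x. 0"]) (auto intro: wpoly.wpoly_const smooth_const)
  next
    case (wpoly_add k f g)
    then show ?case by (intro good_add)
  next
    case (wpoly_var_mult i j f k)
    \<comment> \<open>Weights are at least 1, so the cofactor has strictly smaller weight, and the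
      outer induction applies to it and to its derivatives.\<close>
    then have j: "j < m" using w[of i] by simp
    show ?case
    proof (cases "i \<in> A")
      case True
      have "good j (D i f)" using j wpoly_D[OF wpoly_var_mult(2) fin] by (rule IH)
      then have "good k (D i f)" by (rule good_mono) (use wpoly_var_mult in simp)
      then show ?thesis by (rule good_low[OF wpoly_var_mult(2) True])
    next
      case False
      then show ?thesis
        by (intro good_high[OF IH[OF j wpoly_var_mult(2)]]) (use wpoly_var_mult in auto)
    qed
  qed
  then show ?case using less.prems unfolding good_def by blast
qed

text \<open>Each variable consumes at least s + 1 units of weight. This is the origin of the bound d
  div (s + 1).\<close>

lemma wpoly_degree:
  assumes "\<And>i. i \<in> V \<Longrightarrow> Suc s \<le> w i"
  shows "wpoly w V m f \<Longrightarrow> polyf V (m div Suc s) f"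
proof (induction rule: wpoly.induct)
  case (wpoly_var_mult i m f m')
  have "m div Suc s + 1 = (m + Suc s) div Suc s" by (subst div_add_self2) auto
  also have "\<dots> \<le> m' div Suc s" using assms[OF wpoly_var_mult(1)] wpoly_var_mult(3) by (intro div_le_mono) linarith
  finally show ?case using wpoly_var_mult by (intro wpoly.wpoly_var_mult) auto
qed (auto intro: wpoly_const wpoly_add)

lemma wpoly_scale: "wpoly w V m f \<Longrightarrow> wpoly w V m (\<lambda>x. f (\<lambda>i. c i * x i))"
proof (induction rule: wpoly.induct)
  case (wpoly_var_mult i m f m')
  have "wpoly w V m' (\<lambda>x. x i * (c i * f (\<lambda>i. c i * x i)))"
    using wpoly_var_mult by (intro wpoly.wpoly_var_mult wpoly_cmult)
  then show ?case by (simp add: mult_ac)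
qed (auto intro: wpoly_const wpoly_add)

context gaussian_family begin

text \<open>\<open>rotation\<close> is applied to sequences that do not depend on n, so any
  ultrafilter will do. The inequality keeps the two blocks of variables disjoint.\<close>

lemma E_shift:
  assumes \<Phi>: "smooth {..<K} \<Phi>" and pq: "p + K \<le> q"
  shows "E (\<lambda>x. \<Phi> (\<lambda>i. s i * x (p + i))) = E (\<lambda>x. \<Phi> (\<lambda>i. s i * x (q + i)))"
proof -
  obtain U :: "nat filter" where U: "ultra U" using ultra_exists[of sequentially] by auto
  then have Unb: "U \<noteq> bot" by (simp add: ultra_def)
  define ix where "ix j = (if j < K then p + j else q + (j - K))" for j
  define c where "c j = (if j < K then s j else s (j - K))" for j
  define y :: "nat \<Rightarrow> nat \<Rightarrow> (nat \<Rightarrow> real) \<Rightarrow> real" where "y j n x = c j * x (ix j)" for j n x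
  have inj: "ix i = ix j \<longleftrightarrow> i = j" if "i < 2 * K" "j < 2 * K" for i j
    using that pq by (auto simp: ix_def)
  have [simp]: "sm (y j n)" for j n unfolding y_def[abs_def] by auto
  have "((\<lambda>n. E (\<lambda>x. \<Phi> (\<lambda>i. y i n x)) - E (\<lambda>x. \<Phi> (\<lambda>i. y (K + i) n x))) \<longlongrightarrow> 0) U"
  proof (rule rotation[where \<tau> = "\<lambda>j. (c j)\<^sup>2", OF U _ _ _ \<Phi>])
    show "mb (y j)" for j unfolding y_def[abs_def] by (intro mb_mult mb_const mb_var)
    show "(c (K + i))\<^sup>2 = (c i)\<^sup>2" if "i < K" for i using that by (simp add: c_def)
    fix i \<Psi> assume i: "i < 2 * K" and \<Psi>: "smooth {..<2 * K} \<Psi>"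
    have "E (\<lambda>x. y i n x * \<Psi> (\<lambda>j. y j n x)) = (c i)\<^sup>2 * E (\<lambda>x. D i \<Psi> (\<lambda>j. y j n x))" for n
    proof -
      have "E (\<lambda>x. y i n x * \<Psi> (\<lambda>j. y j n x)) = c i * E (\<lambda>x. x (ix i) * \<Psi> (\<lambda>j. y j n x))"
        unfolding y_def mult.assoc by simp
      also have "E (\<lambda>x. x (ix i) * \<Psi> (\<lambda>j. y j n x)) = E (D (ix i) (\<lambda>x. \<Psi> (\<lambda>j. y j n x)))"
        by (rule E_ibp) (rule sm_compose[OF \<Psi>], simp)
      also have "D (ix i) (\<lambda>x. \<Psi> (\<lambda>j. y j n x)) = (\<lambda>x. c i * D i \<Psi> (\<lambda>j. y j n x))"
      proof
        fix x
        have "D (ix i) (\<lambda>x. \<Psi> (\<lambda>j. y j n x)) x = (\<Sum>j<2 * K. D j \<Psi> (\<lambda>j. y j n x) * D (ix i) (y j n) x)"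
          by (rule fun_cong[OF D_compose[OF \<Psi>]]) auto
        also have "\<dots> = (\<Sum>j<2 * K. if j = i then c i * D i \<Psi> (\<lambda>j. y j n x) else 0)"
        proof (rule sum.cong)
          fix j assume "j \<in> {..<2 * K}"
          then have "D (ix i) (y j n) x = (if j = i then c i else 0)"
            unfolding y_def[abs_def] using inj[OF i, of j] by simp
          then show "D j \<Psi> (\<lambda>j. y j n x) * D (ix i) (y j n) x = (if j = i then c i * D i \<Psi> (\<lambda>j. y j n x) else 0)" by simp
        qed simp
        also have "\<dots> = c i * D i \<Psi> (\<lambda>j. y j n x)" using i by simp
        finally show "D (ix i) (\<lambda>x. \<Psi> (\<lambda>j. y j n x)) x = c i * D i \<Psi> (\<lambda>j. y j n x)" .
      qed
      finally show ?thesis by (simp add: power2_eq_square)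
    qed
    then show "((\<lambda>n. E (\<lambda>x. y i n x * \<Psi> (\<lambda>j. y j n x)) - (c i)\<^sup>2 * E (\<lambda>x. D i \<Psi> (\<lambda>j. y j n x))) \<longlongrightarrow> 0) U" by simp
  qed
  moreover have "\<Phi> (\<lambda>i. y i n x) = \<Phi> (\<lambda>i. s i * x (p + i))" for n x
    by (rule smooth_cong_on[OF \<Phi>]) (auto simp: y_def c_def ix_def)
  moreover have "\<Phi> (\<lambda>i. y (K + i) n x) = \<Phi> (\<lambda>i. s i * x (q + i))" for n x
    by (rule smooth_cong_on[OF \<Phi>]) (auto simp: y_def c_def ix_def)
  ultimately have "((\<lambda>n::nat. E (\<lambda>x. \<Phi> (\<lambda>i. s i * x (p + i))) - E (\<lambda>x. \<Phi> (\<lambda>i. s i * x (q + i)))) \<longlongrightarrow> 0) U" by simp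
  then show ?thesis using tendsto_unique[OF Unb tendsto_const] by force
qed

end

context gaussian_ultra begin

section \<open>Orthogonal systems of primes and their Gaussian limits\<close>

definition sys where
  "sys (K::nat) e w \<longleftrightarrow> (\<forall>i<K. prime (w i) (e i)) \<and> (\<forall>i<K. \<forall>j<K. i \<noteq> j \<longrightarrow> ip (e i) (e j) = 0)"

text \<open>The standard deviation of coordinate i in the limit; it is 0 for a null
  sequence.\<close>

definition scl where "scl e i = sqrt (ip (e i) (e i))"

lemma prime_mb: assumes "prime k Y" shows "mb Y"
proof -
  obtain C where C: "\<And>n. nrm (Y n) \<le> C" using bd_bound[OF prime_bd[OF assms]] by metis
  show ?thesis
    by (rule mb_polyf[of V k Y C]) (use prime_bd[OF assms] C in \<open>auto simp: bd_def\<close>)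
qed

text \<open>Orthogonality of the system leaves only the diagonal term of \<open>stein\<close>. The
  coordinates from K on are further families that decouple from \<open>e i\<close> in the limit:
  fresh Gaussians in \<open>gauss_limit\<close>, the sequence \<open>F\<close> in
  \<open>remove_low_primes\<close>.\<close>

lemma sys_stein:
  assumes sys: "sys K e w" and i: "i < K" and KL: "K \<le> L"
    and y: "\<And>j. j < K \<Longrightarrow> y j = e j" "\<And>j. K \<le> j \<Longrightarrow> j < L \<Longrightarrow> mb (y j)"
    and Gm: "\<And>j. K \<le> j \<Longrightarrow> j < L \<Longrightarrow> ((\<lambda>n. nrm (Gam (V n) (e i n) (y j n))) \<longlongrightarrow> 0) U"
    and \<Psi>: "smooth {..<L} \<Psi>"
  shows "((\<lambda>n. E (\<lambda>x. e i n x * \<Psi> (\<lambda>j. y j n x)) - ip (e i) (e i) * E (\<lambda>x. D i \<Psi> (\<lambda>j. y j n x))) \<longlongrightarrow> 0) U"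
proof -
  have pr: "prime (w j) (e j)" if "j < K" for j using sys that by (simp add: sys_def)
  define c where "c j = (if j < K then real (w i) * ip (e i) (e j) else 0)" for j
  have wi: "1 \<le> w i" "bdch (w i) (e i)" using pr[OF i] by (auto simp: prime_def)
  have "((\<lambda>n. E (\<lambda>x. e i n x * \<Psi> (\<lambda>j. y j n x)) - (\<Sum>j<L. c j / real (w i) * E (\<lambda>x. D j \<Psi> (\<lambda>j. y j n x)))) \<longlongrightarrow> 0) U"
  proof (rule stein)
    show "chaos (V n) (w i) (e i n)" for n using wi by (simp add: bdch_def)
    show "mb (y j)" if "j \<in> {..<L}" for j
      using that y prime_mb[OF pr] by (cases "j < K") auto
    show "((\<lambda>n. nrm (\<lambda>x. Gam (V n) (e i n) (y j n) x - c j)) \<longlongrightarrow> 0) U" if "j \<in> {..<L}" for j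
    proof (cases "j < K")
      case True
      then show ?thesis using prime_Gam_tendsto[OF pr[OF i] pr[OF True]] by (simp add: c_def y)
    next
      case False
      then show ?thesis using Gm[of j] that by (simp add: c_def)
    qed
  qed (use wi \<Psi> in auto)
  moreover have "(\<Sum>j<L. c j / real (w i) * E (\<lambda>x. D j \<Psi> (\<lambda>j. y j n x))) = ip (e i) (e i) * E (\<lambda>x. D i \<Psi> (\<lambda>j. y j n x))" for n
  proof -
    have "(\<Sum>j<L. c j / real (w i) * E (\<lambda>x. D j \<Psi> (\<lambda>j. y j n x))) = (\<Sum>j<L. if j = i then ip (e i) (e i) * E (\<lambda>x. D i \<Psi> (\<lambda>j. y j n x)) else 0)"
    proof (rule sum.cong)
      fix j
      have "c j / real (w i) = (if j = i then ip (e i) (e i) else 0)"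
        using wi(1) i sys by (auto simp: c_def sys_def)
      then show "c j / real (w i) * E (\<lambda>x. D j \<Psi> (\<lambda>j. y j n x)) = (if j = i then ip (e i) (e i) * E (\<lambda>x. D i \<Psi> (\<lambda>j. y j n x)) else 0)"
        by simp
    qed simp
    then show ?thesis using i KL by simp
  qed
  ultimately show ?thesis by simp
qed

text \<open>At stage n the primes are compared with Gaussians of equal variances in variables
  outside \<open>V n\<close>. The joint family satisfies Stein's identity: asymptotically for the
  primes, whose carre du champ with a fresh variable is 0, and exactly for the fresh variables. So
  \<open>rotation\<close> carries one half to the other.\<close>

lemma gauss_limit:
  assumes sys: "sys K e w" and \<Phi>: "smooth {..<K} \<Phi>"
  shows "((\<lambda>n. E (\<lambda>x. \<Phi> (\<lambda>i. e i n x))) \<longlongrightarrow> E (\<lambda>x. \<Phi> (\<lambda>i. scl e i * x i))) U"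
proof -
  have pr: "prime (w j) (e j)" if "j < K" for j using sys that by (simp add: sys_def)
  have "\<exists>N. V n \<subseteq> {..<N}" for n using finite_nat_set_iff_bounded[of "V n"] by auto
  then obtain N where N: "\<And>n. V n \<subseteq> {..<N n}" by metis
  have sme: "sm (e j n)" "smooth (V n) (e j n)" if "j < K" for j n
  proof -
    note b = prime_bd[OF pr[OF that]]
    show "sm (e j n)" by (rule bd_sm[OF b])
    have "polyf (V n) (w j) (e j n)" using b by (simp add: bd_def)
    then show "smooth (V n) (e j n)" by (rule wpoly_smooth)
  qed
  have scl2: "scl e i * scl e i = ip (e i) (e i)" if "i < K" for i
    using ip_nonneg[OF prime_bd[OF pr[OF that]]] by (simp add: scl_def)
  define y where "y j = (if j < K then e j else (\<lambda>n x. scl e (j - K) * x (N n + (j - K))))" for j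
  define \<tau> where "\<tau> j = (if j < K then ip (e j) (e j) else ip (e (j - K)) (e (j - K)))" for j
  have yK: "y j = (\<lambda>n x. scl e (j - K) * x (N n + (j - K)))" if "K \<le> j" for j using that by (simp add: y_def)
  have smy: "sm (y j n)" if "j < 2 * K" for j n
    using that sme by (cases "j < K") (auto simp: y_def)
  have mby: "mb (y j)" if "K \<le> j" for j
    unfolding yK[OF that] by (intro mb_mult mb_const mb_var)
  have "((\<lambda>n. E (\<lambda>x. \<Phi> (\<lambda>i. y i n x)) - E (\<lambda>x. \<Phi> (\<lambda>i. y (K + i) n x))) \<longlongrightarrow> 0) U"
  proof (rule rotation[where \<tau> = \<tau>, OF ultra _ _ _ \<Phi>])
    show "mb (y j)" if "j < 2 * K" for j
      using prime_mb[OF pr] mby by (cases "j < K") (auto simp: y_def)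
    show "\<tau> (K + i) = \<tau> i" if "i < K" for i using that by (simp add: \<tau>_def)
    fix i \<Psi> assume i: "i < 2 * K" and \<Psi>: "smooth {..<2 * K} \<Psi>"
    show "((\<lambda>n. E (\<lambda>x. y i n x * \<Psi> (\<lambda>j. y j n x)) - \<tau> i * E (\<lambda>x. D i \<Psi> (\<lambda>j. y j n x))) \<longlongrightarrow> 0) U"
    proof (cases "i < K")
      case True
      have "((\<lambda>n. E (\<lambda>x. e i n x * \<Psi> (\<lambda>j. y j n x)) - ip (e i) (e i) * E (\<lambda>x. D i \<Psi> (\<lambda>j. y j n x))) \<longlongrightarrow> 0) U"
      proof (rule sys_stein[OF sys True _ _ mby _ \<Psi>])
        show "((\<lambda>n. nrm (Gam (V n) (e i n) (y j n))) \<longlongrightarrow> 0) U" if "K \<le> j" "j < 2 * K" for j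
        proof -
          have "Gam (V n) (e i n) (y j n) = (\<lambda>x. 0)" for n
            unfolding Gam_def[abs_def] yK[OF that(1)] using N[of n] by (auto intro!: ext sum.neutral)
          then show ?thesis by simp
        qed
      qed (auto simp: y_def)
      then show ?thesis using True by (simp add: y_def \<tau>_def)
    next
      case False
      then obtain l where l: "i = K + l" "l < K" using i by (metis add_diff_inverse_nat nat_add_left_cancel_less mult_2)
      have "E (\<lambda>x. y i n x * \<Psi> (\<lambda>j. y j n x)) = \<tau> i * E (\<lambda>x. D i \<Psi> (\<lambda>j. y j n x))" for n
      proof -
        have "E (\<lambda>x. y i n x * \<Psi> (\<lambda>j. y j n x)) = scl e l * E (\<lambda>x. x (N n + l) * \<Psi> (\<lambda>j. y j n x))"
          using yK[of i] l by (simp add: mult.assoc)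
        also have "E (\<lambda>x. x (N n + l) * \<Psi> (\<lambda>j. y j n x)) = E (D (N n + l) (\<lambda>x. \<Psi> (\<lambda>j. y j n x)))"
          by (rule E_ibp) (rule sm_compose[OF \<Psi>], use smy in simp)
        also have "D (N n + l) (\<lambda>x. \<Psi> (\<lambda>j. y j n x)) = (\<lambda>x. scl e l * D i \<Psi> (\<lambda>j. y j n x))"
        proof
          fix x
          have "D (N n + l) (\<lambda>x. \<Psi> (\<lambda>j. y j n x)) x = (\<Sum>j<2 * K. D j \<Psi> (\<lambda>j. y j n x) * D (N n + l) (y j n) x)"
            by (rule fun_cong[OF D_compose[OF \<Psi>]]) (use smy in auto)
          also have "\<dots> = (\<Sum>j<2 * K. if j = i then scl e l * D i \<Psi> (\<lambda>j. y j n x) else 0)"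
          proof (rule sum.cong)
            fix j assume "j \<in> {..<2 * K}"
            have "D (N n + l) (y j n) x = (if j = i then scl e l else 0)"
            proof (cases "j < K")
              case True
              have "N n + l \<notin> V n" using N[of n] by auto
              then have "D (N n + l) (e j n) = (\<lambda>x. 0)" by (rule D_outside[OF sme(2)[OF True]])
              then show ?thesis using True l by (simp add: y_def)
            next
              case False
              then show ?thesis using yK[of j] l by auto
            qed
            then show "D j \<Psi> (\<lambda>j. y j n x) * D (N n + l) (y j n) x = (if j = i then scl e l * D i \<Psi> (\<lambda>j. y j n x) else 0)" by simp
          qed simp
          also have "\<dots> = scl e l * D i \<Psi> (\<lambda>j. y j n x)" using i by simp
          finally show "D (N n + l) (\<lambda>x. \<Psi> (\<lambda>j. y j n x)) x = scl e l * D i \<Psi> (\<lambda>j. y j n x)" .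
        qed
        finally show ?thesis using l scl2[OF l(2)] by (simp add: \<tau>_def mult.assoc[symmetric])
      qed
      then show ?thesis by simp
    qed
  qed
  moreover have "\<Phi> (\<lambda>i. y i n x) = \<Phi> (\<lambda>i. e i n x)" for n x
    by (rule smooth_cong_on[OF \<Phi>]) (auto simp: y_def)
  moreover have "E (\<lambda>x. \<Phi> (\<lambda>i. y (K + i) n x)) = E (\<lambda>x. \<Phi> (\<lambda>i. scl e i * x i))" for n
  proof -
    have "E (\<lambda>x. \<Phi> (\<lambda>i. y (K + i) n x)) = E (\<lambda>x. \<Phi> (\<lambda>i. scl e i * x (N n + i)))" using yK by simp
    \<comment> \<open>\<open>E_shift\<close> needs disjoint blocks, while the blocks starting at 0
      and at \<open>N n\<close> may overlap; hence the detour.\<close>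
    also have "\<dots> = E (\<lambda>x. \<Phi> (\<lambda>i. scl e i * x (N n + K + i)))" by (rule E_shift[OF \<Phi>]) simp
    also have "\<dots> = E (\<lambda>x. \<Phi> (\<lambda>i. scl e i * x (0 + i)))" by (rule E_shift[OF \<Phi>, symmetric]) simp
    finally show ?thesis by simp
  qed
  ultimately have "((\<lambda>n. E (\<lambda>x. \<Phi> (\<lambda>i. e i n x)) - E (\<lambda>x. \<Phi> (\<lambda>i. scl e i * x i))) \<longlongrightarrow> 0) U" by simp
  then show ?thesis by (simp add: LIM_zero_iff)
qed

lemma sys_bd:
  assumes "sys K e w"
  shows "wpoly w {..<K} m f \<Longrightarrow> bd m (\<lambda>n x. f (\<lambda>i. e i n x))"
proof (induction rule: wpoly.induct)
  case (wpoly_const m c)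
  show ?case by (rule bd_const)
next
  case (wpoly_add m f g)
  show ?case by (rule bd_add[OF wpoly_add(3,4)])
next
  case (wpoly_var_mult i m f m')
  have "prime (w i) (e i)" using assms wpoly_var_mult(1) by (simp add: sys_def)
  then have "bd (w i + m) (\<lambda>n x. e i n x * f (\<lambda>i. e i n x))" by (intro bd_mult prime_bd wpoly_var_mult(4))
  then show ?case by (rule bd_mono) (use wpoly_var_mult(3) in simp)
qed

text \<open>Primes of order at most \<open>s\<close> can be removed: \<open>F\<close> is orthogonal to everything of the form
  \<open>e\<^sub>i T - \<sigma>\<^sub>i \<partial>\<^sub>i T\<close>, hence to the part of \<open>f(e)\<close> that involves such primes.\<close>

lemma remove_low_primes:
  assumes sys: "sys K e w" and f: "wpoly w {..<K} m f" and F: "bdch d F" and s: "s < d"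
    and sml: "\<forall>\<^sub>F n in U. 0 \<le> \<epsilon> n \<and> small (V n) d s (\<epsilon> n) (F n)" "(\<epsilon> \<longlongrightarrow> 0) U"
  shows "\<exists>g. wpoly w {i. i < K \<and> s < w i} m g \<and>
    dist_sq F (\<lambda>n x. g (\<lambda>i. e i n x))
      \<le> dist_sq F (\<lambda>n x. f (\<lambda>i. e i n x))"
proof -
  have pr: "prime (w j) (e j)" if "j < K" for j using sys that by (simp add: sys_def)
  define A where "A = {i. i < K \<and> w i \<le> s}"
  have hi: "{..<K} - A = {i. i < K \<and> s < w i}" by (auto simp: A_def)
  have w1: "1 \<le> w i" if "i \<in> {..<K}" for i using pr[of i] that by (simp add: prime_def)
  have AK: "A \<subseteq> {..<K}" by (auto simp: A_def)
  \<comment> \<open>With the limit variances as \<sigma>, the difference of \<open>f\<close> and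
    \<open>g\<close> becomes a sum of Stein terms in the low primes.\<close>
  have "\<exists>g T. wpoly w ({..<K} - A) m g \<and> (\<forall>i\<in>A. smooth {..<K} (T i)) \<and>
    f = (\<lambda>x. g x + (\<Sum>i\<in>A. x i * T i x - ip (e i) (e i) * D i (T i) x))"
    by (rule wpoly_removal[OF finite_lessThan w1 AK f])
  then obtain g T where g: "wpoly w ({..<K} - A) m g" and T: "\<forall>i\<in>A. smooth {..<K} (T i)"
    and fg: "f = (\<lambda>x. g x + (\<Sum>i\<in>A. x i * T i x - ip (e i) (e i) * D i (T i) x))" by (elim exE conjE)
  have g': "wpoly w {..<K} m g" by (rule wpoly_subset[OF g]) auto
  note bF = bdch_bd[OF F]
  note bf = sys_bd[OF sys f] and bg = sys_bd[OF sys g']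
  have bFg: "bd (d + m) (\<lambda>n x. F n x - g (\<lambda>i. e i n x))"
    by (rule bd_diff[OF bd_mono[OF bF] bd_mono[OF bg]]) auto
  note bB = bd_diff[OF bf bg]
  have sme: "sm (e j n)" if "j < K" for j n using prime_bd[OF pr[OF that]] bd_sm by blast
  have [simp]: "sm (F n)" for n using bd_sm[OF bF] .
  have smT: "sm (\<lambda>x. T i (\<lambda>j. e j n x))" "sm (\<lambda>x. D i (T i) (\<lambda>j. e j n x))" if "i \<in> A" for i n
  proof -
    have Ti: "smooth {..<K} (T i)" using T that by blast
    show "sm (\<lambda>x. T i (\<lambda>j. e j n x))" by (rule sm_compose[OF Ti]) (use sme in simp)
    show "sm (\<lambda>x. D i (T i) (\<lambda>j. e j n x))" by (rule sm_compose[OF smooth_D[OF Ti]]) (use sme in simp_all)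
  qed
  \<comment> \<open>\<open>F\<close> will be inserted as an extra coordinate with index K, so the
    test function is that coordinate times \<open>T i\<close>.\<close>
  have smooth_ev: "smooth {..<Suc K} (\<lambda>x. x K * T i x)" if "i \<in> A" for i
  proof -
    have Ti: "smooth {..<Suc K} (T i)" by (rule smooth_mono[of "{..<K}"]) (use T that in auto)
    show ?thesis by (intro smooth_mult smooth_var Ti) simp
  qed
  have B_eq: "f (\<lambda>i. e i n x) - g (\<lambda>i. e i n x) = (\<Sum>i\<in>A. e i n x * T i (\<lambda>j. e j n x) - ip (e i) (e i) * D i (T i) (\<lambda>j. e j n x))" for n x
    by (simp add: fg)
  have perp: "ip H (\<lambda>n x. f (\<lambda>i. e i n x) - g (\<lambda>i. e i n x)) = 0"
    if H: "\<And>n. sm (H n)" and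
      lim: "\<And>i. i \<in> A \<Longrightarrow> ((\<lambda>n. E (\<lambda>x. e i n x * (H n x * T i (\<lambda>j. e j n x))) - ip (e i) (e i) * E (\<lambda>x. H n x * D i (T i) (\<lambda>j. e j n x))) \<longlongrightarrow> 0) U" for H
  proof (rule ip_eqI)
    have "((\<lambda>n. \<Sum>i\<in>A. E (\<lambda>x. e i n x * (H n x * T i (\<lambda>j. e j n x))) - ip (e i) (e i) * E (\<lambda>x. H n x * D i (T i) (\<lambda>j. e j n x))) \<longlongrightarrow> (\<Sum>i\<in>A. 0)) U"
      by (intro tendsto_sum lim)
    moreover have "E (\<lambda>x. H n x * (f (\<lambda>i. e i n x) - g (\<lambda>i. e i n x)))
      = (\<Sum>i\<in>A. E (\<lambda>x. e i n x * (H n x * T i (\<lambda>j. e j n x))) - ip (e i) (e i) * E (\<lambda>x. H n x * D i (T i) (\<lambda>j. e j n x)))" for n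
    proof -
      have "E (\<lambda>x. H n x * (f (\<lambda>i. e i n x) - g (\<lambda>i. e i n x)))
          = E (\<lambda>x. \<Sum>i\<in>A. e i n x * (H n x * T i (\<lambda>j. e j n x)) - ip (e i) (e i) * (H n x * D i (T i) (\<lambda>j. e j n x)))"
        unfolding B_eq sum_distrib_left by (simp add: algebra_simps)
      also have "\<dots> = (\<Sum>i\<in>A. E (\<lambda>x. e i n x * (H n x * T i (\<lambda>j. e j n x)) - ip (e i) (e i) * (H n x * D i (T i) (\<lambda>j. e j n x))))"
        using smT H sme AK by (intro E_sum sm_diff sm_mult sm_const) auto
      also have "\<dots> = (\<Sum>i\<in>A. E (\<lambda>x. e i n x * (H n x * T i (\<lambda>j. e j n x))) - ip (e i) (e i) * E (\<lambda>x. H n x * D i (T i) (\<lambda>j. e j n x)))"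
      proof (rule sum.cong)
        fix i assume i: "i \<in> A"
        then have "i < K" using AK by auto
        then show "E (\<lambda>x. e i n x * (H n x * T i (\<lambda>j. e j n x)) - ip (e i) (e i) * (H n x * D i (T i) (\<lambda>j. e j n x)))
           = E (\<lambda>x. e i n x * (H n x * T i (\<lambda>j. e j n x))) - ip (e i) (e i) * E (\<lambda>x. H n x * D i (T i) (\<lambda>j. e j n x))"
          using smT[OF i] H sme by (subst E_diff) auto
      qed simp
      finally show ?thesis .
    qed
    ultimately show "((\<lambda>n. E (\<lambda>x. H n x * (f (\<lambda>i. e i n x) - g (\<lambda>i. e i n x)))) \<longlongrightarrow> 0) U" by simp
  qed
  have pF: "ip F (\<lambda>n x. f (\<lambda>i. e i n x) - g (\<lambda>i. e i n x)) = 0"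
  proof (rule perp)
    fix i assume iA: "i \<in> A"
    then have i: "i < K" "w i \<le> s" by (auto simp: A_def)
    define y where "y j = (if j < K then e j else F)" for j
    have [simp]: "sm (T i)" using T iA smooth_imp_sm by blast
    have "((\<lambda>n. nrm (Gam (V n) (F n) (e i n))) \<longlongrightarrow> 0) U"
    proof -
      \<comment> \<open>The orders satisfy w i \<le> s < d, so the limit of the carre du champ, a
        multiple of this inner product, is 0.\<close>
      have "ip F (e i) = 0" using bdch_orth[OF F, of "w i" "e i"] pr[OF i(1)] i(2) s by (simp add: prime_def)
      then show ?thesis
        using small_Gam_tendsto[OF F _ _ _ _ sml, of "w i" "e i"] pr[OF i(1)] i(2) s by (simp add: prime_def)
    qed
    then have G0: "((\<lambda>n. nrm (Gam (V n) (e i n) (F n))) \<longlongrightarrow> 0) U" by (simp add: Gam_commute)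
    have mF: "mb F"
    proof -
      obtain C where C: "\<And>n. nrm (F n) \<le> C" using bd_bound[OF bF] by metis
      show ?thesis by (rule mb_polyf[of V d F C]) (use bF C in \<open>auto simp: bd_def\<close>)
    qed
    have "((\<lambda>n. E (\<lambda>x. e i n x * (\<lambda>x. x K * T i x) (\<lambda>j. y j n x)) - ip (e i) (e i) * E (\<lambda>x. D i (\<lambda>x. x K * T i x) (\<lambda>j. y j n x))) \<longlongrightarrow> 0) U"
      by (rule sys_stein[OF sys i(1) _ _ _ _ smooth_ev[OF iA]]) (use mF G0 in \<open>auto simp: y_def\<close>)
    moreover have "T i (\<lambda>j. y j n x) = T i (\<lambda>j. e j n x)" "D i (T i) (\<lambda>j. y j n x) = D i (T i) (\<lambda>j. e j n x)" for n x
    proof -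
      have Ti: "smooth {..<K} (T i)" using T iA by blast
      show "T i (\<lambda>j. y j n x) = T i (\<lambda>j. e j n x)" by (rule smooth_cong_on[OF Ti]) (simp add: y_def)
      show "D i (T i) (\<lambda>j. y j n x) = D i (T i) (\<lambda>j. e j n x)"
        by (rule smooth_cong_on[OF smooth_D[OF Ti]]) (simp_all add: y_def)
    qed
    moreover have "D i (\<lambda>x. x K * T i x) = (\<lambda>x. x K * D i (T i) x)" using i by simp
    moreover have "y K = F" by (simp add: y_def)
    ultimately show "((\<lambda>n. E (\<lambda>x. e i n x * (F n x * T i (\<lambda>j. e j n x))) - ip (e i) (e i) * E (\<lambda>x. F n x * D i (T i) (\<lambda>j. e j n x))) \<longlongrightarrow> 0) U"
      by simp
  qed simp
  have pg: "ip (\<lambda>n x. g (\<lambda>i. e i n x)) (\<lambda>n x. f (\<lambda>i. e i n x) - g (\<lambda>i. e i n x)) = 0"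
  proof (rule perp)
    show "sm (\<lambda>x. g (\<lambda>i. e i n x))" for n using bd_sm[OF bg] .
    fix i assume iA: "i \<in> A"
    then have i: "i < K" by (auto simp: A_def)
    have sg: "smooth ({..<K} - A) g" "sm g" using wpoly_smooth[OF g] wpoly_sm[OF g] by auto
    have [simp]: "sm (T i)" using T iA smooth_imp_sm by blast
    have "smooth {..<K} (\<lambda>x. g x * T i x)" using T iA wpoly_smooth[OF g'] by (intro smooth.intros) auto
    then have "((\<lambda>n. E (\<lambda>x. e i n x * (\<lambda>x. g x * T i x) (\<lambda>j. e j n x)) - ip (e i) (e i) * E (\<lambda>x. D i (\<lambda>x. g x * T i x) (\<lambda>j. e j n x))) \<longlongrightarrow> 0) U"
      by (intro sys_stein[OF sys i order_refl]) auto
    moreover have "D i (\<lambda>x. g x * T i x) = (\<lambda>x. g x * D i (T i) x)"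
      using D_outside[OF sg(1), of i] iA sg(2) by simp
    ultimately show "((\<lambda>n. E (\<lambda>x. e i n x * (g (\<lambda>i. e i n x) * T i (\<lambda>j. e j n x))) - ip (e i) (e i) * E (\<lambda>x. g (\<lambda>i. e i n x) * D i (T i) (\<lambda>j. e j n x))) \<longlongrightarrow> 0) U"
      by simp
  qed
  \<comment> \<open>The difference of f and g, evaluated at e, is orthogonal to F and to g, hence to
    F - g; Pythagoras then shows that passing from f to g does not increase the distance to
    F.\<close>
  have "ip (\<lambda>n x. F n x - g (\<lambda>i. e i n x)) (\<lambda>n x. f (\<lambda>i. e i n x) - g (\<lambda>i. e i n x)) = 0"
    using ip_diff_right[OF bB bF bg] pF pg unfolding ip_commute[of "\<lambda>n x. f (\<lambda>i. e i n x) - g (\<lambda>i. e i n x)"] by simp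
  then have "ip (\<lambda>n x. F n x - g (\<lambda>i. e i n x) - (f (\<lambda>i. e i n x) - g (\<lambda>i. e i n x))) (\<lambda>n x. F n x - g (\<lambda>i. e i n x) - (f (\<lambda>i. e i n x) - g (\<lambda>i. e i n x)))
      = dist_sq F (\<lambda>n x. g (\<lambda>i. e i n x)) + ip (\<lambda>n x. f (\<lambda>i. e i n x) - g (\<lambda>i. e i n x)) (\<lambda>n x. f (\<lambda>i. e i n x) - g (\<lambda>i. e i n x))"
    using ip_diff_diff[OF bFg bB] by simp
  then have "dist_sq F (\<lambda>n x. g (\<lambda>i. e i n x)) \<le> dist_sq F (\<lambda>n x. f (\<lambda>i. e i n x))"
    using ip_nonneg[OF bB] by simp
  then show ?thesis using g unfolding hi by (intro exI[of _ g]) simp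
qed

lemma prime_lincomb:
  assumes Y: "prime k Y" and Z: "\<And>i. i \<in> A \<Longrightarrow> prime k (Z i)"
  shows "prime k (\<lambda>n x. Y n x - (\<Sum>i\<in>A. c i * Z i n x))"
  unfolding prime_def
proof (intro conjI allI impI)
  let ?Y = "\<lambda>n x. Y n x - (\<Sum>i\<in>A. c i * Z i n x)"
  show "1 \<le> k" using Y by (simp add: prime_def)
  have bS: "bd k (\<lambda>n x. \<Sum>i\<in>A. c i * Z i n x)" by (intro bd_sum bd_cmult prime_bd Z)
  note b = bd_diff[OF prime_bd[OF Y] bS]
  have chZ: "chaos (V n) k (Z i n)" if "i \<in> A" for i n using Z[OF that] by (simp add: prime_def bdch_def)
  have chY: "chaos (V n) k (Y n)" for n using Y by (simp add: prime_def bdch_def)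
  have "chaos (V n) k (?Y n)" for n
    by (intro chaos_diff[OF fin_V chY] chaos_sum[OF fin_V] chaos_cmult[OF fin_V] chZ)
  then show "bdch k ?Y" using b by (simp add: bdch_def bd_def)
  fix i P Q assume i: "1 \<le> i" "i < k" and P: "bdch i P" and Q: "bdch (k - i) Q"
  let ?W = "\<lambda>n x. P n x * Q n x"
  note bW = bd_mult[OF bdch_bd[OF P] bdch_bd[OF Q]]
  have zY: "ip ?W Y = 0" unfolding ip_commute[of _ Y] using Y i P Q by (simp add: prime_def)
  have zZ: "ip ?W (Z j) = 0" if "j \<in> A" for j
    unfolding ip_commute[of _ "Z j"] using Z[OF that] i P Q by (simp add: prime_def)
  have "ip ?W (\<lambda>n x. \<Sum>j\<in>A. c j * Z j n x) = (\<Sum>j\<in>A. ip ?W (\<lambda>n x. c j * Z j n x))"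
    by (rule ip_sum_right[OF bW bd_cmult[OF prime_bd[OF Z]]])
  also have "\<dots> = 0"
  proof (intro sum.neutral ballI)
    fix j assume j: "j \<in> A"
    show "ip ?W (\<lambda>n x. c j * Z j n x) = 0" unfolding ip_cmult_right[OF bW prime_bd[OF Z[OF j]]] zZ[OF j] by simp
  qed
  finally show "ip ?Y ?W = 0"
    unfolding ip_commute[of ?Y] ip_diff_right[OF bW prime_bd[OF Y] bS] using zY by simp
qed

section \<open>Nested systems and the representation of polynomials in primes\<close>

definition extends where
  "extends (K::nat) e w (K'::nat) e' w' \<longleftrightarrow> K \<le> K' \<and> (\<forall>i<K. e' i = e i \<and> w' i = w i)"

lemma extends_refl: "extends K e w K e w" by (simp add: extends_def)

lemma extends_trans: "extends K e w K' e' w' \<Longrightarrow> extends K' e' w' K'' e'' w'' \<Longrightarrow> extends K e w K'' e'' w''"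
  unfolding extends_def by auto

lemma extends_wpoly:
  assumes "extends K e w K' e' w'" "wpoly w {..<K} m f"
  shows "wpoly w' {..<K'} m f" "f (\<lambda>i. e' i n x) = f (\<lambda>i. e i n x)"
proof -
  have "wpoly w' {..<K} m f" by (rule wpoly_cong_weight[OF assms(2)]) (use assms(1) in \<open>auto simp: extends_def\<close>)
  then show "wpoly w' {..<K'} m f" by (rule wpoly_subset) (use assms(1) in \<open>auto simp: extends_def\<close>)
  show "f (\<lambda>i. e' i n x) = f (\<lambda>i. e i n x)"
    by (rule smooth_cong_on[OF wpoly_smooth[OF assms(2)]]) (use assms(1) in \<open>auto simp: extends_def\<close>)
qed

text \<open>The vectors are not normalised, so that null sequences need no special treatment.\<close>

lemma gram_schmidt:
  assumes sys: "sys K e w" and Y: "prime k Y"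
  shows "\<exists>e' w' f. sys (Suc K) e' w' \<and> extends K e w (Suc K) e' w' \<and> wpoly w' {..<Suc K} k f \<and> Y = (\<lambda>n x. f (\<lambda>i. e' i n x))"
proof -
  have pr: "prime (w j) (e j)" if "j < K" for j using sys that by (simp add: sys_def)
  \<comment> \<open>Primes of other orders are orthogonal to \<open>Y\<close> anyway, and the new
    vector has to stay in the chaos of order k.\<close>
  define A where "A = {i. i < K \<and> w i = k}"
  have fA: "finite A" by (simp add: A_def)
  define c where "c i = ip Y (e i) / ip (e i) (e i)" for i
  define Z where "Z = (\<lambda>n x. Y n x - (\<Sum>i\<in>A. c i * e i n x))"
  have prA: "prime k (e i)" if "i \<in> A" for i using that pr by (auto simp: A_def)
  have pZ: "prime k Z" unfolding Z_def by (rule prime_lincomb[OF Y prA])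
  define e' where "e' = e(K := Z)"
  define w' where "w' = w(K := k)"
  define f where "f x = x K + (\<Sum>i\<in>A. c i * x i)" for x :: "nat \<Rightarrow> real"
  have orth: "ip Z (e j) = 0" if j: "j < K" for j
  proof (cases "j \<in> A")
    case False
    then have "k \<noteq> w j" using j by (auto simp: A_def)
    then show ?thesis using bdch_orth[of k Z "w j" "e j"] pZ pr[OF j] by (auto simp: prime_def)
  next
    case True
    note bj = prime_bd[OF pr[OF j]]
    have bc: "bd k (\<lambda>n x. c i * e i n x)" if "i \<in> A" for i by (intro bd_cmult prime_bd prA that)
    have bS: "bd k (\<lambda>n x. \<Sum>i\<in>A. c i * e i n x)" by (rule bd_sum[OF bc])
    have "ip (e j) (\<lambda>n x. \<Sum>i\<in>A. c i * e i n x) = (\<Sum>i\<in>A. ip (e j) (\<lambda>n x. c i * e i n x))"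
      by (rule ip_sum_right[OF bj bc])
    also have "\<dots> = (\<Sum>i\<in>A. if i = j then c j * ip (e j) (e j) else 0)"
    proof (rule sum.cong)
      fix i assume i: "i \<in> A"
      then have "ip (e j) (e i) = (if i = j then ip (e j) (e j) else 0)"
        using sys j by (auto simp: sys_def A_def)
      then show "ip (e j) (\<lambda>n x. c i * e i n x) = (if i = j then c j * ip (e j) (e j) else 0)"
        by (simp add: ip_cmult_right[OF bj prime_bd[OF prA[OF i]]])
    qed simp
    also have "\<dots> = c j * ip (e j) (e j)" using True fA by simp
    \<comment> \<open>For a null vector the quotient defining \<open>c\<close> is 0 by convention;
      this is consistent because \<open>Y\<close> is then orthogonal to it.\<close>
    also have "\<dots> = ip Y (e j)"
      using ip_null[OF bj prime_bd[OF Y]] by (cases "ip (e j) (e j) = 0") (auto simp: c_def ip_commute[of Y])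
    finally show ?thesis
      unfolding Z_def ip_commute[of _ "e j"] ip_diff_right[OF bj prime_bd[OF Y] bS] by (simp add: ip_commute)
  qed
  have "sys (Suc K) e' w'"
    unfolding sys_def
  proof (intro conjI allI impI)
    show "prime (w' i) (e' i)" if "i < Suc K" for i using that pr pZ by (auto simp: e'_def w'_def less_Suc_eq)
    show "ip (e' i) (e' j) = 0" if "i < Suc K" "j < Suc K" "i \<noteq> j" for i j
      using that orth sys by (auto simp: e'_def less_Suc_eq sys_def ip_commute[of _ Z])
  qed
  moreover have "extends K e w (Suc K) e' w'" by (simp add: extends_def e'_def w'_def)
  moreover have "wpoly w' {..<Suc K} k f"
    unfolding f_def[abs_def]
    by (intro wpoly_add wpoly_sum wpoly_cmult wpoly_var) (auto simp: w'_def A_def)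
  moreover have "Y = (\<lambda>n x. f (\<lambda>i. e' i n x))"
  proof (intro ext)
    fix n x
    have "(\<Sum>i\<in>A. c i * e' i n x) = (\<Sum>i\<in>A. c i * e i n x)" by (rule sum.cong) (auto simp: e'_def A_def)
    then show "Y n x = f (\<lambda>i. e' i n x)" by (simp add: f_def e'_def Z_def)
  qed
  ultimately show ?thesis by (intro exI[of _ e'] exI[of _ w'] exI[of _ f]) simp
qed

text \<open>The initial system is arbitrary, so that the system built for one summand or factor can
  be enlarged for the next; polynomials in the smaller system keep their meaning in the larger
  one.\<close>

lemma qp_representation:
  "qp m Q \<Longrightarrow> sys K e w \<Longrightarrow> \<exists>K' e' w' f. sys K' e' w' \<and> extends K e w K' e' w' \<and> wpoly w' {..<K'} m f \<and>
     Q = (\<lambda>n x. f (\<lambda>i. e' i n x))"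
proof (induction arbitrary: K e w rule: qp.induct)
  case (qp_const m c)
  then show ?case
    by (intro exI[of _ K] exI[of _ e] exI[of _ w] exI[of _ "\<lambda>x. c"]) (auto intro: extends_refl wpoly_const)
next
  case (qp_add m X Z)
  from qp_add.IH(1)[OF qp_add.prems] obtain K1 e1 w1 f1 where 1: "sys K1 e1 w1" "extends K e w K1 e1 w1"
    "wpoly w1 {..<K1} m f1" "X = (\<lambda>n x. f1 (\<lambda>i. e1 i n x))" by (elim exE conjE)
  from qp_add.IH(2)[OF 1(1)] obtain K2 e2 w2 f2 where 2: "sys K2 e2 w2" "extends K1 e1 w1 K2 e2 w2"
    "wpoly w2 {..<K2} m f2" "Z = (\<lambda>n x. f2 (\<lambda>i. e2 i n x))" by (elim exE conjE)
  note f1 = extends_wpoly[OF 2(2) 1(3)]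
  show ?case
  proof (intro exI conjI)
    show "sys K2 e2 w2" by fact
    show "extends K e w K2 e2 w2" by (rule extends_trans[OF 1(2) 2(2)])
    show "wpoly w2 {..<K2} m (\<lambda>x. f1 x + f2 x)" by (rule wpoly_add[OF f1(1) 2(3)])
    show "(\<lambda>n x. X n x + Z n x) = (\<lambda>n x. f1 (\<lambda>i. e2 i n x) + f2 (\<lambda>i. e2 i n x))"
      by (simp add: 1(4) 2(4) f1(2))
  qed
next
  case (qp_prime_mult k Y m X m')
  from qp_prime_mult.IH[OF qp_prime_mult.prems] obtain K1 e1 w1 f1 where 1: "sys K1 e1 w1" "extends K e w K1 e1 w1"
    "wpoly w1 {..<K1} m f1" "X = (\<lambda>n x. f1 (\<lambda>i. e1 i n x))" by (elim exE conjE)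
  from gram_schmidt[OF 1(1) qp_prime_mult.hyps(1)] obtain e2 w2 f2 where 2: "sys (Suc K1) e2 w2" "extends K1 e1 w1 (Suc K1) e2 w2"
    "wpoly w2 {..<Suc K1} k f2" "Y = (\<lambda>n x. f2 (\<lambda>i. e2 i n x))" by (elim exE conjE)
  note f1 = extends_wpoly[OF 2(2) 1(3)]
  show ?case
  proof (intro exI conjI)
    show "sys (Suc K1) e2 w2" by fact
    show "extends K e w (Suc K1) e2 w2" by (rule extends_trans[OF 1(2) 2(2)])
    show "wpoly w2 {..<Suc K1} m' (\<lambda>x. f2 x * f1 x)"
      by (rule wpoly_mono[OF wpoly_mult[OF 2(3) f1(1)]]) (use qp_prime_mult.hyps in simp)
    show "(\<lambda>n x. Y n x * X n x) = (\<lambda>n x. f2 (\<lambda>i. e2 i n x) * f1 (\<lambda>i. e2 i n x))"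
      by (simp add: 1(4) 2(4) f1(2))
  qed
qed

end

section \<open>The limit law\<close>

lemma abs_cos_diff_le: "\<bar>cos a - cos b\<bar> \<le> \<bar>a - b\<bar>" for a b :: real
proof -
  have "norm (cos a - cos b) \<le> 1 * norm (a - b)"
    by (rule field_differentiable_bound[of UNIV cos "\<lambda>x. - sin x"]) (auto intro!: derivative_eq_intros)
  then show ?thesis by simp
qed

lemma abs_sin_diff_le: "\<bar>sin a - sin b\<bar> \<le> \<bar>a - b\<bar>" for a b :: real
proof -
  have "norm (sin a - sin b) \<le> 1 * norm (a - b)"
    by (rule field_differentiable_bound[of UNIV sin cos]) (auto intro!: derivative_eq_intros)
  then show ?thesis by simp
qed

context gaussian_ultra begin

text \<open>A given system is enlarged rather than replaced, so that approximants of increasing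
  accuracy can be compared within one system.\<close>

lemma step_approximation:
  assumes sys: "sys K e w" and F: "bdch d F" and s: "s < d" and \<eta>: "0 < \<eta>"
    and sml: "\<forall>\<^sub>F n in U. 0 \<le> \<epsilon> n \<and> small (V n) d s (\<epsilon> n) (F n)" "(\<epsilon> \<longlongrightarrow> 0) U"
  shows "\<exists>K' e' w' g. sys K' e' w' \<and> extends K e w K' e' w' \<and> wpoly w' {i. i < K' \<and> s < w' i} d g \<and>
    dist_sq F (\<lambda>n x. g (\<lambda>i. e' i n x)) < \<eta>"
proof -
  from bd_approximable[OF bdch_bd[OF F]] \<eta> obtain Q where Q: "qp d Q" "dist_sq F Q < \<eta>"
    unfolding approximable_def by blast
  from qp_representation[OF Q(1) sys] obtain K' e' w' f where 1: "sys K' e' w'" "extends K e w K' e' w'"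
    "wpoly w' {..<K'} d f" "Q = (\<lambda>n x. f (\<lambda>i. e' i n x))" by (elim exE conjE)
  from remove_low_primes[OF 1(1,3) F s sml] obtain g where g: "wpoly w' {i. i < K' \<and> s < w' i} d g"
    "dist_sq F (\<lambda>n x. g (\<lambda>i. e' i n x))
      \<le> dist_sq F (\<lambda>n x. f (\<lambda>i. e' i n x))" by (elim exE conjE)
  show ?thesis
  proof (intro exI conjI)
    show "sys K' e' w'" "extends K e w K' e' w'" "wpoly w' {i. i < K' \<and> s < w' i} d g" by fact+
    show "dist_sq F (\<lambda>n x. g (\<lambda>i. e' i n x)) < \<eta>"
      using g(2) Q(2) unfolding 1(4) by linarith
  qed
qed

text \<open>Cosine and sine are treated together: \<open>h\<close> preserves smooth functions and is
  1-Lipschitz. The expectations for the approximant converge by \<open>gauss_limit\<close>, and the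
  Lipschitz bound controls the error by the limit distance.\<close>

lemma limit_test_function:
  fixes h :: "real \<Rightarrow> real"
  assumes sys: "sys K e w" and g: "wpoly w {..<K} d g" and F: "bdch d F"
    and h: "\<And>W f. smooth W f \<Longrightarrow> smooth W (\<lambda>x. h (f x))" "\<And>a b. \<bar>h a - h b\<bar> \<le> \<bar>a - b\<bar>"
    and c: "((\<lambda>n. E (\<lambda>x. h (t * F n x))) \<longlongrightarrow> c) U"
  shows "\<bar>c - E (\<lambda>x. h (t * g (\<lambda>i. scl e i * x i)))\<bar>
    \<le> \<bar>t\<bar> * sqrt (dist_sq F (\<lambda>n x. g (\<lambda>i. e i n x)))"
proof -
  let ?g = "\<lambda>n x. g (\<lambda>i. e i n x)"
  note bF = bdch_bd[OF F] and bg = sys_bd[OF sys g]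
  note bd = bd_diff[OF bF bg]
  have [simp]: "sm (F n)" "sm (?g n)" for n using bd_sm[OF bF] bd_sm[OF bg] by auto
  have hsm: "sm (\<lambda>x. h (f x))" if "sm f" for f using that h(1) unfolding sm_def by blast
  have "smooth {..<K} (\<lambda>x. h (t * g x))"
    by (rule h(1)) (intro smooth.intros wpoly_smooth[OF g])
  from gauss_limit[OF sys this]
  have "((\<lambda>n. E (\<lambda>x. h (t * ?g n x))) \<longlongrightarrow> E (\<lambda>x. h (t * g (\<lambda>i. scl e i * x i)))) U" .
  then have 1: "((\<lambda>n. \<bar>E (\<lambda>x. h (t * F n x)) - E (\<lambda>x. h (t * ?g n x))\<bar>) \<longlongrightarrow> \<bar>c - E (\<lambda>x. h (t * g (\<lambda>i. scl e i * x i)))\<bar>) U"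
    by (intro tendsto_rabs tendsto_diff c)
  have 2: "((\<lambda>n. \<bar>t\<bar> * nrm (\<lambda>x. F n x - ?g n x)) \<longlongrightarrow> \<bar>t\<bar> * sqrt (dist_sq F ?g)) U"
    by (intro tendsto_mult_left nrm_tendsto[OF bd])
  show ?thesis
  proof (rule tendsto_le[OF U_nb 2 1], intro always_eventually allI)
    fix n
    have "E (\<lambda>x. h (t * F n x)) - E (\<lambda>x. h (t * ?g n x)) = E (\<lambda>x. h (t * F n x) - h (t * ?g n x))"
      by (rule E_diff[symmetric]) (auto intro!: hsm)
    also have "\<bar>\<dots>\<bar> \<le> nrm (\<lambda>x. h (t * F n x) - h (t * ?g n x))"
      by (rule E_abs_le) (auto intro!: hsm sm_diff)
    also have "\<dots> \<le> nrm (\<lambda>x. t * (F n x - ?g n x))"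
    proof (rule nrm_mono)
      show "\<bar>h (t * F n x) - h (t * ?g n x)\<bar> \<le> \<bar>t * (F n x - ?g n x)\<bar>" for x
        using h(2)[of "t * F n x" "t * ?g n x"] by (simp add: right_diff_distrib)
    qed (auto intro!: hsm sm_diff sm_mult)
    finally show "\<bar>E (\<lambda>x. h (t * F n x)) - E (\<lambda>x. h (t * ?g n x))\<bar> \<le> \<bar>t\<bar> * nrm (\<lambda>x. F n x - ?g n x)"
      unfolding nrm_cmult .
  qed
qed

text \<open>Accuracy (1/4)^k for squared distances becomes (1/2)^k for norms. The systems are
  nested, so \<open>p k\<close> and \<open>p l\<close> are polynomials in the same Gaussians; by
  \<open>gauss_limit\<close> their distance is the limit of the distance of the two approximants,
  both of which are close to \<open>F\<close>.\<close>

lemma polynomial_limit: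
  assumes F: "bdch d F" and s: "s < d"
    and sml: "\<forall>\<^sub>F n in U. 0 \<le> \<epsilon> n \<and> small (V n) d s (\<epsilon> n) (F n)" "(\<epsilon> \<longlongrightarrow> 0) U"
  shows "\<exists>p. (\<forall>k. \<exists>W. finite W \<and> polyf W (d div Suc s) (p k)) \<and>
    (\<forall>k l. k \<le> l \<longrightarrow> nrm (\<lambda>x. p k x - p l x) \<le> (1/2) ^ k + (1/2) ^ l) \<and>
    (\<forall>k t c. ((\<lambda>n. E (\<lambda>x. cos (t * F n x))) \<longlongrightarrow> c) U \<longrightarrow> \<bar>c - E (\<lambda>x. cos (t * p k x))\<bar> \<le> \<bar>t\<bar> * (1/2) ^ k) \<and>
    (\<forall>k t c. ((\<lambda>n. E (\<lambda>x. sin (t * F n x))) \<longlongrightarrow> c) U \<longrightarrow> \<bar>c - E (\<lambda>x. sin (t * p k x))\<bar> \<le> \<bar>t\<bar> * (1/2) ^ k)"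
proof -
  define P where "P k = (\<lambda>(K, e, w, g). sys K e w \<and> wpoly w {i. i < K \<and> s < w i} d g \<and>
    dist_sq F (\<lambda>n x. g (\<lambda>i. e i n x)) < (1/4) ^ k)" for k :: nat
  define Q where "Q = (\<lambda>(k::nat) (K, e, w, g :: (nat \<Rightarrow> real) \<Rightarrow> real) (K', e', w', g' :: (nat \<Rightarrow> real) \<Rightarrow> real). extends K (e :: nat \<Rightarrow> nat \<Rightarrow> (nat \<Rightarrow> real) \<Rightarrow> real) (w :: nat \<Rightarrow> nat) K' e' w')"
  have step: "\<exists>st. P k st \<and> (case st of (K', e', w', g) \<Rightarrow> extends K e w K' e' w')" if "sys K e w" for K e w k
  proof -
    have "0 < (1/4::real) ^ k" by simp
    from step_approximation[OF that F s this sml] obtain K' e' w' g where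
      "sys K' e' w'" "extends K e w K' e' w'" "wpoly w' {i. i < K' \<and> s < w' i} d g"
      "dist_sq F (\<lambda>n x. g (\<lambda>i. e' i n x)) < (1/4) ^ k" by (elim exE conjE)
    then show ?thesis by (intro exI[of _ "(K', e', w', g)"]) (simp add: P_def)
  qed
  have "\<exists>f. \<forall>k. P k (f k) \<and> Q k (f k) (f (Suc k))"
  proof (rule dependent_nat_choice)
    have "sys 0 (\<lambda>i n x. 0) (\<lambda>i. 0)" by (simp add: sys_def)
    then show "\<exists>x. P 0 x" using step by blast
    fix st k assume "P k st"
    moreover obtain K e w g where st: "st = (K, e, w, g)" by (cases st)
    ultimately have "sys K e w" by (simp add: P_def)
    from step[OF this, of "Suc k"] show "\<exists>y. P (Suc k) y \<and> Q k st y"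
      unfolding st Q_def by (simp add: case_prod_beta)
  qed
  then obtain f where fP: "\<And>k. P k (f k)" and fQ: "\<And>k. Q k (f k) (f (Suc k))" by blast
  define K e w g where "K k = fst (f k)" and "e k = fst (snd (f k))" and "w k = fst (snd (snd (f k)))"
    and "g k = snd (snd (snd (f k)))" for k
  have sys: "sys (K k) (e k) (w k)" and gw: "wpoly (w k) {i. i < K k \<and> s < w k i} d (g k)"
    and gd: "dist_sq F (\<lambda>n x. g k (\<lambda>i. e k i n x)) < (1/4) ^ k" for k
    using fP[of k] unfolding P_def K_def e_def w_def g_def by (auto simp: case_prod_beta)
  have ext1: "extends (K k) (e k) (w k) (K (Suc k)) (e (Suc k)) (w (Suc k))" for k
    using fQ[of k] unfolding Q_def K_def e_def w_def by (auto simp: case_prod_beta)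
  have ext: "extends (K k) (e k) (w k) (K l) (e l) (w l)" if "k \<le> l" for k l
    using that by (induction rule: dec_induct) (auto intro: extends_refl extends_trans[OF _ ext1])
  have gK: "wpoly (w k) {..<K k} d (g k)" for k by (rule wpoly_subset[OF gw]) auto
  define p where "p k x = g k (\<lambda>i. scl (e k) i * x i)" for k x
  have sq: "sqrt (dist_sq F (\<lambda>n x. g k (\<lambda>i. e k i n x))) \<le> (1/2) ^ k" for k
  proof -
    have "sqrt (dist_sq F (\<lambda>n x. g k (\<lambda>i. e k i n x))) \<le> sqrt ((1/4) ^ k)"
      using gd[of k] by (intro real_sqrt_le_mono) simp
    also have "(1/4::real) ^ k = ((1/2) ^ k)\<^sup>2"
    proof -
      have "((1/2::real) ^ k)\<^sup>2 = ((1/2) * (1/2)) ^ k" unfolding power2_eq_square power_mult_distrib ..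
      then show ?thesis by simp
    qed
    also have "sqrt (((1/2::real) ^ k)\<^sup>2) = (1/2) ^ k" by (rule real_sqrt_unique) auto
    finally show ?thesis .
  qed
  have pol: "\<exists>W. finite W \<and> polyf W (d div Suc s) (p k)" for k
  proof (intro exI conjI)
    show "finite {i. i < K k \<and> s < w k i}" by simp
    show "polyf {i. i < K k \<and> s < w k i} (d div Suc s) (p k)"
      unfolding p_def[abs_def] by (rule wpoly_scale, rule wpoly_degree[OF _ gw]) auto
  qed
  have cau: "nrm (\<lambda>x. p k x - p l x) \<le> (1/2) ^ k + (1/2) ^ l" if kl: "k \<le> l" for k l
  proof -
    note gkl = extends_wpoly[OF ext[OF kl] gK]
    let ?gk = "\<lambda>n x. g k (\<lambda>i. e l i n x)" and ?gl = "\<lambda>n x. g l (\<lambda>i. e l i n x)"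
    note bF = bdch_bd[OF F] and bk = sys_bd[OF sys gkl(1)] and bl = sys_bd[OF sys gK, of l]
    have "smooth {..<K l} (\<lambda>x. (g k x - g l x) * (g k x - g l x))"
      using wpoly_smooth[OF wpoly_diff[OF gkl(1) gK]] by (intro smooth_mult)
    from gauss_limit[OF sys this]
    have "((\<lambda>n. E (\<lambda>x. (?gk n x - ?gl n x) * (?gk n x - ?gl n x))) \<longlongrightarrow> E (\<lambda>x. (g k (\<lambda>i. scl (e l) i * x i) - p l x) * (g k (\<lambda>i. scl (e l) i * x i) - p l x))) U"
      unfolding p_def .
    \<comment> \<open>The first \<open>K k\<close> vectors are common to both systems, so the
      scaling factors agree.\<close>
    moreover have "g k (\<lambda>i. scl (e l) i * x i) = p k x" for x
      unfolding p_def
    proof (rule smooth_cong_on[OF wpoly_smooth[OF gK]])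
      fix i assume "i \<in> {..<K k}"
      then have "e l i = e k i" using ext[OF kl] by (simp add: extends_def)
      then show "scl (e l) i * x i = scl (e k) i * x i" by (simp add: scl_def)
    qed
    ultimately have "((\<lambda>n. E (\<lambda>x. (?gk n x - ?gl n x) * (?gk n x - ?gl n x))) \<longlongrightarrow> E (\<lambda>x. (p k x - p l x) * (p k x - p l x))) U"
      by simp
    then have 1: "((\<lambda>n. nrm (\<lambda>x. ?gk n x - ?gl n x)) \<longlongrightarrow> nrm (\<lambda>x. p k x - p l x)) U"
      unfolding nrm_def power2_eq_square by (rule tendsto_real_sqrt)
    have 2: "((\<lambda>n. nrm (\<lambda>x. F n x - ?gk n x) + nrm (\<lambda>x. F n x - ?gl n x)) \<longlongrightarrow>
        sqrt (dist_sq F ?gk) + sqrt (dist_sq F ?gl)) U"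
      by (intro tendsto_add nrm_tendsto[OF bd_diff[OF bF bk]] nrm_tendsto[OF bd_diff[OF bF bl]])
    have [simp]: "sm (F n)" "sm (?gk n)" "sm (?gl n)" for n using bd_sm[OF bF] bd_sm[OF bk] bd_sm[OF bl] by auto
    have "nrm (\<lambda>x. p k x - p l x) \<le> sqrt (dist_sq F ?gk) + sqrt (dist_sq F ?gl)"
    proof (rule tendsto_le[OF U_nb 2 1], intro always_eventually allI)
      fix n
      have "(\<lambda>x. ?gk n x - ?gl n x) = (\<lambda>x. (F n x - ?gl n x) - (F n x - ?gk n x))" by simp
      then show "nrm (\<lambda>x. ?gk n x - ?gl n x) \<le> nrm (\<lambda>x. F n x - ?gk n x) + nrm (\<lambda>x. F n x - ?gl n x)"
        using nrm_diff[of "\<lambda>x. F n x - ?gl n x" "\<lambda>x. F n x - ?gk n x"] by simp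
    qed
    also have "?gk = (\<lambda>n x. g k (\<lambda>i. e k i n x))" using gkl(2) by simp
    finally show ?thesis using sq[of k] sq[of l] by linarith
  qed
  have tst: "\<bar>c - E (\<lambda>x. h (t * p k x))\<bar> \<le> \<bar>t\<bar> * (1/2) ^ k"
    if h: "\<And>W f. smooth W f \<Longrightarrow> smooth W (\<lambda>x. h (f x))" "\<And>a b. \<bar>h a - h b\<bar> \<le> \<bar>a - b\<bar>"
    and c: "((\<lambda>n. E (\<lambda>x. h (t * F n x))) \<longlongrightarrow> c) U" for h :: "real \<Rightarrow> real" and k t c
    unfolding p_def
    by (rule order_trans[OF limit_test_function[OF sys gK F h c]]) (auto intro!: mult_left_mono sq)
  show ?thesis
  proof (intro exI[of _ p] conjI allI impI)
    show "\<exists>W. finite W \<and> polyf W (d div Suc s) (p k)" for k by (rule pol)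
    show "nrm (\<lambda>x. p k x - p l x) \<le> (1/2) ^ k + (1/2) ^ l" if "k \<le> l" for k l by (rule cau[OF that])
    show "\<bar>c - E (\<lambda>x. cos (t * p k x))\<bar> \<le> \<bar>t\<bar> * (1/2) ^ k"
      if "((\<lambda>n. E (\<lambda>x. cos (t * F n x))) \<longlongrightarrow> c) U" for k t c
      by (rule tst[OF smooth_cos abs_cos_diff_le that])
    show "\<bar>c - E (\<lambda>x. sin (t * p k x))\<bar> \<le> \<bar>t\<bar> * (1/2) ^ k"
      if "((\<lambda>n. E (\<lambda>x. sin (t * F n x))) \<longlongrightarrow> c) U" for k t c
      by (rule tst[OF smooth_sin abs_sin_diff_le that])
  qed
qed

end

section \<open>Translation into finitely supported exponent maps, and the analysis of the
  limit\<close>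

definition mono_eval :: "(nat \<Rightarrow>\<^sub>0 nat) \<Rightarrow> (nat \<Rightarrow> real) \<Rightarrow> real" where
  "mono_eval e x = (\<Prod>i \<in> Poly_Mapping.keys e. x i ^ Poly_Mapping.lookup e i)"

definition mono_degree :: "(nat \<Rightarrow>\<^sub>0 nat) \<Rightarrow> nat" where
  "mono_degree e = (\<Sum>i \<in> Poly_Mapping.keys e. Poly_Mapping.lookup e i)"

lemma mono_eval_superset:
  "finite T \<Longrightarrow> Poly_Mapping.keys e \<subseteq> T \<Longrightarrow> mono_eval e x = (\<Prod>i\<in>T. x i ^ Poly_Mapping.lookup e i)"
  unfolding mono_eval_def by (rule prod.mono_neutral_left) (auto simp: in_keys_iff)

lemma mono_degree_superset:
  "finite T \<Longrightarrow> Poly_Mapping.keys e \<subseteq> T \<Longrightarrow> mono_degree e = (\<Sum>i\<in>T. Poly_Mapping.lookup e i)"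
  unfolding mono_degree_def by (rule sum.mono_neutral_left) (auto simp: in_keys_iff)

lemma mono_eval_var: "mono_eval (e + Poly_Mapping.single i 1) x = x i * mono_eval e x"
proof -
  let ?T = "insert i (Poly_Mapping.keys e)"
  have "mono_eval (e + Poly_Mapping.single i 1) x = (\<Prod>j\<in>?T. x j ^ Poly_Mapping.lookup (e + Poly_Mapping.single i 1) j)"
    using keys_add[of e "Poly_Mapping.single i 1"] by (intro mono_eval_superset) auto
  also have "\<dots> = (\<Prod>j\<in>?T. (if j = i then x i else 1) * x j ^ Poly_Mapping.lookup e j)"
    by (rule prod.cong) (auto simp: lookup_add lookup_single when_def)
  also have "\<dots> = x i * (\<Prod>j\<in>?T. x j ^ Poly_Mapping.lookup e j)"
    unfolding prod.distrib by (subst prod.delta) auto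
  also have "(\<Prod>j\<in>?T. x j ^ Poly_Mapping.lookup e j) = mono_eval e x"
    by (rule mono_eval_superset[symmetric]) auto
  finally show ?thesis .
qed

lemma mono_degree_var: "mono_degree (e + Poly_Mapping.single i 1) = Suc (mono_degree e)"
proof -
  let ?T = "insert i (Poly_Mapping.keys e)"
  have "mono_degree (e + Poly_Mapping.single i 1) = (\<Sum>j\<in>?T. Poly_Mapping.lookup (e + Poly_Mapping.single i 1) j)"
    using keys_add[of e "Poly_Mapping.single i 1"] by (intro mono_degree_superset) auto
  also have "\<dots> = (\<Sum>j\<in>?T. (if j = i then 1 else 0) + Poly_Mapping.lookup e j)"
    by (rule sum.cong) (auto simp: lookup_add lookup_single when_def)
  also have "\<dots> = Suc (\<Sum>j\<in>?T. Poly_Mapping.lookup e j)"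
    unfolding sum.distrib by (subst sum.delta) auto
  also have "(\<Sum>j\<in>?T. Poly_Mapping.lookup e j) = mono_degree e"
    by (rule mono_degree_superset[symmetric]) auto
  finally show ?thesis .
qed

lemma mpoly_eval_superset:
  "finite T \<Longrightarrow> Poly_Mapping.keys p \<subseteq> T \<Longrightarrow> mpoly_eval p x = (\<Sum>e\<in>T. Poly_Mapping.lookup p e * mono_eval e x)"
  unfolding mpoly_eval_def mono_eval_def by (rule sum.mono_neutral_left) (auto simp: in_keys_iff)

lemma total_degree_le_iff: "total_degree p \<le> m \<longleftrightarrow> (\<forall>e\<in>Poly_Mapping.keys p. mono_degree e \<le> m)"
  unfolding total_degree_def mono_degree_def by auto

lemma mpoly_eval_add: "mpoly_eval (p + q) x = mpoly_eval p x + mpoly_eval q x"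
proof -
  let ?T = "Poly_Mapping.keys p \<union> Poly_Mapping.keys q"
  have "mpoly_eval (p + q) x = (\<Sum>e\<in>?T. Poly_Mapping.lookup (p + q) e * mono_eval e x)"
    using keys_add[of p q] by (intro mpoly_eval_superset) auto
  also have "\<dots> = (\<Sum>e\<in>?T. Poly_Mapping.lookup p e * mono_eval e x) + (\<Sum>e\<in>?T. Poly_Mapping.lookup q e * mono_eval e x)"
    by (simp add: lookup_add distrib_right sum.distrib)
  also have "(\<Sum>e\<in>?T. Poly_Mapping.lookup p e * mono_eval e x) = mpoly_eval p x"
    by (rule mpoly_eval_superset[symmetric]) auto
  also have "(\<Sum>e\<in>?T. Poly_Mapping.lookup q e * mono_eval e x) = mpoly_eval q x"
    by (rule mpoly_eval_superset[symmetric]) auto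
  finally show ?thesis .
qed

lemma mpoly_eval_single: "mpoly_eval (Poly_Mapping.single e c) x = c * mono_eval e x"
  using mpoly_eval_superset[of "{e}" "Poly_Mapping.single e c" x] by simp

lemma polyf_mpoly: "polyf W m f \<Longrightarrow> \<exists>p. total_degree p \<le> m \<and> f = mpoly_eval p"
proof (induction rule: wpoly.induct)
  case (wpoly_const m c)
  show ?case
    by (intro exI[of _ "Poly_Mapping.single 0 c"])
      (auto simp: total_degree_le_iff mpoly_eval_single mono_eval_def mono_degree_def fun_eq_iff)
next
  case (wpoly_add m f g)
  then obtain p q where "total_degree p \<le> m" "f = mpoly_eval p" "total_degree q \<le> m" "g = mpoly_eval q" by blast
  then show ?case using keys_add[of p q]
    by (intro exI[of _ "p + q"]) (auto simp: total_degree_le_iff mpoly_eval_add fun_eq_iff)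
next
  case (wpoly_var_mult i m f m')
  then obtain p where p: "total_degree p \<le> m" "f = mpoly_eval p" by blast
  define sh where "sh e = Poly_Mapping.single (e + Poly_Mapping.single i 1) (Poly_Mapping.lookup p e)" for e
  have ev: "mpoly_eval (\<Sum>e\<in>S. sh e) x = x i * (\<Sum>e\<in>S. Poly_Mapping.lookup p e * mono_eval e x)"
    if "finite S" for S x
    using that
  proof (induction rule: finite_induct)
    case empty
    then show ?case by (simp add: mpoly_eval_def)
  next
    case (insert e S)
    have "mpoly_eval (sh e) x = x i * (Poly_Mapping.lookup p e * mono_eval e x)"
      unfolding sh_def mpoly_eval_single mono_eval_var by simp
    then show ?case using insert by (simp add: mpoly_eval_add distrib_left)
  qed
  have kk: "\<forall>e'\<in>Poly_Mapping.keys (\<Sum>e\<in>S. sh e). mono_degree e' \<le> m'" if "finite S" "S \<subseteq> Poly_Mapping.keys p" for S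
    using that
  proof (induction rule: finite_induct)
    case (insert e S)
    have "mono_degree e \<le> m" using p(1) insert.prems by (auto simp: total_degree_le_iff)
    then have "\<forall>e'\<in>Poly_Mapping.keys (sh e). mono_degree e' \<le> m'"
      using wpoly_var_mult.hyps by (auto simp: sh_def mono_degree_var[unfolded One_nat_def] split: if_splits)
    then show ?case using insert keys_add[of "sh e" "\<Sum>e\<in>S. sh e"] by auto
  qed simp
  show ?case
  proof (intro exI conjI)
    show "total_degree (\<Sum>e\<in>Poly_Mapping.keys p. sh e) \<le> m'"
      unfolding total_degree_le_iff by (rule kk) auto
    show "(\<lambda>x. x i * f x) = mpoly_eval (\<Sum>e\<in>Poly_Mapping.keys p. sh e)"
      by (intro ext) (simp only: ev[OF finite_keys] p(2) mpoly_eval_superset[OF finite_keys order_refl, of p])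
  qed
qed

text \<open>Tightness bounds the \<open>L\<^sup>2\<close>-norm because the \<open>L\<^sup>4\<close>-norm of a polynomial of degree \<open>d\<close> is controlled by
  its \<open>L\<^sup>2\<close>-norm.\<close>

lemma (in gaussian_family) weak_conv_nrm_bounded:
  assumes fin: "\<And>n. finite (V n)" and F: "\<And>n. polyf (V n) d (F n)"
    and \<mu>: "real_distribution \<mu>" and wc: "weak_conv_m (\<lambda>n. distr M borel (\<lambda>\<omega>. F n (\<lambda>i. G i \<omega>))) \<mu>"
  shows "\<exists>C. \<forall>n. nrm (F n) \<le> C"
proof -
  interpret \<mu>: real_distribution \<mu> by fact
  have [simp]: "sm (F n)" for n using wpoly_sm[OF F fin] .
  have [measurable]: "(\<lambda>\<omega>. F n (\<lambda>i. G i \<omega>)) \<in> borel_measurable M" for n by (rule sm_measurable) simp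
  have rd: "real_distribution (distr M borel (\<lambda>\<omega>. F n (\<lambda>i. G i \<omega>)))" for n
    by (rule real_distribution_distr) simp
  \<comment> \<open>A continuous substitute for the indicator of |x| > R: it vanishes up to R and is
    1 from R + 1 on.\<close>
  define h :: "nat \<Rightarrow> real \<Rightarrow> real" where "h R x = min 1 (max 0 (\<bar>x\<bar> - real R))" for R x
  have h01: "0 \<le> h R x" "h R x \<le> 1" for R x by (auto simp: h_def)
  have hcont: "isCont (h R) x" for R x unfolding h_def by (intro continuous_intros)
  have hm [measurable]: "h R \<in> borel_measurable borel" for R
    using hcont by (auto intro!: borel_measurable_continuous_onI continuous_at_imp_continuous_on)
  define C where "C = prod_const (d + d)"
  have C: "0 < C" unfolding C_def by (rule prod_const_pos)
  \<comment> \<open>With this \<delta> and with \<open>lam\<close> below, the two error terms are at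
    most N / 4 each, so that they can be absorbed into N.\<close>
  define \<delta> where "\<delta> = 1 / (4 * C)"
  have \<delta>: "0 < \<delta>" using C by (simp add: \<delta>_def)
  have "(\<lambda>R. \<integral>x. h R x \<partial>\<mu>) \<longlonglongrightarrow> (\<integral>x. 0 \<partial>\<mu>)"
  proof (rule integral_dominated_convergence[where w = "\<lambda>_. 1"])
    show "AE x in \<mu>. (\<lambda>R. h R x) \<longlonglongrightarrow> 0"
    proof (rule AE_I2)
      fix x
      obtain R0 :: nat where "\<bar>x\<bar> \<le> real R0" using real_arch_simple by blast
      then have "eventually (\<lambda>R. h R x = 0) sequentially"
        unfolding eventually_sequentially by (intro exI[of _ R0]) (auto simp: h_def)
      then show "(\<lambda>R. h R x) \<longlonglongrightarrow> 0" by (rule tendsto_eventually)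
    qed
    show "AE x in \<mu>. norm (h R x) \<le> 1" for R using h01 by auto
  qed auto
  then have "eventually (\<lambda>R. (\<integral>x. h R x \<partial>\<mu>) < \<delta>) sequentially" using \<delta> by (intro order_tendstoD) simp_all
  then obtain R where R: "(\<integral>x. h R x \<partial>\<mu>) < \<delta>" by (auto simp: eventually_sequentially)
  have "(\<lambda>n. \<integral>x. h R x \<partial>distr M borel (\<lambda>\<omega>. F n (\<lambda>i. G i \<omega>))) \<longlonglongrightarrow> (\<integral>x. h R x \<partial>\<mu>)"
    using h01 by (intro weak_conv_imp_integral_bdd_continuous_conv[OF rd \<mu> wc hcont, where B = 1]) simp
  then have "eventually (\<lambda>n. (\<integral>x. h R x \<partial>distr M borel (\<lambda>\<omega>. F n (\<lambda>i. G i \<omega>))) < \<delta>) sequentially"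
    using R by (rule order_tendstoD(2))
  then obtain n0 where n0: "\<And>n. n \<ge> n0 \<Longrightarrow> (\<integral>\<omega>. h R (F n (\<lambda>i. G i \<omega>)) \<partial>M) < \<delta>"
    by (auto simp: eventually_sequentially integral_distr)
  have bnd: "(nrm (F n))\<^sup>2 \<le> 2 * (real R + 1)\<^sup>2" if n: "n \<ge> n0" for n
  proof (cases "nrm (F n) = 0")
    case False
    define N where "N = E (\<lambda>x. (F n x)\<^sup>2)"
    have N0: "0 < N" using False nrm_sq[of "F n"] unfolding N_def by (metis nrm_nonneg zero_less_power2)
    define lam where "lam = 1 / (2 * C * N)"
    have l0: "0 < lam" using C N0 by (simp add: lam_def)
    \<comment> \<open>Up to R + 1 the square is bounded outright; beyond, it is split by Young's
      inequality into a fourth power and a tail term.\<close>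
    have pw: "y\<^sup>2 \<le> (real R + 1)\<^sup>2 + (lam / 2 * (y * y)\<^sup>2 + 1 / (2 * lam) * h R y)" for y
    proof -
      have "y\<^sup>2 \<le> (real R + 1)\<^sup>2 + y\<^sup>2 * h R y"
      proof (cases "\<bar>y\<bar> \<le> real R + 1")
        case True
        then have "y\<^sup>2 \<le> (real R + 1)\<^sup>2" by (intro abs_le_square_iff[THEN iffD1]) auto
        then show ?thesis using h01(1)[of R y] by (simp add: add_increasing2)
      next
        case False
        then have "h R y = 1" by (simp add: h_def)
        then show ?thesis by simp
      qed
      moreover have "y\<^sup>2 * h R y \<le> lam / 2 * (y * y)\<^sup>2 + 1 / (2 * lam) * h R y"
      proof -
        have "0 \<le> (lam * (y * y) - h R y)\<^sup>2" by simp
        then have "2 * lam * (y\<^sup>2 * h R y) \<le> lam * lam * (y * y)\<^sup>2 + h R y * h R y"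
          by (simp add: power2_eq_square algebra_simps)
        also have "h R y * h R y \<le> h R y * 1" using h01[of R y] by (intro mult_left_mono) auto
        finally have "2 * lam * (y\<^sup>2 * h R y) \<le> lam * lam * (y * y)\<^sup>2 + h R y" by simp
        then have "y\<^sup>2 * h R y \<le> (lam * lam * (y * y)\<^sup>2 + h R y) / (2 * lam)"
          using l0 by (simp add: pos_le_divide_eq mult_ac)
        also have "\<dots> = lam / 2 * (y * y)\<^sup>2 + 1 / (2 * lam) * h R y" using l0 by (simp add: add_divide_distrib)
        finally show ?thesis .
      qed
      ultimately show ?thesis by linarith
    qed
    have ih: "integrable M (\<lambda>\<omega>. h R (F n (\<lambda>i. G i \<omega>)))"
      by (rule integrable_const_bound[of _ 1]) (use h01 in auto)
    have i2: "integrable M (\<lambda>\<omega>. (F n (\<lambda>i. G i \<omega>))\<^sup>2)" by (rule sm_integrable[of "\<lambda>x. (F n x)\<^sup>2"]) auto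
    have i4: "integrable M (\<lambda>\<omega>. (F n (\<lambda>i. G i \<omega>) * F n (\<lambda>i. G i \<omega>))\<^sup>2)" by (rule sm_integrable[of "\<lambda>x. (F n x * F n x)\<^sup>2"]) auto
    have "N \<le> (\<integral>\<omega>. (real R + 1)\<^sup>2 + (lam / 2 * (F n (\<lambda>i. G i \<omega>) * F n (\<lambda>i. G i \<omega>))\<^sup>2 + 1 / (2 * lam) * h R (F n (\<lambda>i. G i \<omega>))) \<partial>M)"
      unfolding N_def E_def using ih i2 i4
      by (intro integral_mono pw integrable_add integrable_mult_right integrable_const) auto
    also have "\<dots> = (real R + 1)\<^sup>2 + (lam / 2 * E (\<lambda>x. (F n x * F n x)\<^sup>2) + 1 / (2 * lam) * (\<integral>\<omega>. h R (F n (\<lambda>i. G i \<omega>)) \<partial>M))"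
      unfolding E_def using ih i4 by (simp add: prob_space)
    also have "\<dots> \<le> (real R + 1)\<^sup>2 + (lam / 2 * (C * (N * N)) + 1 / (2 * lam) * \<delta>)"
    proof -
      have "E (\<lambda>x. (F n x * F n x)\<^sup>2) \<le> C * (N * N)"
        unfolding C_def N_def by (rule E_prod_sq_le[OF fin F F order_refl])
      then have "lam / 2 * E (\<lambda>x. (F n x * F n x)\<^sup>2) \<le> lam / 2 * (C * (N * N))" using l0 by (intro mult_left_mono) auto
      moreover have "1 / (2 * lam) * (\<integral>\<omega>. h R (F n (\<lambda>i. G i \<omega>)) \<partial>M) \<le> 1 / (2 * lam) * \<delta>"
        using n0[OF n] l0 by (intro mult_left_mono) auto
      ultimately show ?thesis by linarith
    qed
    also have "lam / 2 * (C * (N * N)) + 1 / (2 * lam) * \<delta> = N / 2"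
      using C N0 by (simp add: lam_def \<delta>_def)
    finally have "N \<le> 2 * (real R + 1)\<^sup>2" by linarith
    then show ?thesis by (simp add: nrm_sq N_def)
  qed simp
  \<comment> \<open>The finitely many stages before n0 are covered by the sum of their
    norms.\<close>
  have "nrm (F n) \<le> sqrt (2 * (real R + 1)\<^sup>2) + (\<Sum>k<n0. nrm (F k))" for n
  proof (cases "n \<ge> n0")
    case True
    have "sqrt ((nrm (F n))\<^sup>2) \<le> sqrt (2 * (real R + 1)\<^sup>2)" by (intro real_sqrt_le_mono bnd True)
    then show ?thesis by (simp add: add_increasing2 sum_nonneg)
  next
    case False
    then have "nrm (F n) \<le> (\<Sum>k<n0. nrm (F k))" by (intro member_le_sum) auto
    then show ?thesis by (simp add: add_increasing)
  qed
  then show ?thesis by blast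
qed

text \<open>The Riesz-Fischer argument with explicit rates: summable increments give almost sure
  convergence, and Fatou's lemma turns the Cauchy bound into a bound for the distance to the
  limit.\<close>

lemma (in prob_space) L2_limit_exists:
  fixes X :: "nat \<Rightarrow> 'a \<Rightarrow> real"
  assumes [measurable]: "\<And>k. X k \<in> borel_measurable M" and sq: "\<And>k. integrable M (\<lambda>\<omega>. (X k \<omega>)\<^sup>2)"
    and cauchy: "\<And>k l. k \<le> l \<Longrightarrow> (\<integral>\<omega>. (X k \<omega> - X l \<omega>)\<^sup>2 \<partial>M) \<le> (2 * (1/2) ^ k)\<^sup>2"
  shows "\<exists>Q. Q \<in> borel_measurable M \<and> integrable M (\<lambda>\<omega>. (Q \<omega>)\<^sup>2) \<and>
    (\<forall>k. integrable M (\<lambda>\<omega>. (Q \<omega> - X k \<omega>)\<^sup>2) \<and> (\<integral>\<omega>. (Q \<omega> - X k \<omega>)\<^sup>2 \<partial>M) \<le> (2 * (1/2) ^ k)\<^sup>2)"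
proof -
  have sqd: "integrable M (\<lambda>\<omega>. (f \<omega> - g \<omega>)\<^sup>2)"
    if [measurable]: "f \<in> borel_measurable M" "g \<in> borel_measurable M"
      and "integrable M (\<lambda>\<omega>. (f \<omega>)\<^sup>2)" "integrable M (\<lambda>\<omega>. (g \<omega>)\<^sup>2)" for f g :: "'a \<Rightarrow> real"
  proof (rule Bochner_Integration.integrable_bound)
    show "integrable M (\<lambda>\<omega>. 2 * (f \<omega>)\<^sup>2 + 2 * (g \<omega>)\<^sup>2)" using that by auto
    have "(a - b)\<^sup>2 \<le> 2 * a\<^sup>2 + 2 * b\<^sup>2" for a b :: real
      using zero_le_power2[of "a + b"] by (simp add: power2_eq_square algebra_simps)
    then show "AE \<omega> in M. norm ((f \<omega> - g \<omega>)\<^sup>2) \<le> norm (2 * (f \<omega>)\<^sup>2 + 2 * (g \<omega>)\<^sup>2)" by auto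
  qed simp
  define Y where "Y k \<omega> = \<bar>X (Suc k) \<omega> - X k \<omega>\<bar>" for k \<omega>
  have [measurable]: "Y k \<in> borel_measurable M" for k unfolding Y_def[abs_def] by simp
  have Ybound: "(\<integral>\<^sup>+\<omega>. ennreal (Y k \<omega>) \<partial>M) \<le> ennreal (3 * (1/2) ^ k)" for k
  proof -
    define c where "c = (1/2::real) ^ k"
    have c: "0 < c" by (simp add: c_def)
    have yint: "integrable M (\<lambda>\<omega>. (X k \<omega> - X (Suc k) \<omega>)\<^sup>2)" by (intro sqd sq) auto
    \<comment> \<open>Young's inequality with c = (1/2)^k passes from second to first moments at the
      right rate: 2 c + c / 2 \<le> 3 c.\<close>
    have pw: "Y k \<omega> \<le> (1 / (2 * c)) * (X k \<omega> - X (Suc k) \<omega>)\<^sup>2 + c / 2" for \<omega>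
    proof -
      have "0 \<le> (Y k \<omega> - c)\<^sup>2" by simp
      then have "2 * c * Y k \<omega> \<le> (X k \<omega> - X (Suc k) \<omega>)\<^sup>2 + c * c"
        by (simp add: Y_def power2_eq_square algebra_simps abs_mult_self)
      then have "Y k \<omega> \<le> ((X k \<omega> - X (Suc k) \<omega>)\<^sup>2 + c * c) / (2 * c)"
        using c by (simp add: pos_le_divide_eq mult_ac)
      then show ?thesis using c by (simp add: add_divide_distrib)
    qed
    have "(\<integral>\<^sup>+\<omega>. ennreal (Y k \<omega>) \<partial>M) \<le> (\<integral>\<^sup>+\<omega>. ennreal ((1 / (2 * c)) * (X k \<omega> - X (Suc k) \<omega>)\<^sup>2 + c / 2) \<partial>M)"
      by (intro nn_integral_mono ennreal_leI pw)
    also have "\<dots> = ennreal (\<integral>\<omega>. (1 / (2 * c)) * (X k \<omega> - X (Suc k) \<omega>)\<^sup>2 + c / 2 \<partial>M)"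
      using yint c by (intro nn_integral_eq_integral) auto
    also have "(\<integral>\<omega>. (1 / (2 * c)) * (X k \<omega> - X (Suc k) \<omega>)\<^sup>2 + c / 2 \<partial>M) = (1 / (2 * c)) * (\<integral>\<omega>. (X k \<omega> - X (Suc k) \<omega>)\<^sup>2 \<partial>M) + c / 2"
      using yint by (simp add: prob_space)
    also have "ennreal \<dots> \<le> ennreal ((1 / (2 * c)) * (2 * c)\<^sup>2 + c / 2)"
      using cauchy[of k "Suc k"] c unfolding c_def[symmetric]
      by (intro ennreal_leI add_right_mono mult_left_mono) auto
    also have "\<dots> \<le> ennreal (3 * c)" using c by (intro ennreal_leI) (simp add: power2_eq_square)
    finally show ?thesis by (simp add: c_def)
  qed
  have "(\<integral>\<^sup>+\<omega>. (suminf (\<lambda>k. ennreal (Y k \<omega>))) \<partial>M) = (suminf (\<lambda>k. \<integral>\<^sup>+\<omega>. ennreal (Y k \<omega>) \<partial>M))"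
    by (rule nn_integral_suminf) simp
  also have "\<dots> \<le> (suminf (\<lambda>k. ennreal (3 * (1/2) ^ k)))" by (intro suminf_le Ybound) auto
  also have "\<dots> = ennreal (suminf (\<lambda>k. 3 * (1/2) ^ k))"
    by (intro suminf_ennreal2) (auto intro!: summable_mult summable_geometric)
  finally have "(\<integral>\<^sup>+\<omega>. (suminf (\<lambda>k. ennreal (Y k \<omega>))) \<partial>M) \<noteq> \<infinity>" by (auto simp: top_unique)
  then have "AE \<omega> in M. (suminf (\<lambda>k. ennreal (Y k \<omega>))) \<noteq> \<infinity>" by (intro nn_integral_PInf_AE) auto
  then have conv: "AE \<omega> in M. convergent (\<lambda>k. X k \<omega>)"
  proof eventually_elim
    case (elim \<omega>)
    have "summable (\<lambda>k. Y k \<omega>)"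
      by (rule summable_suminf_not_top) (use elim in \<open>simp_all add: Y_def infinity_ennreal_def\<close>)
    then have "summable (\<lambda>k. \<bar>X (Suc k) \<omega> - X k \<omega>\<bar>)" by (simp only: Y_def)
    then have "summable (\<lambda>k. X (Suc k) \<omega> - X k \<omega>)" by (rule summable_rabs_cancel)
    then have "convergent (\<lambda>n. \<Sum>k<n. X (Suc k) \<omega> - X k \<omega>)" by (simp add: summable_iff_convergent)
    then have "convergent (\<lambda>n. X n \<omega> - X 0 \<omega>)" by (simp only: sum_lessThan_telescope[of "\<lambda>n. X n \<omega>"])
    then have "convergent (\<lambda>n. (X n \<omega> - X 0 \<omega>) + X 0 \<omega>)" by (intro convergent_add convergent_const)
    then show ?case by simp
  qed
  \<comment> \<open>Off the set of convergence the value is arbitrary; that set is null.\<close>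
  define Q where "Q \<omega> = lim (\<lambda>k. X k \<omega>)" for \<omega>
  have Qm [measurable]: "Q \<in> borel_measurable M" unfolding Q_def[abs_def] by simp
  have nnb: "(\<integral>\<^sup>+\<omega>. ennreal ((Q \<omega> - X k \<omega>)\<^sup>2) \<partial>M) \<le> ennreal ((2 * (1/2) ^ k)\<^sup>2)" for k
  proof -
    have "(\<integral>\<^sup>+\<omega>. ennreal ((Q \<omega> - X k \<omega>)\<^sup>2) \<partial>M) = (\<integral>\<^sup>+\<omega>. liminf (\<lambda>l. ennreal ((X l \<omega> - X k \<omega>)\<^sup>2)) \<partial>M)"
    proof (rule nn_integral_cong_AE)
      show "AE \<omega> in M. ennreal ((Q \<omega> - X k \<omega>)\<^sup>2) = liminf (\<lambda>l. ennreal ((X l \<omega> - X k \<omega>)\<^sup>2))"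
        using conv
      proof eventually_elim
        case (elim \<omega>)
        then have "(\<lambda>l. X l \<omega>) \<longlonglongrightarrow> Q \<omega>" by (simp add: Q_def convergent_LIMSEQ_iff)
        then have "(\<lambda>l. ennreal ((X l \<omega> - X k \<omega>)\<^sup>2)) \<longlonglongrightarrow> ennreal ((Q \<omega> - X k \<omega>)\<^sup>2)"
          by (intro tendsto_ennrealI tendsto_intros)
        then show ?case by (rule lim_imp_Liminf[OF sequentially_bot, symmetric])
      qed
    qed
    also have "\<dots> \<le> liminf (\<lambda>l. \<integral>\<^sup>+\<omega>. ennreal ((X l \<omega> - X k \<omega>)\<^sup>2) \<partial>M)"
      by (rule nn_integral_liminf) simp
    also have "\<dots> \<le> limsup (\<lambda>l. \<integral>\<^sup>+\<omega>. ennreal ((X l \<omega> - X k \<omega>)\<^sup>2) \<partial>M)"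
      by (rule Liminf_le_Limsup) simp
    also have "\<dots> \<le> ennreal ((2 * (1/2) ^ k)\<^sup>2)"
    proof (rule Limsup_bounded)
      show "\<forall>\<^sub>F l in sequentially. (\<integral>\<^sup>+\<omega>. ennreal ((X l \<omega> - X k \<omega>)\<^sup>2) \<partial>M) \<le> ennreal ((2 * (1/2) ^ k)\<^sup>2)"
        using eventually_ge_at_top[of k]
      proof eventually_elim
        case (elim l)
        have "(\<integral>\<^sup>+\<omega>. ennreal ((X l \<omega> - X k \<omega>)\<^sup>2) \<partial>M) = ennreal (\<integral>\<omega>. (X l \<omega> - X k \<omega>)\<^sup>2 \<partial>M)"
          by (intro nn_integral_eq_integral sqd sq) auto
        also have "(\<integral>\<omega>. (X l \<omega> - X k \<omega>)\<^sup>2 \<partial>M) = (\<integral>\<omega>. (X k \<omega> - X l \<omega>)\<^sup>2 \<partial>M)"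
          by (simp add: power2_commute)
        finally show ?case using cauchy[OF elim] by (simp add: ennreal_leI)
      qed
    qed
    finally show ?thesis .
  qed
  have int: "integrable M (\<lambda>\<omega>. (Q \<omega> - X k \<omega>)\<^sup>2)" for k
  proof (rule integrableI_nonneg)
    show "(\<integral>\<^sup>+\<omega>. ennreal ((Q \<omega> - X k \<omega>)\<^sup>2) \<partial>M) < \<infinity>" using nnb[of k] by (simp add: order_le_less_trans)
  qed auto
  have le: "(\<integral>\<omega>. (Q \<omega> - X k \<omega>)\<^sup>2 \<partial>M) \<le> (2 * (1/2) ^ k)\<^sup>2" for k
  proof -
    have "ennreal (\<integral>\<omega>. (Q \<omega> - X k \<omega>)\<^sup>2 \<partial>M) = (\<integral>\<^sup>+\<omega>. ennreal ((Q \<omega> - X k \<omega>)\<^sup>2) \<partial>M)"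
      by (rule nn_integral_eq_integral[symmetric, OF int]) simp
    then have "ennreal (\<integral>\<omega>. (Q \<omega> - X k \<omega>)\<^sup>2 \<partial>M) \<le> ennreal ((2 * (1/2) ^ k)\<^sup>2)"
      using nnb[of k] by (simp only:)
    then show ?thesis by (subst (asm) ennreal_le_iff) auto
  qed
  have "integrable M (\<lambda>\<omega>. (Q \<omega> - (0 - 0))\<^sup>2)"
  proof -
    have "integrable M (\<lambda>\<omega>. ((Q \<omega> - X 0 \<omega>) - (- X 0 \<omega>))\<^sup>2)"
      by (rule sqd) (use int[of 0] sq[of 0] in auto)
    then show ?thesis by simp
  qed
  then show ?thesis using Qm int le by (intro exI[of _ Q]) auto
qed

lemma (in prob_space) char_distr_eq:
  assumes [measurable]: "X \<in> borel_measurable M"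
  shows "char (distr M borel X) t = Complex (\<integral>\<omega>. cos (t * X \<omega>) \<partial>M) (\<integral>\<omega>. sin (t * X \<omega>) \<partial>M)"
proof -
  have int: "complex_integrable M (\<lambda>\<omega>. iexp (t * X \<omega>))"
    by (rule integrable_const_bound[of _ 1]) auto
  have "char (distr M borel X) t = (CLINT \<omega>|M. iexp (t * X \<omega>))"
    unfolding char_def by (rule integral_distr) auto
  moreover have e: "Re (iexp y) = cos y" "Im (iexp y) = sin y" for y
    by (simp_all add: cis_conv_exp[symmetric])
  moreover have "Re (CLINT \<omega>|M. iexp (t * X \<omega>)) = (\<integral>\<omega>. cos (t * X \<omega>) \<partial>M)"
    by (simp only: integral_Re[OF int, symmetric] e)
  moreover have "Im (CLINT \<omega>|M. iexp (t * X \<omega>)) = (\<integral>\<omega>. sin (t * X \<omega>) \<partial>M)"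
    by (simp only: integral_Im[OF int, symmetric] e)
  ultimately show ?thesis by (simp add: complex_eq_iff)
qed

text \<open>Pointwise |u| \<le> u^2 / (2 c) + c / 2; when the mean of u^2 is at most c^2, the
  right-hand side has mean at most c.\<close>

lemma (in prob_space) L2_lipschitz_close:
  fixes h :: "real \<Rightarrow> real"
  assumes [measurable]: "X \<in> borel_measurable M" "Z \<in> borel_measurable M" "h \<in> borel_measurable borel"
    and h: "\<And>a. \<bar>h a\<bar> \<le> 1" "\<And>a b. \<bar>h a - h b\<bar> \<le> \<bar>a - b\<bar>"
    and int: "integrable M (\<lambda>\<omega>. (X \<omega> - Z \<omega>)\<^sup>2)" "(\<integral>\<omega>. (X \<omega> - Z \<omega>)\<^sup>2 \<partial>M) \<le> c\<^sup>2" and c: "0 < c"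
  shows "\<bar>(\<integral>\<omega>. h (t * X \<omega>) \<partial>M) - (\<integral>\<omega>. h (t * Z \<omega>) \<partial>M)\<bar> \<le> \<bar>t\<bar> * c"
proof -
  have i: "integrable M (\<lambda>\<omega>. h (t * X \<omega>))" "integrable M (\<lambda>\<omega>. h (t * Z \<omega>))"
    by (rule integrable_const_bound[of _ 1], use h in auto)+
  have pw: "\<bar>h (t * X \<omega>) - h (t * Z \<omega>)\<bar> \<le> \<bar>t\<bar> * ((1 / (2 * c)) * (X \<omega> - Z \<omega>)\<^sup>2 + c / 2)" for \<omega>
  proof -
    have "0 \<le> (\<bar>X \<omega> - Z \<omega>\<bar> - c)\<^sup>2" by simp
    then have "2 * c * \<bar>X \<omega> - Z \<omega>\<bar> \<le> (X \<omega> - Z \<omega>)\<^sup>2 + c * c"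
      by (simp add: power2_eq_square algebra_simps abs_mult_self)
    then have "\<bar>X \<omega> - Z \<omega>\<bar> \<le> ((X \<omega> - Z \<omega>)\<^sup>2 + c * c) / (2 * c)"
      using c by (simp add: pos_le_divide_eq mult_ac)
    then have "\<bar>t\<bar> * \<bar>X \<omega> - Z \<omega>\<bar> \<le> \<bar>t\<bar> * ((1 / (2 * c)) * (X \<omega> - Z \<omega>)\<^sup>2 + c / 2)"
      using c by (intro mult_left_mono) (auto simp: add_divide_distrib)
    moreover have "\<bar>h (t * X \<omega>) - h (t * Z \<omega>)\<bar> \<le> \<bar>t\<bar> * \<bar>X \<omega> - Z \<omega>\<bar>"
      using h(2)[of "t * X \<omega>" "t * Z \<omega>"] by (simp add: right_diff_distrib[symmetric] abs_mult)
    ultimately show ?thesis by linarith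
  qed
  have "\<bar>(\<integral>\<omega>. h (t * X \<omega>) \<partial>M) - (\<integral>\<omega>. h (t * Z \<omega>) \<partial>M)\<bar> = \<bar>\<integral>\<omega>. h (t * X \<omega>) - h (t * Z \<omega>) \<partial>M\<bar>"
    using i by simp
  also have "\<dots> \<le> (\<integral>\<omega>. \<bar>h (t * X \<omega>) - h (t * Z \<omega>)\<bar> \<partial>M)" by (rule integral_abs_bound)
  also have "\<dots> \<le> (\<integral>\<omega>. \<bar>t\<bar> * ((1 / (2 * c)) * (X \<omega> - Z \<omega>)\<^sup>2 + c / 2) \<partial>M)"
    using i int(1) by (intro integral_mono pw) auto
  also have "\<dots> = \<bar>t\<bar> * ((1 / (2 * c)) * (\<integral>\<omega>. (X \<omega> - Z \<omega>)\<^sup>2 \<partial>M) + c / 2)"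
    using int(1) by (simp add: prob_space)
  also have "\<dots> \<le> \<bar>t\<bar> * ((1 / (2 * c)) * c\<^sup>2 + c / 2)"
    using int(2) c by (intro mult_left_mono add_right_mono) auto
  also have "\<dots> = \<bar>t\<bar> * c" using c by (simp add: power2_eq_square)
  finally show ?thesis .
qed

theorem theorem1p4:
  fixes M :: "'a measure" and G :: "nat \<Rightarrow> 'a \<Rightarrow> real"
    and a :: "nat \<Rightarrow> nat set \<Rightarrow> real" and d s :: nat and \<mu> :: "real measure"
  assumes "prob_space M"
    and "prob_space.indep_vars M (\<lambda>_. borel) G UNIV"
    and "\<And>i. distr M borel (G i) = std_normal_distribution"
    and "d \<ge> 2"
    and "s \<in> {1..d - 1}"
    and "\<And>n. finite_coeffs d (a n)"
    and "(\<lambda>n. rho_tilde M G s (hom_poly d (a n))) \<longlonglongrightarrow> 0"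
    and "real_distribution \<mu>"
    and "weak_conv_m (\<lambda>n. distr M borel (\<lambda>\<omega>. hom_poly d (a n) (\<lambda>i. G i \<omega>))) \<mu>"
  shows "\<exists>Q \<in> L2_poly_closure M G (d div (s + 1)). distr M borel Q = \<mu>"
proof -
  interpret gaussian_family M G
    using assms(1-3) by (intro gaussian_family.intro gaussian_family_axioms.intro)
  have s: "s < d" using assms(4,5) by auto
  define F where "F n = hom_poly d (a n)" for n
  have "\<exists>V. finite V \<and> coeffs_in V d (a n)" for n
    using coeffs_in_exists[OF assms(6)[of n]] by blast
  then obtain V where V: "\<And>n. finite (V n)" "\<And>n. coeffs_in (V n) d (a n)" by metis
  \<comment> \<open>The law \<mu> is the limit along the whole sequence, so working along one
    ultrafilter loses nothing.\<close>
  obtain U :: "nat filter" where U: "U \<le> sequentially" "ultra U"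
    using ultra_exists[of sequentially] by auto
  interpret gaussian_ultra M G U V
    using U V(1) by unfold_locales auto
  have chF: "chaos (V n) d (F n)" for n unfolding F_def by (rule chaos_hom_poly[OF V])
  have wc: "weak_conv_m (\<lambda>n. distr M borel (\<lambda>\<omega>. F n (\<lambda>i. G i \<omega>))) \<mu>"
    using assms(9) by (simp add: F_def)
  have F: "bdch d F"
    unfolding bdch_def using chF weak_conv_nrm_bounded[OF V(1) chaos_polyf[OF chF] assms(8) wc] by blast
  have smF [simp]: "sm (F n)" for n using bd_sm[OF bdch_bd[OF F]] .
  define \<rho> where "\<rho> n = rho_tilde M G s (F n)" for n
  have \<rho>: "\<rho> \<longlonglongrightarrow> 0" using assms(7) unfolding \<rho>_def F_def .
  \<comment> \<open>The zero polynomial is admissible in the supremum.\<close>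
  have \<rho>0: "0 \<le> \<rho> n" for n
  proof -
    have b0: "finite_coeffs s (\<lambda>I. 0)" "hom_poly s (\<lambda>I. 0) = (\<lambda>x. 0)"
      by (auto simp: finite_coeffs_def hom_poly_def)
    show ?thesis unfolding \<rho>_def rho_tilde_def
      by (rule SUP_upper2[of "\<lambda>I. 0"]) (auto simp: b0 L2_norm_def)
  qed
  \<comment> \<open>At an infinite value \<open>real_of_ereal\<close> would return 0; smallness is
    therefore claimed only where \<open>\<rho> n\<close> < 1, which holds eventually.\<close>
  define \<epsilon> where "\<epsilon> n = real_of_ereal (\<rho> n)" for n
  have \<epsilon>0: "0 \<le> \<epsilon> n" for n unfolding \<epsilon>_def using \<rho>0 by (simp add: real_of_ereal_pos)
  have "(\<epsilon> \<longlongrightarrow> 0) sequentially"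
    unfolding \<epsilon>_def[abs_def] using \<rho> by (intro lim_real_of_ereal) (simp add: zero_ereal_def)
  then have \<epsilon>: "(\<epsilon> \<longlongrightarrow> 0) U" by (rule tendsto_mono[OF U(1)])
  have "eventually (\<lambda>n. \<rho> n < 1) sequentially" using \<rho> by (rule order_tendstoD) simp
  then have "eventually (\<lambda>n. \<rho> n < 1) U" using U(1) filter_leD by blast
  then have sml: "\<forall>\<^sub>F n in U. 0 \<le> \<epsilon> n \<and> small (V n) d s (\<epsilon> n) (F n)"
  proof eventually_elim
    case (elim n)
    have "\<rho> n = ereal (\<epsilon> n)" using elim \<rho>0[of n] unfolding \<epsilon>_def by (cases "\<rho> n") auto
    then have "rho_tilde M G s (hom_poly d (a n)) \<le> ereal (\<epsilon> n)" by (simp add: \<rho>_def F_def)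
    then show ?case using rho_tilde_small[OF V s _ \<epsilon>0] \<epsilon>0 unfolding F_def by simp
  qed
  from polynomial_limit[OF F s sml \<epsilon>] obtain p where
    p: "\<forall>k. \<exists>W. finite W \<and> polyf W (d div Suc s) (p k)"
    "\<forall>k l. k \<le> l \<longrightarrow> nrm (\<lambda>x. p k x - p l x) \<le> (1/2) ^ k + (1/2) ^ l"
    "\<forall>k t c. ((\<lambda>n. E (\<lambda>x. cos (t * F n x))) \<longlongrightarrow> c) U \<longrightarrow> \<bar>c - E (\<lambda>x. cos (t * p k x))\<bar> \<le> \<bar>t\<bar> * (1/2) ^ k"
    "\<forall>k t c. ((\<lambda>n. E (\<lambda>x. sin (t * F n x))) \<longlongrightarrow> c) U \<longrightarrow> \<bar>c - E (\<lambda>x. sin (t * p k x))\<bar> \<le> \<bar>t\<bar> * (1/2) ^ k"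
    by (elim exE conjE)
  have smp [simp]: "sm (p k)" for k using p(1) wpoly_sm by blast
  define X where "X k \<omega> = p k (\<lambda>i. G i \<omega>)" for k \<omega>
  have Xm [measurable]: "X k \<in> borel_measurable M" for k unfolding X_def[abs_def] by (rule sm_measurable) simp
  have "\<exists>Q. Q \<in> borel_measurable M \<and> integrable M (\<lambda>\<omega>. (Q \<omega>)\<^sup>2) \<and>
    (\<forall>k. integrable M (\<lambda>\<omega>. (Q \<omega> - X k \<omega>)\<^sup>2) \<and> (\<integral>\<omega>. (Q \<omega> - X k \<omega>)\<^sup>2 \<partial>M) \<le> (2 * (1/2) ^ k)\<^sup>2)"
  proof (rule L2_limit_exists[OF Xm])
    show "integrable M (\<lambda>\<omega>. (X k \<omega>)\<^sup>2)" for k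
      unfolding X_def by (rule sm_integrable[of "\<lambda>x. (p k x)\<^sup>2"]) simp
    fix k l :: nat assume kl: "k \<le> l"
    have "(1/2::real) ^ l \<le> (1/2) ^ k" using kl by (intro power_decreasing) auto
    then have "nrm (\<lambda>x. p k x - p l x) \<le> 2 * (1/2) ^ k" using p(2)[rule_format, OF kl] by linarith
    then have "(nrm (\<lambda>x. p k x - p l x))\<^sup>2 \<le> (2 * (1/2) ^ k)\<^sup>2" by (intro power_mono) auto
    then show "(\<integral>\<omega>. (X k \<omega> - X l \<omega>)\<^sup>2 \<partial>M) \<le> (2 * (1/2) ^ k)\<^sup>2" by (simp add: nrm_sq E_def X_def)
  qed
  then obtain Q where Q: "Q \<in> borel_measurable M" "integrable M (\<lambda>\<omega>. (Q \<omega>)\<^sup>2)"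
    and QX: "\<And>k. integrable M (\<lambda>\<omega>. (Q \<omega> - X k \<omega>)\<^sup>2)" "\<And>k. (\<integral>\<omega>. (Q \<omega> - X k \<omega>)\<^sup>2 \<partial>M) \<le> (2 * (1/2) ^ k)\<^sup>2" by blast
  have "Q \<in> L2_poly_closure M G (d div (s + 1))"
    unfolding L2_poly_closure_def
  proof (intro CollectI conjI allI impI)
    fix \<eta> :: real assume "\<eta> > 0"
    moreover have "(\<lambda>k. 2 * (1/2) ^ k :: real) \<longlonglongrightarrow> 0" by real_asymp
    ultimately have "eventually (\<lambda>k. 2 * (1/2) ^ k < \<eta>) sequentially" by (intro order_tendstoD(2))
    then obtain k where k: "2 * (1/2) ^ k < \<eta>" by (auto simp: eventually_sequentially)
    obtain q where q: "total_degree q \<le> d div Suc s" "p k = mpoly_eval q" using p(1) polyf_mpoly by blast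
    have "L2_norm M (\<lambda>\<omega>. Q \<omega> - mpoly_eval q (\<lambda>i. G i \<omega>)) \<le> sqrt ((2 * (1/2) ^ k)\<^sup>2)"
      unfolding L2_norm_def using QX(2)[of k] by (intro real_sqrt_le_mono) (simp add: X_def q(2))
    also have "sqrt ((2 * (1/2) ^ k)\<^sup>2) = 2 * (1/2) ^ k" by (rule real_sqrt_unique) auto
    also have "\<dots> < \<eta>" by (rule k)
    finally show "\<exists>p. total_degree p \<le> d div (s + 1) \<and> L2_norm M (\<lambda>\<omega>. Q \<omega> - mpoly_eval p (\<lambda>i. G i \<omega>)) < \<eta>"
      using q by auto
  qed (use Q in auto)
  moreover have "distr M borel Q = \<mu>"
  proof (rule Levy_uniqueness)
    show "real_distribution (distr M borel Q)" by (rule real_distribution_distr[OF Q(1)])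
    show "real_distribution \<mu>" by fact
    show "char (distr M borel Q) = char \<mu>"
    proof
      fix t
      have Fm: "(\<lambda>\<omega>. F n (\<lambda>i. G i \<omega>)) \<in> borel_measurable M" for n by (rule sm_measurable) simp
      have "(\<lambda>n. char (distr M borel (\<lambda>\<omega>. F n (\<lambda>i. G i \<omega>))) t) \<longlonglongrightarrow> char \<mu> t"
        by (rule levy_continuity1[OF real_distribution_distr[OF Fm] assms(8) wc])
      \<comment> \<open>Convergence along the sequence passes to \<open>U\<close> and identifies the
        ultralimits of the cosine and sine expectations with the characteristic function of
        \<mu>.\<close>
      then have "((\<lambda>n. Complex (E (\<lambda>x. cos (t * F n x))) (E (\<lambda>x. sin (t * F n x)))) \<longlongrightarrow> char \<mu> t) U"
        unfolding char_distr_eq[OF Fm] E_def by (rule tendsto_mono[OF U(1)])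
      then have cs: "((\<lambda>n. E (\<lambda>x. cos (t * F n x))) \<longlongrightarrow> Re (char \<mu> t)) U"
        "((\<lambda>n. E (\<lambda>x. sin (t * F n x))) \<longlongrightarrow> Im (char \<mu> t)) U"
        by (auto dest: tendsto_Re tendsto_Im)
      \<comment> \<open>For every k, both numbers are within a multiple of (1/2)^k of the
        expectation for \<open>p k\<close>.\<close>
      have eq: "c = (\<integral>\<omega>. h (t * Q \<omega>) \<partial>M)"
        if h: "h \<in> borel_measurable borel" "\<And>a. \<bar>h a\<bar> \<le> 1" "\<And>a b. \<bar>h a - h b\<bar> \<le> \<bar>a - b\<bar>"
        and c: "\<And>k. \<bar>c - E (\<lambda>x. h (t * p k x))\<bar> \<le> \<bar>t\<bar> * (1/2) ^ k" for h :: "real \<Rightarrow> real" and c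
      proof -
        have "\<bar>c - (\<integral>\<omega>. h (t * Q \<omega>) \<partial>M)\<bar> \<le> \<bar>t\<bar> * (1/2) ^ k + \<bar>t\<bar> * (2 * (1/2) ^ k)" for k
        proof -
          have "\<bar>(\<integral>\<omega>. h (t * Q \<omega>) \<partial>M) - (\<integral>\<omega>. h (t * X k \<omega>) \<partial>M)\<bar> \<le> \<bar>t\<bar> * (2 * (1/2) ^ k)"
            by (rule L2_lipschitz_close[OF Q(1) Xm h QX]) simp
          moreover have "(\<integral>\<omega>. h (t * X k \<omega>) \<partial>M) = E (\<lambda>x. h (t * p k x))" by (simp add: E_def X_def)
          ultimately show ?thesis using c[of k] by linarith
        qed
        moreover have "(\<lambda>k. \<bar>t\<bar> * (1/2) ^ k + \<bar>t\<bar> * (2 * (1/2) ^ k)) \<longlonglongrightarrow> 0" by real_asymp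
        ultimately have "\<bar>c - (\<integral>\<omega>. h (t * Q \<omega>) \<partial>M)\<bar> \<le> 0"
          by - (rule LIMSEQ_le_const, assumption, blast)
        then show ?thesis by simp
      qed
      have "Re (char \<mu> t) = (\<integral>\<omega>. cos (t * Q \<omega>) \<partial>M)"
        by (rule eq) (use p(3) cs(1) abs_cos_diff_le in auto)
      moreover have "Im (char \<mu> t) = (\<integral>\<omega>. sin (t * Q \<omega>) \<partial>M)"
        by (rule eq) (use p(4) cs(2) abs_sin_diff_le in auto)
      ultimately show "char (distr M borel Q) t = char \<mu> t"
        unfolding char_distr_eq[OF Q(1)] by (simp add: complex_eq_iff)
    qed
  qed
  ultimately show ?thesis by blast
qed

end
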